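(* Let $X$ be the Ornstein–Uhlenbeck process $dX_t=\mu(\theta-X_t)\,dt+\sigma\,dB_t$ with constants $\mu,\sigma>0$, $\theta\in\mathbb{R}$, driven by a standard Brownian motion $B$, let $r>0$, $c_s>0$, $c_b>0$ be constants, and let $\mathcal{T}$ be the set of stopping times with respect to the filtration generated by $B$. Define \[F(x)=\int_0^\infty u^{\frac{r}{\mu}-1}e^{\sqrt{\frac{2\mu}{\sigma^2}}(x-\theta)u-\frac{u^2}{2}}\,du,\qquad G(x)=\int_0^\infty u^{\frac{r}{\mu}-1}e^{\sqrt{\frac{2\mu}{\sigma^2}}(\theta-x)u-\frac{u^2}{2}}\,du,\] let $V(x)=\sup_{\tau\in\mathcal{T}}\mathbb{E}_x\{e^{-r\tau}(e^{X_\tau}-c_s)\}$, and \[J(x)=\sup_{\nu\in\mathcal{T}}\mathbb{E}_x\{e^{-r\nu}(V(X_\nu)-e^{X_\nu}-c_b)\}.\] Assume $\sup_{x\in\mathbb{R}}(V(x)-e^x-c_b)>0$. Then \[J(x)=\begin{cases}PF(x), & x\in(-\infty,a^* ),\\ V(x)-(e^x+c_b), & x\in[a^*,d^*],\\ QG(x), & x\in(d^*,+\infty),\end{cases}\] with constants $P=\frac{V(a^* )-(e^{a^*}+c_b)}{F(a^* )}$, $Q=\frac{V(d^* )-(e^{d^*}+c_b)}{G(d^* )}$, where the critical levels $a^*$ and $d^*$ satisfy respectively \[F(a)(V'(a)-e^a)=F'(a)(V(a)-(e^a+c_b)),\qquad G(d)(V'(d)-e^d)=G'(d)(V(d)-(e^d+c_b)).\]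 The optimal entry time is $\nu_{a^*,d^*}=\inf\{t\ge0: X_t\in[a^*,d^*]\}$.
   Context: $\mathbb{E}_x$ denotes expectation given $X_0=x$. $F,G$ are the increasing and decreasing positive solutions of $\frac{\sigma^2}{2}u''+\mu(\theta-x)u'=ru$. *)

theory Defs
  imports "HOL-Probability.Probability"
begin

definition brownian_motion :: "'a measure \<Rightarrow> (real \<Rightarrow> 'a \<Rightarrow> real) \<Rightarrow> bool" where
  "brownian_motion M B \<longleftrightarrow>
     prob_space M \<and>
     (\<forall>t. B t \<in> borel_measurable M) \<and>
     (\<forall>\<omega>\<in>space M. B 0 \<omega> = 0 \<and> continuous_on {0..} (\<lambda>t. B t \<omega>)) \<and>
     (\<forall>s t. 0 \<le> s \<and> s < t \<longrightarrow>
        distributed M lborel (\<lambda>\<omega>. B t \<omega> - B s \<omega>)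
          (\<lambda>y. ennreal (normal_density 0 (sqrt (t - s)) y))) \<and>
     (\<forall>(ts :: nat \<Rightarrow> real) n. 0 \<le> ts 0 \<and> strict_mono ts \<longrightarrow>
        prob_space.indep_vars M (\<lambda>_. borel) (\<lambda>i \<omega>. B (ts (Suc i)) \<omega> - B (ts i) \<omega>) {..<n})"

definition nat_filtration :: "'a measure \<Rightarrow> (real \<Rightarrow> 'a \<Rightarrow> real) \<Rightarrow> real \<Rightarrow> 'a set set" where
  "nat_filtration M B t =
     sigma_sets (space M) (\<Union>s\<in>{0..t}. {B s -` A \<inter> space M | A. A \<in> sets borel})"

definition B_stopping_time :: "'a measure \<Rightarrow> (real \<Rightarrow> 'a \<Rightarrow> real) \<Rightarrow> ('a \<Rightarrow> ennreal) \<Rightarrow> bool" where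
  "B_stopping_time M B \<tau> \<longleftrightarrow>
     (\<forall>t\<ge>0. {\<omega>\<in>space M. \<tau> \<omega> \<le> ennreal t} \<in> nat_filtration M B t)"

definition disc_reward ::
  "(real \<Rightarrow> real \<Rightarrow> 'a \<Rightarrow> real) \<Rightarrow> real \<Rightarrow> (real \<Rightarrow> real) \<Rightarrow> ('a \<Rightarrow> ennreal) \<Rightarrow> real \<Rightarrow> 'a \<Rightarrow> real" where
  "disc_reward X r g \<tau> x \<omega> =
     (if \<tau> \<omega> = \<infinity> then 0
      else exp (- r * enn2real (\<tau> \<omega>)) * g (X x (enn2real (\<tau> \<omega>)) \<omega>))"

definition opt_stop_value ::
  "'a measure \<Rightarrow> (real \<Rightarrow> 'a \<Rightarrow> real) \<Rightarrow> (real \<Rightarrow> real \<Rightarrow> 'a \<Rightarrow> real) \<Rightarrow> real \<Rightarrow> (real \<Rightarrow> real) \<Rightarrow> real \<Rightarrow> real" where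
  "opt_stop_value M B X r g x =
     (SUP \<tau>\<in>{\<tau>. B_stopping_time M B \<tau>}. integral\<^sup>L M (disc_reward X r g \<tau> x))"

text \<open>X x is the OU process started at x, written in pathwise integral form
  X_t = x + \<integral>_0^t \<mu>(\<theta> - X_s) ds + \<sigma> B_t (equivalent to the SDE since \<sigma> is constant).\<close>
definition OU_process ::
  "'a measure \<Rightarrow> (real \<Rightarrow> 'a \<Rightarrow> real) \<Rightarrow> real \<Rightarrow> real \<Rightarrow> real \<Rightarrow> (real \<Rightarrow> real \<Rightarrow> 'a \<Rightarrow> real) \<Rightarrow> bool" where
  "OU_process M B \<mu> \<theta> \<sigma> X \<longleftrightarrow>
     (\<forall>x. \<forall>\<omega>\<in>space M. continuous_on {0..} (\<lambda>t. X x t \<omega>) \<and>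
        (\<forall>t\<ge>0. X x t \<omega> = x + integral {0..t} (\<lambda>s. \<mu> * (\<theta> - X x s \<omega>)) + \<sigma> * B t \<omega>))"

definition OU_F :: "real \<Rightarrow> real \<Rightarrow> real \<Rightarrow> real \<Rightarrow> real \<Rightarrow> real" where
  "OU_F \<mu> \<sigma> \<theta> r x =
     (LBINT u:{0<..}. u powr (r / \<mu> - 1) * exp (sqrt (2 * \<mu> / \<sigma>\<^sup>2) * (x - \<theta>) * u - u\<^sup>2 / 2))"

definition OU_G :: "real \<Rightarrow> real \<Rightarrow> real \<Rightarrow> real \<Rightarrow> real \<Rightarrow> real" where
  "OU_G \<mu> \<sigma> \<theta> r x =
     (LBINT u:{0<..}. u powr (r / \<mu> - 1) * exp (sqrt (2 * \<mu> / \<sigma>\<^sup>2) * (\<theta> - x) * u - u\<^sup>2 / 2))"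

text \<open>First entry time of X (started at x) into [a,d]; Inf of the empty set is \<infinity>.\<close>
definition entry_time ::
  "(real \<Rightarrow> real \<Rightarrow> 'a \<Rightarrow> real) \<Rightarrow> real \<Rightarrow> real \<Rightarrow> real \<Rightarrow> 'a \<Rightarrow> ennreal" where
  "entry_time X a d x \<omega> = Inf (ennreal ` {t. 0 \<le> t \<and> X x t \<omega> \<in> {a..d}})"

end

theory Submission
  imports Defs "HOL-Real_Asymp.Real_Asymp"
begin

text \<open>
  The functions \<open>F\<close> and \<open>G\<close> are mixtures of exponentials, so Tonelli and the Gaussian moment generating
  function show directly that \<open>exp (- r * t) * F (X t)\<close> and \<open>exp (- r * t) * G (X t)\<close> are martingales; no Ito
  formula is needed. A nonnegative \<open>U\<close> that at every point is touched from above by some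
  \<open>\<alpha> * F + \<beta> * G\<close> therefore yields a supermartingale and dominates every stopping reward below it.
  For a \<open>C\<^sup>1\<close> function this touching property follows from \<open>\<sigma>\<^sup>2 / 2 * U'' + \<mu> * (\<theta> - x) * U' \<le> r * U\<close>
  holding piecewise, by monotonicity of a weighted Wronskian.

  The exit level \<open>b\<close> maximises \<open>(exp x - c\<^sub>s) / F x\<close>. The entry levels \<open>a\<close> and \<open>d\<close> maximise
  \<open>h / F\<close> and \<open>h / G\<close> for \<open>h x = V x - exp x - c\<^sub>b\<close>: the first-order conditions are the two
  equations of the theorem, monotonicity of \<open>F / G\<close> gives \<open>a \<le> d\<close>, and the second-order conditions give
  \<open>\<sigma>\<^sup>2 / 2 * h'' + \<mu> * (\<theta> - x) * h' \<le> r * h\<close> at \<open>a\<close> and \<open>d\<close>, hence on \<open>[a, d]\<close> by convexity.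
\<close>

section \<open>Parabolic cylinder functions\<close>

text \<open>The suprema \<open>V\<close> and \<open>J\<close> range over all stopping times, so at
  the outset nothing is known about their size or smoothness. Both are found by verification: an
  explicit candidate (\<open>W\<close>, then \<open>Y\<close>) is superharmonic and dominates the
  reward, which bounds every stopping time, and an entry time attains it. Only once
  \<open>V = W\<close> is known do the equations at the entry levels concern derivatives of an
  explicit function.

  Attainment is the harder half. Hitting times are unbounded and so are \<open>F\<close> and
  \<open>G\<close>; equality in optional stopping relies on the path staying, until it hits the
  level, on the side where the chosen solution is at most its value at the level.

  The filtration is the raw one generated by \<open>B\<close>, neither completed nor
  right-continuous. Adaptedness of \<open>X\<close> and the stopping property of entry times must
  therefore hold path by path, not almost surely. This is why the noise of \<open>X\<close> is
  obtained as a pathwise limit of Riemann sums, and why closedness of [a, d] matters.\<close>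

definition pcf_int :: "real \<Rightarrow> real \<Rightarrow> real \<Rightarrow> real" where
  "pcf_int p z u = u powr (p - 1) * exp (z * u - u\<^sup>2 / 2)"

text \<open>With \<open>D\<close> the parabolic cylinder function, \<open>pcf p z\<close> is
  Gamma(p) exp(z^2/4) D_{-p}(-z). Left unnormalised, a derivative in \<open>z\<close> is just a
  shift of \<open>p\<close> by one.\<close>

definition pcf :: "real \<Rightarrow> real \<Rightarrow> real" where
  "pcf p z = (LBINT u:{0<..}. pcf_int p z u)"

lemma pcf_int_measurable [measurable]:
  "(\<lambda>(z, u). pcf_int p z u) \<in> borel_measurable (borel \<Otimes>\<^sub>M borel)"
  "pcf_int p z \<in> borel_measurable borel"
  unfolding pcf_int_def[abs_def] by measurable

lemma pcf_int_nonneg: "pcf_int p z u \<ge> 0"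
  by (simp add: pcf_int_def)

lemma powr_exp_integrable:
  fixes p :: real
  assumes "p > 0"
  shows "set_integrable lborel {0<..} (\<lambda>u::real. u powr (p - 1) * exp (- u))"
proof -
  have "((\<lambda>t. t powr (p - 1) / exp t) has_integral Gamma p) {0..}"
    by (rule Gamma_integral_real[OF assms])
  then have "(\<lambda>t. t powr (p - 1) / exp t) integrable_on {0..}" by blast
  then have "(\<lambda>t. t powr (p - 1) / exp t) absolutely_integrable_on {0..}"
    by (rule nonnegative_absolutely_integrable_1) auto
  then have "set_integrable lebesgue {0<..} (\<lambda>t. t powr (p - 1) / exp t)"
    by (rule set_integrable_subset) auto
  then show ?thesis
    unfolding set_integrable_def
    by (subst (asm) integrable_completion) (auto simp: exp_minus field_simps)
qed

text \<open>Completing the square bounds the Gaussian factor by a multiple of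
  \<open>exp (- u)\<close>, which leaves the Gamma integral.\<close>

lemma pcf_integrable:
  assumes "p > 0"
  shows "set_integrable lborel {0<..} (pcf_int p z)"
proof -
  have "set_integrable lborel {0<..} (\<lambda>u. exp ((z + 1)\<^sup>2 / 2) * (u powr (p - 1) * exp (- u)))"
    using powr_exp_integrable[OF assms] by (rule set_integrable_mult_right)
  then show ?thesis
  proof (rule set_integrable_bound)
    show "set_borel_measurable lborel {0<..} (pcf_int p z)"
      unfolding set_borel_measurable_def by measurable
    show "AE u in lborel. u \<in> {0<..} \<longrightarrow>
        norm (pcf_int p z u) \<le> norm (exp ((z + 1)\<^sup>2 / 2) * (u powr (p - 1) * exp (- u)))"
    proof (intro AE_I2 impI)
      fix u :: real
      have "z * u - u\<^sup>2 / 2 \<le> (z + 1)\<^sup>2 / 2 + - u"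
        using zero_le_power2[of "u - (z + 1)"] by (simp add: power2_eq_square algebra_simps)
      then have "exp (z * u - u\<^sup>2 / 2) \<le> exp ((z + 1)\<^sup>2 / 2) * exp (- u)"
        by (simp add: exp_add[symmetric])
      then have "u powr (p - 1) * exp (z * u - u\<^sup>2 / 2)
          \<le> u powr (p - 1) * (exp ((z + 1)\<^sup>2 / 2) * exp (- u))"
        by (rule mult_left_mono) simp
      then show "norm (pcf_int p z u) \<le> norm (exp ((z + 1)\<^sup>2 / 2) * (u powr (p - 1) * exp (- u)))"
        by (simp add: pcf_int_def ac_simps)
    qed
  qed
qed

lemma ennreal_pcf:
  assumes "p > 0"
  shows "ennreal (pcf p z) = (\<integral>\<^sup>+u. indicator {0<..} u * ennreal (pcf_int p z u) \<partial>lborel)"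
proof -
  have "(\<integral>\<^sup>+u. ennreal (indicator {0<..} u *\<^sub>R pcf_int p z u) \<partial>lborel) = ennreal (pcf p z)"
    unfolding pcf_def set_lebesgue_integral_def
    using pcf_integrable[OF assms, of z]
    by (intro nn_integral_eq_integral) (auto simp: set_integrable_def pcf_int_nonneg)
  also have "(\<integral>\<^sup>+u. ennreal (indicator {0<..} u *\<^sub>R pcf_int p z u) \<partial>lborel)
      = (\<integral>\<^sup>+u. indicator {0<..} u * ennreal (pcf_int p z u) \<partial>lborel)"
    by (intro nn_integral_cong) (auto simp: indicator_def)
  finally show ?thesis ..
qed

lemma pcf_int_Icc_pos:
  assumes "m > 0"
  shows "(LBINT u:{m..m+1}. pcf_int p z u) > 0"
proof -
  have c: "continuous_on {m..m+1} (pcf_int p z)"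
    unfolding pcf_int_def[abs_def] using assms by (intro continuous_intros) auto
  then obtain u0 where u0: "u0 \<in> {m..m+1}" "\<And>u. u \<in> {m..m+1} \<Longrightarrow> pcf_int p z u0 \<le> pcf_int p z u"
    using continuous_attains_inf[of "{m..m+1}" "pcf_int p z"] by auto
  have "0 < pcf_int p z u0" using u0 assms by (auto simp: pcf_int_def)
  also have "\<dots> = (LBINT u:{m..m+1}. pcf_int p z u0)" by (simp add: set_lebesgue_integral_def)
  also have "\<dots> \<le> (LBINT u:{m..m+1}. pcf_int p z u)"
    using u0 by (intro set_integral_mono borel_integrable_atLeastAtMost' c) auto
  finally show ?thesis .
qed

lemma pcf_ge_Icc:
  assumes "p > 0" "m > 0"
  shows "(LBINT u:{m..m+1}. pcf_int p z u) \<le> pcf p z"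
proof -
  have i: "set_integrable lborel {m..m+1} (pcf_int p z)"
    by (rule set_integrable_subset[OF pcf_integrable[OF assms(1)]]) (use assms in auto)
  show ?thesis
    using pcf_integrable[OF assms(1), of z] i assms(2)
    unfolding pcf_def set_lebesgue_integral_def set_integrable_def
    by (intro integral_mono) (auto simp: pcf_int_nonneg indicator_def)
qed

text \<open>On the window [m, m + 1] the factor \<open>exp (z * u)\<close> is at least
  \<open>exp (m * z)\<close>, so growth is at least exponential at any prescribed rate. The rate is
  chosen later so that \<open>F\<close> outgrows \<open>exp\<close>.\<close>

lemma pcf_ge:
  fixes m :: real
  assumes "p > 0" "m > 0"
  obtains c where "c > 0" "\<And>z. z \<ge> 0 \<Longrightarrow> pcf p z \<ge> c * exp (m * z)"
proof
  let ?c = "LBINT u:{m..m+1}. pcf_int p 0 u"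
  show "?c > 0" using assms by (rule_tac pcf_int_Icc_pos)
  have i: "set_integrable lborel {m..m+1} (pcf_int p z)" for z
    by (rule set_integrable_subset[OF pcf_integrable[OF assms(1)]]) (use assms in auto)
  fix z :: real assume z: "z \<ge> 0"
  have "?c * exp (m * z) = (LBINT u:{m..m+1}. exp (m * z) * pcf_int p 0 u)" by simp
  also have "\<dots> \<le> (LBINT u:{m..m+1}. pcf_int p z u)"
  proof (rule set_integral_mono)
    fix u assume "u \<in> {m..m+1}"
    then have "m * z \<le> z * u" using mult_left_mono[of m u z] z by (simp add: mult.commute)
    then have "exp (m * z) * exp (- u\<^sup>2 / 2) \<le> exp (z * u - u\<^sup>2 / 2)"
      by (simp add: exp_add[symmetric])
    then show "exp (m * z) * pcf_int p 0 u \<le> pcf_int p z u"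
      using mult_left_mono[of "exp (m * z) * exp (- u\<^sup>2 / 2)" "exp (z * u - u\<^sup>2 / 2)" "u powr (p - 1)"]
      by (simp add: pcf_int_def mult.left_commute)
  qed (use i in \<open>auto intro: set_integrable_mult_right\<close>)
  also have "\<dots> \<le> pcf p z" by (rule pcf_ge_Icc[OF assms])
  finally show "pcf p z \<ge> ?c * exp (m * z)" .
qed

lemma pcf_pos: "p > 0 \<Longrightarrow> pcf p z > 0"
  using pcf_int_Icc_pos[of 1 p z] pcf_ge_Icc[of p 1 z] by simp

text \<open>The bound is uniform in \<open>h\<close>, and the factor \<open>u * exp u\<close> turns
  \<open>pcf_int p z\<close> into \<open>pcf_int (p + 1) (z + 1)\<close>, the dominating function
  for differentiating under the integral.\<close>

lemma exp_diff_quotient_le: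
  fixes h u :: real
  assumes "h \<noteq> 0" "\<bar>h\<bar> \<le> 1" "u \<ge> 0"
  shows "\<bar>(exp (h * u) - 1) / h\<bar> \<le> u * exp u"
proof -
  have "\<bar>exp (h * u) - 1\<bar> \<le> \<bar>h * u\<bar> * exp \<bar>h * u\<bar>"
  proof (cases "h * u \<ge> 0")
    case True
    have "1 - exp (- (h * u)) \<le> h * u" using exp_ge_add_one_self[of "- (h * u)"] by linarith
    then have "exp (h * u) * (1 - exp (- (h * u))) \<le> exp (h * u) * (h * u)" by (rule mult_left_mono) simp
    then show ?thesis using True by (simp add: algebra_simps exp_minus)
  next
    case False
    then have "1 - exp (h * u) \<le> \<bar>h * u\<bar>" using exp_ge_add_one_self[of "h * u"] by linarith
    also have "\<dots> \<le> \<bar>h * u\<bar> * exp \<bar>h * u\<bar>" 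
      using mult_left_mono[of 1 "exp \<bar>h * u\<bar>" "\<bar>h * u\<bar>"] by simp
    finally show ?thesis using False by simp
  qed
  also have "\<dots> \<le> (\<bar>h\<bar> * u) * exp u"
    using assms by (intro mult_mono) (auto simp: abs_mult mult_left_le_one_le)
  finally show ?thesis using assms by (simp add: divide_simps ac_simps)
qed

lemma pcf_DERIV:
  assumes "p > 0"
  shows "(pcf p has_real_derivative pcf (p + 1) z) (at z)"
  unfolding has_field_derivative_iff tendsto_at_iff_sequentially
proof (intro allI impI)
  fix X :: "nat \<Rightarrow> real"
  assume X0: "\<forall>i. X i \<in> UNIV - {z}" and X: "X \<longlonglongrightarrow> z"
  \<comment> \<open>The domination holds for increments of size at most 1, so finitely many terms of
    the sequence are dropped.\<close>
  have "\<forall>\<^sub>F n in sequentially. dist (X n) z < 1" using X by (rule tendstoD) simp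
  then obtain N where N: "\<And>n. n \<ge> N \<Longrightarrow> dist (X n) z < 1" by (auto simp: eventually_sequentially)
  define Y where "Y n = X (n + N)" for n
  have Y: "Y \<longlonglongrightarrow> z" unfolding Y_def using X by (rule LIMSEQ_ignore_initial_segment)
  have Y0: "Y n \<noteq> z" and Y1: "\<bar>Y n - z\<bar> \<le> 1" for n
    using X0 N[of "n + N"] by (auto simp: Y_def dist_real_def)
  let ?q = "\<lambda>n u. (pcf_int p (Y n) u - pcf_int p z u) / (Y n - z)"
  have q: "?q n u = pcf_int p z u * ((exp ((Y n - z) * u) - 1) / (Y n - z))" for n u
  proof -
    have "pcf_int p (Y n) u = pcf_int p z u * exp ((Y n - z) * u)"
      by (simp add: pcf_int_def exp_add[symmetric] algebra_simps)
    then show ?thesis by (simp add: algebra_simps diff_divide_distrib)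
  qed
  have "(\<lambda>n. LINT u|lborel. indicator {0<..} u *\<^sub>R ?q n u) \<longlonglongrightarrow>
      (LINT u|lborel. indicator {0<..} u *\<^sub>R pcf_int (p + 1) z u)"
  proof (rule integral_dominated_convergence[where w = "\<lambda>u. indicator {0<..} u *\<^sub>R pcf_int (p + 1) (z + 1) u"])
    show "integrable lborel (\<lambda>u. indicat_real {0<..} u *\<^sub>R pcf_int (p + 1) (z + 1) u)"
      using pcf_integrable[of "p + 1" "z + 1"] assms by (simp add: set_integrable_def)
    show "AE u in lborel. (\<lambda>n. indicator {0<..} u *\<^sub>R ?q n u) \<longlonglongrightarrow> indicator {0<..} u *\<^sub>R pcf_int (p + 1) z u"
    proof (rule AE_I2)
      fix u :: real
      show "(\<lambda>n. indicator {0<..} u *\<^sub>R ?q n u) \<longlonglongrightarrow> indicator {0<..} u *\<^sub>R pcf_int (p + 1) z u"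
      proof (cases "u > 0")
        case True
        have "((\<lambda>y. pcf_int p y u) has_real_derivative pcf_int (p + 1) z u) (at z)"
          unfolding pcf_int_def using True
          by (auto intro!: derivative_eq_intros simp: powr_diff field_simps)
        then have "(\<lambda>n. ?q n u) \<longlonglongrightarrow> pcf_int (p + 1) z u"
          using Y Y0 unfolding has_field_derivative_iff tendsto_at_iff_sequentially comp_def by auto
        then show ?thesis by (rule tendsto_scaleR[OF tendsto_const])
      qed simp
    qed
    show "AE u in lborel. norm (indicator {0<..} u *\<^sub>R ?q n u)
        \<le> indicator {0<..} u *\<^sub>R pcf_int (p + 1) (z + 1) u" for n
    proof (rule AE_I2)
      fix u :: real
      show "norm (indicator {0<..} u *\<^sub>R ?q n u) \<le> indicator {0<..} u *\<^sub>R pcf_int (p + 1) (z + 1) u"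
      proof (cases "u > 0")
        case True
        have "\<bar>?q n u\<bar> \<le> pcf_int p z u * (u * exp u)"
          unfolding q abs_mult using exp_diff_quotient_le[of "Y n - z" u] Y0 Y1 True
          by (intro mult_mono) (auto simp: pcf_int_nonneg)
        also have "\<dots> = pcf_int (p + 1) (z + 1) u"
          using True by (simp add: pcf_int_def powr_diff exp_add[symmetric] field_simps)
        finally show ?thesis using True by simp
      qed simp
    qed
  qed measurable
  moreover have "(LINT u|lborel. indicator {0<..} u *\<^sub>R ?q n u) = (pcf p (Y n) - pcf p z) / (Y n - z)" for n
  proof -
    have "(LINT u|lborel. indicator {0<..} u *\<^sub>R ?q n u) = (LBINT u:{0<..}. ?q n u)"
      by (simp add: set_lebesgue_integral_def)
    also have "\<dots> = (LBINT u:{0<..}. pcf_int p (Y n) u - pcf_int p z u) / (Y n - z)"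
      unfolding set_lebesgue_integral_def by (simp flip: integral_divide_zero)
    also have "\<dots> = (pcf p (Y n) - pcf p z) / (Y n - z)"
      unfolding pcf_def by (subst set_integral_diff(2)) (use pcf_integrable[OF assms] in auto)
    finally show ?thesis .
  qed
  ultimately have "(\<lambda>n. (pcf p (Y n) - pcf p z) / (Y n - z)) \<longlonglongrightarrow> pcf (p + 1) z"
    unfolding pcf_def[of "p + 1"] set_lebesgue_integral_def by (simp only:)
  then have "(\<lambda>n. (pcf p (X (n + N)) - pcf p z) / (X (n + N) - z)) \<longlonglongrightarrow> pcf (p + 1) z" by (simp add: Y_def)
  then show "((\<lambda>y. (pcf p y - pcf p z) / (y - z)) \<circ> X) \<longlonglongrightarrow> pcf (p + 1) z"
    unfolding comp_def by (rule LIMSEQ_offset)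
qed

lemma pcf_at_bot:
  assumes "p > 0"
  shows "(pcf p \<longlongrightarrow> 0) at_bot"
proof -
  have "((\<lambda>t. LBINT u:{0<..}. pcf_int p (- t) u) \<longlongrightarrow> (LINT u::real|lborel. (0::real))) at_top"
    unfolding set_lebesgue_integral_def
  proof (rule integral_dominated_convergence_at_top[where w = "\<lambda>u. indicator {0<..} u *\<^sub>R pcf_int p 0 u"])
    show "\<forall>\<^sub>F t in at_top. AE u in lborel. norm (indicator {0<..} u *\<^sub>R pcf_int p (- t) u)
       \<le> indicator {0<..} u *\<^sub>R pcf_int p 0 u"
      by (intro eventually_mono[OF eventually_ge_at_top[of 0]] AE_I2)
         (auto simp: pcf_int_def indicator_def intro!: mult_left_mono)
    show "AE u in lborel. ((\<lambda>t. indicator {0<..} u *\<^sub>R pcf_int p (- t) u) \<longlongrightarrow> 0) at_top"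
    proof (rule AE_I2)
      fix u :: real
      show "((\<lambda>t. indicator {0<..} u *\<^sub>R pcf_int p (- t) u) \<longlongrightarrow> 0) at_top"
      proof (cases "u > 0")
        case True
        have "((\<lambda>t. u powr (p - 1) * (exp (- (u * t)) * exp (- u\<^sup>2 / 2))) \<longlongrightarrow> 
          u powr (p - 1) * (0 * exp (- u\<^sup>2 / 2))) at_top"
          by (intro tendsto_intros filterlim_compose[OF exp_at_bot] filterlim_compose[OF filterlim_uminus_at_bot_at_top]
                filterlim_tendsto_pos_mult_at_top[OF tendsto_const True] filterlim_ident)
        then show ?thesis using True by (simp add: pcf_int_def exp_add[symmetric] ac_simps)
      qed simp
    qed
    show "integrable lborel (\<lambda>u. indicat_real {0<..} u *\<^sub>R pcf_int p 0 u)"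
      using pcf_integrable[of p 0] assms by (simp add: set_integrable_def)
  qed measurable
  then have "((\<lambda>t. pcf p (- t)) \<longlongrightarrow> 0) at_top" by (simp add: pcf_def)
  then show ?thesis by (simp add: filterlim_at_bot_mirror)
qed

text \<open>The derivative of \<open>u powr p * exp (z * u - u\<^sup>2 / 2)\<close> integrates to 0
  over the half-line; the boundary term at 0 vanishes because \<open>p > 0\<close>. With
  \<open>pcf_DERIV\<close> this is the equation f'' = z f' + p f.\<close>

lemma pcf_rec:
  assumes "p > 0"
  shows "pcf (p + 2) z = z * pcf (p + 1) z + p * pcf p z"
proof -
  let ?f = "\<lambda>u. p * pcf_int p z u + z * pcf_int (p + 1) z u - pcf_int (p + 2) z u"
  let ?F = "\<lambda>u. u powr p * exp (z * u - u\<^sup>2 / 2)"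
  have int: "set_integrable lborel {0<..} ?f"
    using assms by (intro set_integral_diff set_integral_add set_integrable_mult_right) (auto intro!: pcf_integrable)
  have "(LBINT u=0..\<infinity>. ?f u) = 0 - 0"
  proof (rule interval_integral_FTC_integrable[where F = ?F])
    fix u :: real assume "0 < ereal u"
    then have u: "u > 0" by simp
    have "(?F has_real_derivative ?f u) (at u)"
      using u by (auto intro!: derivative_eq_intros simp: pcf_int_def powr_diff powr_add field_simps power2_eq_square)
    then show "(?F has_vector_derivative ?f u) (at u)"
      by (simp add: has_real_derivative_iff_has_vector_derivative)
    show "isCont ?f u" unfolding pcf_int_def using u by (auto intro!: continuous_intros)
  next
    show "set_integrable lborel (einterval 0 \<infinity>) ?f" using int by (simp add: einterval_def zero_ereal_def greaterThan_def)
  next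
    have "(?F \<longlongrightarrow> 0 powr p * exp (z * 0 - 0\<^sup>2 / 2)) (at_right 0)"
      using assms
      by (intro tendsto_mult tendsto_powr' tendsto_exp tendsto_diff tendsto_divide tendsto_power tendsto_ident_at
          tendsto_const) (auto intro: eventually_mono[OF eventually_at_right_less])
    then show "((?F \<circ> real_of_ereal) \<longlongrightarrow> 0) (at_right 0)"
      unfolding zero_ereal_def ereal_tendsto_simps by simp
    have "(?F \<longlongrightarrow> 0) at_top" using assms by real_asymp
    then show "((?F \<circ> real_of_ereal) \<longlongrightarrow> 0) (at_left \<infinity>)"
      by (simp add: ereal_tendsto_simps)
  qed simp
  then have "(LBINT u:{0<..}. ?f u) = 0"
    by (simp add: interval_integral_to_infinity_eq zero_ereal_def)
  also have "(LBINT u:{0<..}. ?f u) = p * pcf p z + z * pcf (p + 1) z - pcf (p + 2) z"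
    unfolding pcf_def using assms
    by (simp add: pcf_integrable set_integral_add set_integral_diff)
  finally show ?thesis by simp
qed

section \<open>Gaussian averages of parabolic cylinder functions\<close>

lemma nn_integral_std_normal_exp:
  "(\<integral>\<^sup>+w. ennreal (exp (l * w)) \<partial>std_normal_distribution) = ennreal (exp (l\<^sup>2 / 2))"
proof -
  have "(\<integral>\<^sup>+w. ennreal (exp (l * w)) \<partial>std_normal_distribution)
      = (\<integral>\<^sup>+w. ennreal (std_normal_density w) * ennreal (exp (l * w)) \<partial>lborel)"
    by (subst nn_integral_density) auto
  also have "\<dots> = (\<integral>\<^sup>+w. ennreal (exp (l\<^sup>2 / 2)) * ennreal (normal_density l 1 w) \<partial>lborel)"
  proof (intro nn_integral_cong)
    fix w :: real
    have "std_normal_density w * exp (l * w) = exp (l\<^sup>2 / 2) * normal_density l 1 w"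
      by (simp add: normal_density_def exp_add[symmetric] power2_eq_square field_simps)
    then show "ennreal (std_normal_density w) * ennreal (exp (l * w))
        = ennreal (exp (l\<^sup>2 / 2)) * ennreal (normal_density l 1 w)"
      by (simp add: ennreal_mult[symmetric])
  qed
  also have "\<dots> = ennreal (exp (l\<^sup>2 / 2)) * (\<integral>\<^sup>+w. ennreal (normal_density l 1 w) \<partial>lborel)"
    by (rule nn_integral_cmult) auto
  also have "(\<integral>\<^sup>+w. ennreal (normal_density l 1 w) \<partial>lborel) = 1"
    by (subst nn_integral_eq_integral) auto
  finally show ?thesis by simp
qed

text \<open>\<open>pcf p\<close> is an eigenfunction of the normalised Ornstein-Uhlenbeck semigroup.
  Tonelli reduces to exponentials in \<open>w\<close>, whose average is
  \<open>exp ((\<rho> * u)\<^sup>2 / 2)\<close>; by the choice of \<open>\<rho>\<close> this leaves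
  exactly the Gaussian factor in \<open>exp (- t) * u\<close>, and rescaling \<open>u\<close>
  produces the eigenvalue.\<close>

lemma nn_integral_std_normal_pcf:
  assumes p: "p > 0" and \<rho>: "\<rho>\<^sup>2 = 1 - (exp (- t))\<^sup>2"
  shows "(\<integral>\<^sup>+w. ennreal (pcf p (exp (- t) * z + \<rho> * w)) \<partial>std_normal_distribution)
    = ennreal (exp (p * t) * pcf p z)"
proof -
  interpret N: prob_space std_normal_distribution by (rule prob_space_normal_density) simp
  interpret P: pair_sigma_finite std_normal_distribution lborel ..
  let ?I = "\<lambda>u. indicator {0<..} u :: ennreal"
  have "(\<integral>\<^sup>+w. ennreal (pcf p (exp (- t) * z + \<rho> * w)) \<partial>std_normal_distribution)
    = (\<integral>\<^sup>+w. (\<integral>\<^sup>+u. ?I u * ennreal (pcf_int p (exp (- t) * z + \<rho> * w) u) \<partial>lborel) \<partial>std_normal_distribution)"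
    by (simp add: ennreal_pcf p)
  also have "\<dots> = (\<integral>\<^sup>+u. (\<integral>\<^sup>+w. ?I u * ennreal (pcf_int p (exp (- t) * z + \<rho> * w) u) \<partial>std_normal_distribution) \<partial>lborel)"
    by (rule P.Fubini'[symmetric]) measurable
  also have "\<dots> = (\<integral>\<^sup>+u. ?I u * ennreal (pcf_int p (exp (- t) * z) u * exp ((\<rho> * u)\<^sup>2 / 2)) \<partial>lborel)"
  proof (intro nn_integral_cong)
    fix u :: real
    have "pcf_int p (exp (- t) * z + \<rho> * w) u = pcf_int p (exp (- t) * z) u * exp ((\<rho> * u) * w)" for w
      by (simp add: pcf_int_def exp_add[symmetric] algebra_simps)
    then have "(\<integral>\<^sup>+w. ?I u * ennreal (pcf_int p (exp (- t) * z + \<rho> * w) u) \<partial>std_normal_distribution)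
       = (\<integral>\<^sup>+w. (?I u * ennreal (pcf_int p (exp (- t) * z) u)) * ennreal (exp ((\<rho> * u) * w)) \<partial>std_normal_distribution)"
      by (simp add: ennreal_mult pcf_int_nonneg mult.assoc)
    also have "\<dots> = (?I u * ennreal (pcf_int p (exp (- t) * z) u)) * ennreal (exp ((\<rho> * u)\<^sup>2 / 2))"
      by (subst nn_integral_cmult) (auto simp: nn_integral_std_normal_exp)
    finally show "(\<integral>\<^sup>+w. ?I u * ennreal (pcf_int p (exp (- t) * z + \<rho> * w) u) \<partial>std_normal_distribution)
       = ?I u * ennreal (pcf_int p (exp (- t) * z) u * exp ((\<rho> * u)\<^sup>2 / 2))"
      by (simp add: ennreal_mult pcf_int_nonneg mult.assoc)
  qed
  also have "\<dots> = (\<integral>\<^sup>+u. ennreal (exp ((p - 1) * t)) * (?I (exp (- t) * u) * ennreal (pcf_int p z (exp (- t) * u))) \<partial>lborel)"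
  proof (intro nn_integral_cong)
    fix u :: real
    show "?I u * ennreal (pcf_int p (exp (- t) * z) u * exp ((\<rho> * u)\<^sup>2 / 2))
      = ennreal (exp ((p - 1) * t)) * (?I (exp (- t) * u) * ennreal (pcf_int p z (exp (- t) * u)))"
    proof (cases "u > 0")
      case True
      have "exp (- t) * z * u - u\<^sup>2 / 2 + (\<rho> * u)\<^sup>2 / 2 = z * (exp (- t) * u) - (exp (- t) * u)\<^sup>2 / 2"
        unfolding power_mult_distrib \<rho> by (simp add: algebra_simps diff_divide_distrib)
      then have 1: "exp (exp (- t) * z * u - u\<^sup>2 / 2) * exp ((\<rho> * u)\<^sup>2 / 2)
          = exp (z * (exp (- t) * u) - (exp (- t) * u)\<^sup>2 / 2)"
        unfolding exp_add[symmetric] by simp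
      have 2: "u powr (p - 1) = exp ((p - 1) * t) * (exp (- t) * u) powr (p - 1)"
        using True by (simp add: powr_mult powr_def[of "exp _"] exp_add[symmetric] algebra_simps)
      have "pcf_int p (exp (- t) * z) u * exp ((\<rho> * u)\<^sup>2 / 2)
          = exp ((p - 1) * t) * pcf_int p z (exp (- t) * u)"
        unfolding pcf_int_def mult.assoc[of "u powr _"] 1 by (subst 2) (simp add: mult.assoc)
      then show ?thesis using True by (simp add: ennreal_mult pcf_int_nonneg)
    qed (simp add: mult_less_0_iff zero_less_mult_iff)
  qed
  also have "\<dots> = ennreal (exp ((p - 1) * t)) *
      (\<integral>\<^sup>+u. ?I (exp (- t) * u) * ennreal (pcf_int p z (exp (- t) * u)) \<partial>lborel)"
    by (rule nn_integral_cmult) measurable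
  \<comment> \<open>The Jacobian \<open>exp (- t)\<close> of the rescaling is inserted and
    compensated by \<open>exp t\<close>.\<close>
  also have "(\<integral>\<^sup>+u. ?I (exp (- t) * u) * ennreal (pcf_int p z (exp (- t) * u)) \<partial>lborel)
      = ennreal (exp t) * (ennreal (exp (- t)) *
          (\<integral>\<^sup>+u. ?I (exp (- t) * u) * ennreal (pcf_int p z (exp (- t) * u)) \<partial>lborel))"
    unfolding mult.assoc[symmetric] ennreal_mult[symmetric, OF exp_ge_zero exp_ge_zero] exp_add[symmetric] by simp
  also have "ennreal (exp (- t)) * (\<integral>\<^sup>+u. ?I (exp (- t) * u) * ennreal (pcf_int p z (exp (- t) * u)) \<partial>lborel)
      = ennreal (pcf p z)"
    using nn_integral_real_affine[of "\<lambda>u. ?I u * ennreal (pcf_int p z u)" "exp (- t)" 0]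
    by (simp add: ennreal_pcf p)
  also have "ennreal (exp ((p - 1) * t)) * (ennreal (exp t) * ennreal (pcf p z)) = ennreal (exp (p * t) * pcf p z)"
  proof -
    have "exp ((p - 1) * t) * (exp t * pcf p z) = exp (p * t) * pcf p z"
      unfolding mult.assoc[symmetric] exp_add[symmetric] by (simp add: algebra_simps)
    then show ?thesis
      using pcf_pos[OF p, of z] by (simp add: ennreal_mult[symmetric] del: exp_gt_zero)
  qed
  finally show ?thesis .
qed

section \<open>Superharmonic functions of the Ornstein-Uhlenbeck generator\<close>

text \<open>The second derivative is available only at \<open>z\<close>: were it negative,
  \<open>f'\<close> would be negative just to the right of \<open>z\<close>, and the mean value
  theorem would push \<open>f\<close> below its minimum.\<close>

lemma local_min_second_derivative:
  fixes f f' :: "real \<Rightarrow> real"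
  assumes f: "\<And>x. \<bar>x - z\<bar> < e \<Longrightarrow> (f has_real_derivative f' x) (at x)"
    and f2: "(f' has_real_derivative f2) (at z)"
    and e: "e > 0" and min: "\<And>x. \<bar>x - z\<bar> < e \<Longrightarrow> f z \<le> f x"
  shows "f' z = 0" "f2 \<ge> 0"
proof -
  have "(f has_real_derivative f' z) (at z)" using f e by simp
  then show 0: "f' z = 0" by (rule DERIV_local_min[OF _ e]) (auto intro: min simp: abs_minus_commute)
  show "f2 \<ge> 0"
  proof (rule ccontr)
    assume "\<not> f2 \<ge> 0"
    then have "f2 < 0" by simp
    from DERIV_neg_dec_right[OF f2 this] obtain d where
      d: "d > 0" "\<And>h. h > 0 \<Longrightarrow> h < d \<Longrightarrow> f' (z + h) < f' z" by auto
    define h where "h = min d e / 2"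
    have h: "h > 0" "h < d" "h < e" using d e by (auto simp: h_def)
    have "\<exists>u>z. u < z + h \<and> f (z + h) - f z = (z + h - z) * f' u"
      by (rule MVT2) (use h in \<open>auto intro!: f\<close>)
    then obtain u where u: "u > z" "u < z + h" "f (z + h) - f z = h * f' u" by auto
    have "f' u < 0" using d(2)[of "u - z"] u h 0 by simp
    then have "f (z + h) < f z" using u h mult_pos_neg[of h "f' u"] by linarith
    moreover have "f z \<le> f (z + h)" using h by (intro min) auto
    ultimately show False by simp
  qed
qed

text \<open>Smooth fit: matching value and slope at \<open>c\<close> give equal one-sided
  derivatives of the glued function.\<close>

lemma DERIV_if_less:
  fixes f g f' g' :: "real \<Rightarrow> real"
  assumes "\<And>x. x \<le> c \<Longrightarrow> (f has_real_derivative f' x) (at x)"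
    and "\<And>x. x \<ge> c \<Longrightarrow> (g has_real_derivative g' x) (at x)"
    and "f c = g c" "f' c = g' c"
  shows "((\<lambda>x. if x < c then f x else g x) has_real_derivative (if x < c then f' x else g' x)) (at x)"
proof -
  consider "x < c" | "x > c" | "x = c" by linarith
  then show ?thesis
  proof cases
    case 1
    have "\<forall>\<^sub>F y in nhds x. y < c" using 1 by (intro eventually_nhds_in_open[of "{..<c}", simplified]) auto
    then have "\<forall>\<^sub>F y in nhds x. (if y < c then f y else g y) = f y" by (rule eventually_mono) auto
    then show ?thesis using 1 assms(1)[of x] by (subst DERIV_cong_ev[OF refl _ refl]) auto
  next
    case 2
    have "\<forall>\<^sub>F y in nhds x. y > c" using 2 by (intro eventually_nhds_in_open[of "{c<..}", simplified]) auto
    then have "\<forall>\<^sub>F y in nhds x. (if y < c then f y else g y) = g y" by (rule eventually_mono) auto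
    then show ?thesis using 2 assms(2)[of x] by (subst DERIV_cong_ev[OF refl _ refl]) auto
  next
    case 3
    let ?h = "\<lambda>x. if x < c then f x else g x"
    have "((\<lambda>y. (f y - f c) / (y - c)) \<longlongrightarrow> f' c) (at c)"
      using assms(1)[of c] by (simp add: has_field_derivative_iff)
    then have "((\<lambda>y. (f y - f c) / (y - c)) \<longlongrightarrow> f' c) (at_left c)"
      by (rule tendsto_within_subset) simp
    then have l: "((\<lambda>y. (?h y - ?h c) / (y - c)) \<longlongrightarrow> f' c) (at_left c)"
      by (rule Lim_transform_eventually) (simp add: eventually_at_filter assms(3))
    have "((\<lambda>y. (g y - g c) / (y - c)) \<longlongrightarrow> g' c) (at c)"
      using assms(2)[of c] by (simp add: has_field_derivative_iff)
    then have "((\<lambda>y. (g y - g c) / (y - c)) \<longlongrightarrow> g' c) (at_right c)"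
      by (rule tendsto_within_subset) simp
    then have r: "((\<lambda>y. (?h y - ?h c) / (y - c)) \<longlongrightarrow> g' c) (at_right c)"
      by (rule Lim_transform_eventually) (simp add: eventually_at_filter)
    show ?thesis using 3 l r assms(4) by (simp add: has_field_derivative_iff filterlim_at_split)
  qed
qed

lemma antimono_glue:
  fixes f :: "real \<Rightarrow> real"
  assumes "\<And>x y. x \<le> y \<Longrightarrow> y \<le> c \<Longrightarrow> f y \<le> f x" "\<And>x y. c \<le> x \<Longrightarrow> x \<le> y \<Longrightarrow> f y \<le> f x" "x \<le> y"
  shows "f y \<le> f x"
proof -
  consider "y \<le> c" | "c \<le> x" | "x \<le> c" "c \<le> y" by linarith
  then show ?thesis
    by cases (use assms in \<open>auto intro: order_trans[of _ "f c"]\<close>)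
qed

text \<open>Outside the compact interval \<open>f\<close> stays below its value at
  \<open>x0\<close>, and \<open>x0\<close> lies inside, so the maximum over the interval is
  global.\<close>

lemma exists_max_of_signs:
  fixes f :: "real \<Rightarrow> real"
  assumes cont: "continuous_on {l..u} f" and x0: "f x0 > 0"
    and out: "\<And>x. x \<notin> {l..u} \<Longrightarrow> f x < f x0"
  obtains a where "\<And>x. f x \<le> f a"
proof -
  have "x0 \<in> {l..u}" using out by force
  then obtain a where a: "a \<in> {l..u}" "\<And>x. x \<in> {l..u} \<Longrightarrow> f x \<le> f a"
    using continuous_attains_sup[OF compact_Icc _ cont] by auto
  have "f x \<le> f a" for x
    using a(2)[of x] a(2)[OF \<open>x0 \<in> _\<close>] out[of x] by (cases "x \<in> {l..u}") auto
  then show ?thesis using that by blast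
qed

section \<open>The fundamental solutions \<open>F\<close> and \<open>G\<close>\<close>

locale ou_params =
  fixes \<mu> \<sigma> \<theta> r :: real
  assumes mu_pos: "\<mu> > 0" and sigma_pos: "\<sigma> > 0" and r_pos: "r > 0"
begin

text \<open>The scaling \<open>k * (x - \<theta>)\<close> turns the stationary law into the standard
  normal one.\<close>

definition "k = sqrt (2 * \<mu> / \<sigma>\<^sup>2)"
definition "F x = pcf (r / \<mu>) (k * (x - \<theta>))"
definition "F' x = k * pcf (r / \<mu> + 1) (k * (x - \<theta>))"
definition "F'' x = k\<^sup>2 * pcf (r / \<mu> + 2) (k * (x - \<theta>))"
definition "G x = pcf (r / \<mu>) (k * (\<theta> - x))"
definition "G' x = - k * pcf (r / \<mu> + 1) (k * (\<theta> - x))"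
definition "G'' x = k\<^sup>2 * pcf (r / \<mu> + 2) (k * (\<theta> - x))"

lemma p_pos: "r / \<mu> > 0" "r / \<mu> + 1 > 0"
  using divide_pos_pos[OF r_pos mu_pos] by simp_all

lemma k_pos: "k > 0" and k_sq: "k\<^sup>2 = 2 * \<mu> / \<sigma>\<^sup>2"
  using mu_pos sigma_pos unfolding k_def by simp_all

lemma OU_F_eq: "OU_F \<mu> \<sigma> \<theta> r = F" and OU_G_eq: "OU_G \<mu> \<sigma> \<theta> r = G"
proof -
  show "OU_F \<mu> \<sigma> \<theta> r = F"
    unfolding OU_F_def[abs_def] F_def[abs_def] pcf_def pcf_int_def[abs_def] k_def ..
  show "OU_G \<mu> \<sigma> \<theta> r = G"
    unfolding OU_G_def[abs_def] G_def[abs_def] pcf_def pcf_int_def[abs_def] k_def ..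
qed

lemma F_DERIV: "(F has_real_derivative F' x) (at x)"
  and F'_DERIV: "(F' has_real_derivative F'' x) (at x)"
  and G_DERIV: "(G has_real_derivative G' x) (at x)"
  and G'_DERIV: "(G' has_real_derivative G'' x) (at x)"
proof -
  have *: "((\<lambda>x. pcf p (k * (x - \<theta>))) has_real_derivative pcf (p + 1) (k * (x - \<theta>)) * k) (at x)"
    and **: "((\<lambda>x. pcf p (k * (\<theta> - x))) has_real_derivative pcf (p + 1) (k * (\<theta> - x)) * - k) (at x)"
    if "p > 0" for p
  proof -
    have "((\<lambda>x. k * (x - \<theta>)) has_real_derivative k) (at x)"
      "((\<lambda>x. k * (\<theta> - x)) has_real_derivative - k) (at x)"
      by (auto intro!: derivative_eq_intros)
    then show "((\<lambda>x. pcf p (k * (x - \<theta>))) has_real_derivative pcf (p + 1) (k * (x - \<theta>)) * k) (at x)"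
      "((\<lambda>x. pcf p (k * (\<theta> - x))) has_real_derivative pcf (p + 1) (k * (\<theta> - x)) * - k) (at x)"
      using DERIV_chain2[OF pcf_DERIV[OF that]] by blast+
  qed
  show "(F has_real_derivative F' x) (at x)"
    unfolding F_def[abs_def] F'_def by (rule DERIV_cong[OF *[OF p_pos(1)]]) simp
  show "(G has_real_derivative G' x) (at x)"
    unfolding G_def[abs_def] G'_def by (rule DERIV_cong[OF **[OF p_pos(1)]]) simp
  show "(F' has_real_derivative F'' x) (at x)"
    unfolding F'_def[abs_def] F''_def
    by (rule DERIV_cong[OF DERIV_cmult[OF *[OF p_pos(2)]]]) (simp add: power2_eq_square add.assoc)
  show "(G' has_real_derivative G'' x) (at x)"
    unfolding G'_def[abs_def] G''_def
    by (rule DERIV_cong[OF DERIV_cmult[OF **[OF p_pos(2)]]]) (simp add: power2_eq_square add.assoc)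
qed

lemma F_pos: "F x > 0"
  unfolding F_def by (rule pcf_pos[OF p_pos(1)])

lemma G_pos: "G x > 0"
  unfolding G_def by (rule pcf_pos[OF p_pos(1)])

lemma F'_pos: "F' x > 0"
  unfolding F'_def by (rule mult_pos_pos[OF k_pos pcf_pos[OF p_pos(2)]])

lemma G'_neg: "G' x < 0"
  unfolding G'_def using mult_pos_pos[OF k_pos pcf_pos[OF p_pos(2)]] by simp

text \<open>This is \<open>pcf_rec\<close> times \<open>\<mu>\<close>, since
  \<open>\<sigma>\<^sup>2 / 2 * k\<^sup>2 = \<mu>\<close>.\<close>

lemma F_ode: "\<sigma>\<^sup>2 / 2 * F'' x + \<mu> * (\<theta> - x) * F' x = r * F x"
  and G_ode: "\<sigma>\<^sup>2 / 2 * G'' x + \<mu> * (\<theta> - x) * G' x = r * G x"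
proof -
  have s: "\<sigma>\<^sup>2 / 2 * (k\<^sup>2 * y) = \<mu> * y" for y using sigma_pos by (simp add: k_sq)
  have "\<sigma>\<^sup>2 / 2 * F'' x = \<mu> * (k * (x - \<theta>) * pcf (r / \<mu> + 1) (k * (x - \<theta>)) + r / \<mu> * F x)"
    unfolding F''_def F_def s pcf_rec[OF p_pos(1)] ..
  then show "\<sigma>\<^sup>2 / 2 * F'' x + \<mu> * (\<theta> - x) * F' x = r * F x"
    using mu_pos by (simp add: F'_def algebra_simps)
  have "\<sigma>\<^sup>2 / 2 * G'' x = \<mu> * (k * (\<theta> - x) * pcf (r / \<mu> + 1) (k * (\<theta> - x)) + r / \<mu> * G x)"
    unfolding G''_def G_def s pcf_rec[OF p_pos(1)] ..
  then show "\<sigma>\<^sup>2 / 2 * G'' x + \<mu> * (\<theta> - x) * G' x = r * G x"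
    using mu_pos by (simp add: G'_def algebra_simps)
qed

lemma F_strict_mono: "x < y \<Longrightarrow> F x < F y"
  using DERIV_pos_imp_increasing[of x y F] F_DERIV F'_pos by blast

lemma G_strict_antimono: "x < y \<Longrightarrow> G y < G x"
  using DERIV_neg_imp_decreasing[of x y G] G_DERIV G'_neg by blast

lemma F_continuous: "continuous_on S F"
  by (intro continuous_at_imp_continuous_on ballI DERIV_isCont[OF F_DERIV])

lemma G_continuous: "continuous_on S G"
  by (intro continuous_at_imp_continuous_on ballI DERIV_isCont[OF G_DERIV])

lemma F_small:
  assumes "e > 0"
  obtains L where "\<And>x. x < L \<Longrightarrow> F x < e"
proof -
  have "\<forall>\<^sub>F z in at_bot. pcf (r / \<mu>) z < e"
    using order_tendstoD(2)[OF pcf_at_bot[OF p_pos(1)] assms] .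
  then obtain N where N: "\<And>z. z \<le> N \<Longrightarrow> pcf (r / \<mu>) z < e" by (auto simp: eventually_at_bot_linorder)
  show ?thesis
  proof (rule that[of "\<theta> + N / k"])
    fix x assume "x < \<theta> + N / k"
    then have "x - \<theta> \<le> N / k" by simp
    then have "k * (x - \<theta>) \<le> N" using k_pos by (simp add: pos_le_divide_eq mult.commute)
    then show "F x < e" unfolding F_def by (rule N)
  qed
qed

text \<open>The rate \<open>2 / k\<close> in the normalised variable becomes 2 in \<open>x\<close>;
  being above 1, it makes \<open>exp x / F x\<close> vanish at infinity.\<close>

lemma F_ge_exp:
  obtains c where "c > 0" "\<And>x. x \<ge> \<theta> \<Longrightarrow> F x \<ge> c * exp (2 * x)"
proof -
  from pcf_ge[OF p_pos(1), of "2 / k"] k_pos obtain c where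
    c: "c > 0" "\<And>z. z \<ge> 0 \<Longrightarrow> pcf (r / \<mu>) z \<ge> c * exp (2 / k * z)" by auto
  show ?thesis
  proof (rule that[of "c * exp (- 2 * \<theta>)"])
    fix x assume "x \<ge> \<theta>"
    then have "F x \<ge> c * exp (2 / k * (k * (x - \<theta>)))" unfolding F_def using k_pos by (intro c) auto
    also have "2 / k * (k * (x - \<theta>)) = -2 * \<theta> + 2 * x" using k_pos by simp
    finally show "F x \<ge> c * exp (- 2 * \<theta>) * exp (2 * x)" by (simp only: exp_add mult.assoc)
  qed (use c in simp)
qed

text \<open>The weighted Wronskian against \<open>G\<close>: up to a positive factor the derivative of \<open>U / G\<close>.
  The weight makes it constant on solutions of the ODE and decreasing on supersolutions.\<close>

definition "wr U U' x = exp (- \<mu> * (x - \<theta>)\<^sup>2 / \<sigma>\<^sup>2) * (U' x * G x - U x * G' x)"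

text \<open>The logarithmic derivative of the weight is
  \<open>2 * \<mu> * (\<theta> - x) / \<sigma>\<^sup>2\<close>, which supplies the drift terms; the
  ODE of \<open>G\<close> eliminates \<open>G''\<close>.\<close>

lemma wr_DERIV:
  assumes U: "(U has_real_derivative U' x) (at x)" and U': "(U' has_real_derivative U2) (at x)"
  shows "(wr U U' has_real_derivative
    exp (- \<mu> * (x - \<theta>)\<^sup>2 / \<sigma>\<^sup>2) * (2 / \<sigma>\<^sup>2) * G x * (\<sigma>\<^sup>2 / 2 * U2 + \<mu> * (\<theta> - x) * U' x - r * U x)) (at x)"
proof -
  have g: "2 / \<sigma>\<^sup>2 * r * G x = G'' x + 2 / \<sigma>\<^sup>2 * \<mu> * (\<theta> - x) * G' x"
    using G_ode[of x] sigma_pos by (simp add: field_simps)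
  have "exp (- \<mu> * (x - \<theta>)\<^sup>2 / \<sigma>\<^sup>2) * (2 / \<sigma>\<^sup>2) * G x * (\<sigma>\<^sup>2 / 2 * U2 + \<mu> * (\<theta> - x) * U' x - r * U x)
      = exp (- \<mu> * (x - \<theta>)\<^sup>2 / \<sigma>\<^sup>2) *
        (U2 * G x + 2 / \<sigma>\<^sup>2 * \<mu> * (\<theta> - x) * U' x * G x - U x * (2 / \<sigma>\<^sup>2 * r * G x))"
    using sigma_pos by (simp add: field_simps)
  also have "\<dots> = (- \<mu> * (2 * (x - \<theta>)) / \<sigma>\<^sup>2) * exp (- \<mu> * (x - \<theta>)\<^sup>2 / \<sigma>\<^sup>2) * (U' x * G x - U x * G' x)
      + exp (- \<mu> * (x - \<theta>)\<^sup>2 / \<sigma>\<^sup>2) * (U2 * G x + U' x * G' x - (U' x * G' x + U x * G'' x))"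
    unfolding g by (simp add: algebra_simps add_divide_distrib diff_divide_distrib)
  finally have e: "exp (- \<mu> * (x - \<theta>)\<^sup>2 / \<sigma>\<^sup>2) * (2 / \<sigma>\<^sup>2) * G x * (\<sigma>\<^sup>2 / 2 * U2 + \<mu> * (\<theta> - x) * U' x - r * U x)
    = \<dots>" .
  have E: "((\<lambda>x. exp (- \<mu> * (x - \<theta>)\<^sup>2 / \<sigma>\<^sup>2)) has_real_derivative
      (- \<mu> * (2 * (x - \<theta>)) / \<sigma>\<^sup>2) * exp (- \<mu> * (x - \<theta>)\<^sup>2 / \<sigma>\<^sup>2)) (at x)"
    using sigma_pos by (auto intro!: derivative_eq_intros simp: field_simps power2_eq_square)
  show ?thesis
    unfolding wr_def[abs_def] e
    by (rule DERIV_cong[OF DERIV_mult[OF E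
          DERIV_diff[OF DERIV_mult[OF U' G_DERIV] DERIV_mult[OF U G'_DERIV]]]])
       (simp add: algebra_simps)
qed

lemma wr_decreasing:
  assumes "\<And>x. l \<le> x \<Longrightarrow> x \<le> u \<Longrightarrow> (U has_real_derivative U' x) (at x)"
    and "\<And>x. l \<le> x \<Longrightarrow> x \<le> u \<Longrightarrow> (U' has_real_derivative U2 x) (at x)"
    and "\<And>x. l \<le> x \<Longrightarrow> x \<le> u \<Longrightarrow> \<sigma>\<^sup>2 / 2 * U2 x + \<mu> * (\<theta> - x) * U' x - r * U x \<le> 0"
    and "l \<le> u"
  shows "wr U U' u \<le> wr U U' l"
  using assms(4)
proof (rule DERIV_nonpos_imp_nonincreasing)
  fix x assume x: "l \<le> x" "x \<le> u"
  have "exp (- \<mu> * (x - \<theta>)\<^sup>2 / \<sigma>\<^sup>2) * (2 / \<sigma>\<^sup>2) * G x * (\<sigma>\<^sup>2 / 2 * U2 x + \<mu> * (\<theta> - x) * U' x - r * U x) \<le> 0"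
    using assms(3)[OF x] G_pos[of x] sigma_pos by (intro mult_nonneg_nonpos) auto
  then show "\<exists>y. (wr U U' has_real_derivative y) (at x) \<and> y \<le> 0"
    using wr_DERIV[OF assms(1)[OF x] assms(2)[OF x]] by blast
qed

lemma wr_F: "wr F F' x = wr F F' y"
proof -
  have "\<forall>x. (wr F F' has_real_derivative 0) (at x)"
    using wr_DERIV[OF F_DERIV F'_DERIV] F_ode by simp
  then show ?thesis by (rule DERIV_isconst_all)
qed

text \<open>Tangency replaces a differential inequality because it can be integrated directly
  against the transition law, under which the averages of \<open>F\<close> and \<open>G\<close> are
  known exactly. The coefficients may be negative.\<close>

definition "superharmonic U \<longleftrightarrow> (\<forall>x. U x \<ge> 0) \<and>
  (\<forall>y. \<exists>\<alpha> \<beta>. U y = \<alpha> * F y + \<beta> * G y \<and> (\<forall>x. U x \<le> \<alpha> * F x + \<beta> * G x))"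

lemma superharmonicI:
  assumes nonneg: "\<And>x. U x \<ge> 0" and U: "\<And>x. (U has_real_derivative U' x) (at x)"
    and wr: "\<And>x y. x \<le> y \<Longrightarrow> wr U U' y \<le> wr U U' x"
  shows "superharmonic U"
  unfolding superharmonic_def
proof (intro conjI allI nonneg)
  fix y
  let ?D = "F' y * G y - F y * G' y"
  have D: "?D > 0"
    using F_pos[of y] F'_pos[of y] G_pos[of y] G'_neg[of y] mult_pos_neg[of "F y" "G' y"]
      mult_pos_pos[of "F' y" "G y"] by linarith
  \<comment> \<open>Cramer's rule: \<open>\<alpha> * F + \<beta> * G\<close> is to match value and
    slope of \<open>U\<close> at \<open>y\<close>, and \<open>?D\<close> is the Wronskian of the
    system.\<close>
  define \<alpha> where "\<alpha> = (U' y * G y - U y * G' y) / ?D"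
  define \<beta> where "\<beta> = (U y * F' y - U' y * F y) / ?D"
  have a: "\<alpha> * ?D = U' y * G y - U y * G' y" and b: "\<beta> * ?D = U y * F' y - U' y * F y"
    using D by (simp_all add: \<alpha>_def \<beta>_def)
  have "?D * (\<alpha> * F y + \<beta> * G y) = (\<alpha> * ?D) * F y + (\<beta> * ?D) * G y" by (simp add: algebra_simps)
  also have "\<dots> = ?D * U y" unfolding a b by (simp add: algebra_simps)
  finally have e: "\<alpha> * F y + \<beta> * G y = U y" using D by simp
  have "?D * (\<alpha> * F' y + \<beta> * G' y) = (\<alpha> * ?D) * F' y + (\<beta> * ?D) * G' y" by (simp add: algebra_simps)
  also have "\<dots> = ?D * U' y" unfolding a b by (simp add: algebra_simps)
  finally have e': "\<alpha> * F' y + \<beta> * G' y = U' y" using D by simp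
  define H where "H x = \<alpha> * F x + \<beta> * G x - U x" for x
  define H' where "H' x = \<alpha> * F' x + \<beta> * G' x - U' x" for x
  have H0: "H y = 0" "H' y = 0" using e e' by (auto simp: H_def H'_def)
  have H: "(H has_real_derivative H' x) (at x)" for x
    unfolding H_def[abs_def] H'_def by (auto intro!: derivative_eq_intros F_DERIV G_DERIV U)
  \<comment> \<open>No \<open>\<beta>\<close> appears because the Wronskian of \<open>G\<close> with
    itself vanishes. As \<open>wr F F'\<close> is constant and \<open>wr U U'\<close> decreases,
    \<open>wr H H'\<close> increases through 0 at \<open>y\<close>, so \<open>H / G\<close> has its
    minimum, 0, there.\<close>
  have wrH: "wr H H' x = \<alpha> * wr F F' x - wr U U' x" for x
    by (simp add: wr_def H_def H'_def algebra_simps)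
  have wry: "wr H H' y = 0" by (simp add: wr_def H0)
  have Q: "((\<lambda>x. H x / G x) has_real_derivative
      wr H H' x / (exp (- \<mu> * (x - \<theta>)\<^sup>2 / \<sigma>\<^sup>2) * (G x)\<^sup>2)) (at x)" for x
    unfolding wr_def using G_pos[of x]
    by (auto intro!: derivative_eq_intros H G_DERIV simp: power2_eq_square field_simps)
  have "H y / G y \<le> H x / G x" for x
  proof (cases "x \<ge> y")
    case True
    then show ?thesis
    proof (rule DERIV_nonneg_imp_nondecreasing)
      fix z assume "y \<le> z"
      then have "wr H H' z \<ge> 0" using wr[of y z] wrH[of z] wrH[of y] wr_F[of y z] wry by simp
      then have "wr H H' z / (exp (- \<mu> * (z - \<theta>)\<^sup>2 / \<sigma>\<^sup>2) * (G z)\<^sup>2) \<ge> 0" by simp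
      then show "\<exists>w. ((\<lambda>x. H x / G x) has_real_derivative w) (at z) \<and> w \<ge> 0" using Q by blast
    qed
  next
    case False
    then have "x \<le> y" by simp
    then show ?thesis
    proof (rule DERIV_nonpos_imp_nonincreasing)
      fix z assume "z \<le> y"
      then have "wr H H' z \<le> 0" using wr[of z y] wrH[of z] wrH[of y] wr_F[of y z] wry by simp
      then have "wr H H' z / (exp (- \<mu> * (z - \<theta>)\<^sup>2 / \<sigma>\<^sup>2) * (G z)\<^sup>2) \<le> 0"
        by (simp add: divide_nonpos_nonneg)
      then show "\<exists>w. ((\<lambda>x. H x / G x) has_real_derivative w) (at z) \<and> w \<le> 0" using Q by blast
    qed
  qed
  then have "0 \<le> H x" for x using H0(1) G_pos[of x] by (simp add: zero_le_divide_iff) (metis less_le_not_le)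
  then have "\<forall>x. U x \<le> \<alpha> * F x + \<beta> * G x" by (simp add: H_def)
  then show "\<exists>\<alpha> \<beta>. U y = \<alpha> * F y + \<beta> * G y \<and> (\<forall>x. U x \<le> \<alpha> * F x + \<beta> * G x)" using e by metis
qed

end

section \<open>The free boundary problems for exit and entry\<close>

context ou_params
begin

text \<open>First- and second-order conditions at a point where \<open>H\<close> is touched from below by \<open>U\<close>;
  in both uses \<open>H\<close> is a multiple of \<open>F\<close> or \<open>G\<close>.\<close>

lemma touching_conditions:
  assumes H: "\<And>x. (H has_real_derivative H' x) (at x)" and H': "\<And>x. (H' has_real_derivative H'' x) (at x)"
    and Hode: "\<And>x. \<sigma>\<^sup>2 / 2 * H'' x + \<mu> * (\<theta> - x) * H' x = r * H x"
    and e: "e > 0"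
    and U: "\<And>x. \<bar>x - a\<bar> < e \<Longrightarrow> (U has_real_derivative U' x) (at x)"
    and U': "\<And>x. \<bar>x - a\<bar> < e \<Longrightarrow> (U' has_real_derivative U'' x) (at x)"
    and le: "\<And>x. \<bar>x - a\<bar> < e \<Longrightarrow> U x \<le> H x" and eq: "U a = H a"
  shows "U' a = H' a" "\<sigma>\<^sup>2 / 2 * U'' a + \<mu> * (\<theta> - a) * U' a - r * U a \<le> 0"
proof -
  have D: "((\<lambda>x. H x - U x) has_real_derivative H' x - U' x) (at x)" if "\<bar>x - a\<bar> < e" for x
    using that by (intro DERIV_diff H U)
  have D': "((\<lambda>x. H' x - U' x) has_real_derivative H'' a - U'' a) (at a)"
    using e by (intro DERIV_diff H' U') auto
  have min: "H a - U a \<le> H x - U x" if "\<bar>x - a\<bar> < e" for x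
    using le[OF that] eq by simp
  note * = local_min_second_derivative[OF D D' e min]
  then show "U' a = H' a" by simp
  have "\<sigma>\<^sup>2 / 2 * (H'' a - U'' a) \<ge> 0" using *(2) by simp
  then show "\<sigma>\<^sup>2 / 2 * U'' a + \<mu> * (\<theta> - a) * U' a - r * U a \<le> 0"
    using Hode[of a] *(1) eq by (simp add: algebra_simps)
qed

lemma scaled_ode:
  assumes "\<And>x. \<sigma>\<^sup>2 / 2 * H'' x + \<mu> * (\<theta> - x) * H' x = r * (H x :: real)"
  shows "\<sigma>\<^sup>2 / 2 * (c * H'' x) + \<mu> * (\<theta> - x) * (c * H' x) = r * (c * H x)"
  using arg_cong[OF assms[of x], of "\<lambda>y. c * y"] by (simp add: algebra_simps)

lemma exp_generator:
  "\<sigma>\<^sup>2 / 2 * exp x + \<mu> * (\<theta> - x) * exp x - r * (exp x + c)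
    = (\<sigma>\<^sup>2 / 2 + \<mu> * \<theta> - r - \<mu> * x) * exp x - r * c"
  by (simp add: algebra_simps)

text \<open>The last two clauses are the first- and second-order conditions at the maximum, the
  latter propagated to the right of \<open>b\<close>.\<close>

lemma exists_exit_level:
  assumes cs: "cs > 0"
  obtains b where "exp b > cs" "\<And>x. exp x - cs \<le> (exp b - cs) / F b * F x"
    "exp b = (exp b - cs) / F b * F' b"
    "\<And>x. x \<ge> b \<Longrightarrow> (\<sigma>\<^sup>2 / 2 + \<mu> * \<theta> - r - \<mu> * x) * exp x + r * cs \<le> 0"
proof -
  define f where "f x = (exp x - cs) / F x" for x
  define x0 where "x0 = ln (cs + 1)"
  have ex0: "exp x0 = cs + 1" using cs by (simp add: x0_def)
  have f0: "f x0 > 0" using F_pos[of x0] by (simp add: f_def ex0)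
  obtain c where c: "c > 0" "\<And>x. x \<ge> \<theta> \<Longrightarrow> F x \<ge> c * exp (2 * x)" using F_ge_exp by blast
  \<comment> \<open>Beyond \<open>u\<close> the bound \<open>exp (- x) / c\<close> for
    \<open>f x\<close> is below \<open>f x0\<close>.\<close>
  define u where "u = max \<theta> (- ln (c * f x0))"
  have right: "f x < f x0" if "x > u" for x
  proof -
    have x: "x \<ge> \<theta>" "- ln (c * f x0) < x" using that by (auto simp: u_def)
    have "- x < ln (c * f x0)" using x by simp
    then have "exp (- x) < c * f x0"
      using exp_less_mono[of "- x" "ln (c * f x0)"] c(1) f0 by simp
    have "f x < exp x / F x" using F_pos[of x] cs by (simp add: f_def divide_strict_right_mono)
    also have "\<dots> \<le> exp x / (c * exp (2 * x))"
      using c F_pos[of x] x by (intro divide_left_mono) auto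
    also have "\<dots> = exp (- x) / c" using c(1) by (simp add: exp_minus field_simps exp_add[symmetric])
    also have "\<dots> < f x0" using \<open>exp (- x) < _\<close> c(1) by (simp add: field_simps)
    finally show ?thesis .
  qed
  have left: "f x < f x0" if "x < ln cs" for x
  proof -
    have "exp x < cs" using that cs by (metis exp_less_mono exp_ln)
    then have "f x < 0" using F_pos[of x] by (simp add: f_def divide_neg_pos)
    then show ?thesis using f0 by simp
  qed
  have out: "f x < f x0" if "x \<notin> {ln cs..u}" for x
    using that left[of x] right[of x] by force
  have cont: "continuous_on {ln cs..u} f"
    unfolding f_def[abs_def] using F_pos
    by (intro continuous_intros F_continuous) (metis less_irrefl)
  obtain b where b: "\<And>x. f x \<le> f b"
    using exists_max_of_signs[OF cont f0 out] by blast
  have "f b > 0" using b[of x0] f0 by simp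
  then have eb: "exp b > cs" using F_pos[of b] by (simp add: f_def zero_less_divide_iff)
  define K where "K = f b"
  have le: "exp x - cs \<le> K * F x" for x
    using b[of x] F_pos[of x] by (simp add: K_def f_def[of x] divide_le_eq)
  have eq: "exp b - cs = K * F b" using F_pos[of b] by (simp add: K_def f_def)
  have dU: "((\<lambda>x. exp x - cs) has_real_derivative exp x) (at x)" for x
    by (auto intro!: derivative_eq_intros)
  have t: "exp b = K * F' b" "\<sigma>\<^sup>2 / 2 * exp b + \<mu> * (\<theta> - b) * exp b - r * (exp b - cs) \<le> 0"
    using touching_conditions[of "\<lambda>x. K * F x" "\<lambda>x. K * F' x" "\<lambda>x. K * F'' x" 1 b "\<lambda>x. exp x - cs" exp exp,
        OF DERIV_cmult[OF F_DERIV] DERIV_cmult[OF F'_DERIV] scaled_ode[OF F_ode] zero_less_one dU DERIV_exp le eq]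
    by auto
  have L: "(\<sigma>\<^sup>2 / 2 + \<mu> * \<theta> - r - \<mu> * b) * exp b + r * cs \<le> 0"
    using t(2) by (simp add: algebra_simps)
  show ?thesis
  proof (rule that[OF eb])
    show "exp x - cs \<le> (exp b - cs) / F b * F x" for x using le by (simp add: K_def f_def)
    show "exp b = (exp b - cs) / F b * F' b" using t(1) by (simp add: K_def f_def)
    fix x assume x: "x \<ge> b"
    \<comment> \<open>As \<open>r * cs > 0\<close>, the condition \<open>L\<close> forces the linear
      factor to be negative at \<open>b\<close>; to the right it decreases further and is multiplied
      by a larger exponential.\<close>
    have "(\<sigma>\<^sup>2 / 2 + \<mu> * \<theta> - r - \<mu> * b) * exp b < 0" using L mult_pos_pos[OF r_pos cs] by linarith
    then have n: "\<sigma>\<^sup>2 / 2 + \<mu> * \<theta> - r - \<mu> * b < 0" by (simp add: mult_less_0_iff)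
    have "(\<sigma>\<^sup>2 / 2 + \<mu> * \<theta> - r - \<mu> * x) * exp x \<le> (\<sigma>\<^sup>2 / 2 + \<mu> * \<theta> - r - \<mu> * b) * exp x"
      using x mu_pos by (intro mult_right_mono) auto
    also have "\<dots> \<le> (\<sigma>\<^sup>2 / 2 + \<mu> * \<theta> - r - \<mu> * b) * exp b"
      using n x by (intro mult_left_mono_neg) auto
    finally show "(\<sigma>\<^sup>2 / 2 + \<mu> * \<theta> - r - \<mu> * x) * exp x + r * cs \<le> 0" using L by simp
  qed
qed

end

section \<open>The exit problem and its candidate value function\<close>

locale ou_exit = ou_params +
  fixes cs b :: real
  assumes cs_pos: "cs > 0" and exp_b: "exp b > cs"
    and majorant: "exp x - cs \<le> (exp b - cs) / F b * F x"
    and smooth_fit: "exp b = (exp b - cs) / F b * F' b"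
    and drift: "x \<ge> b \<Longrightarrow> (\<sigma>\<^sup>2 / 2 + \<mu> * \<theta> - r - \<mu> * x) * exp x + r * cs \<le> 0"
begin

definition "K = (exp b - cs) / F b"
text \<open>Candidate for \<open>V\<close>: wait below \<open>b\<close>, stop at once from
  \<open>b\<close> on. Equality with \<open>V\<close> is proved only inside the theorem.\<close>

definition "W x = (if x < b then K * F x else exp x - cs)"
definition "W' x = (if x < b then K * F' x else exp x)"

lemma K_pos: "K > 0"
  using exp_b F_pos[of b] by (simp add: K_def)

lemma K_F_b: "K * F b = exp b - cs" "K * F' b = exp b"
  using F_pos[of b] smooth_fit by (simp_all add: K_def)

lemma W_DERIV: "(W has_real_derivative W' x) (at x)"
  unfolding W_def[abs_def] W'_def
  by (rule DERIV_if_less)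
     (auto intro!: derivative_eq_intros F_DERIV simp: K_F_b)

lemma W_ge: "exp x - cs \<le> W x"
  using majorant[of x] by (simp add: W_def K_def)

lemma W_nonneg: "W x \<ge> 0"
proof (cases "x < b")
  case True
  then show ?thesis using K_pos F_pos[of x] by (simp add: W_def)
next
  case False
  then have "exp b \<le> exp x" by simp
  then have "cs < exp x" using exp_b by linarith
  then show ?thesis using False by (simp add: W_def)
qed

text \<open>Left of \<open>b\<close> the weighted Wronskian is constant, being that of a multiple of
  \<open>F\<close>; right of \<open>b\<close> it decreases by \<open>drift\<close>. Smooth fit makes
  the two descriptions agree at \<open>b\<close>, so a jump of the second derivative there does no
  harm.\<close>

lemma superharmonic_W: "superharmonic W"
proof (rule superharmonicI[OF W_nonneg W_DERIV])
  have 1: "wr W W' y \<le> wr W W' x" if "x \<le> y" "y \<le> b" for x y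
  proof -
    have "wr W W' z = wr (\<lambda>x. K * F x) (\<lambda>x. K * F' x) z" if "z \<le> b" for z
      using that K_F_b by (cases "z = b") (auto simp: wr_def W_def W'_def)
    moreover have "wr (\<lambda>x. K * F x) (\<lambda>x. K * F' x) y \<le> wr (\<lambda>x. K * F x) (\<lambda>x. K * F' x) x"
      by (rule wr_decreasing[where ?U2.0 = "\<lambda>x. K * F'' x"])
         (use that F_ode scaled_ode[OF F_ode, of K] in \<open>auto intro!: DERIV_cmult F_DERIV F'_DERIV\<close>)
    ultimately show ?thesis using that by simp
  qed
  have 2: "wr W W' y \<le> wr W W' x" if "b \<le> x" "x \<le> y" for x y
  proof -
    have "wr W W' z = wr (\<lambda>x. exp x - cs) exp z" if "b \<le> z" for z
      using that by (auto simp: wr_def W_def W'_def)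
    moreover have "wr (\<lambda>x. exp x - cs) exp y \<le> wr (\<lambda>x. exp x - cs) exp x"
    proof (rule wr_decreasing[where ?U2.0 = exp])
      fix z assume "x \<le> z"
      then show "\<sigma>\<^sup>2 / 2 * exp z + \<mu> * (\<theta> - z) * exp z - r * (exp z - cs) \<le> 0"
        using drift[of z] exp_generator[of z "- cs"] that by simp
    qed (use that in \<open>auto intro!: derivative_eq_intros\<close>)
    ultimately show ?thesis using that by simp
  qed
  show "wr W W' y \<le> wr W W' x" if "x \<le> y" for x y
    by (rule antimono_glue[OF 1 2 that])
qed

lemma W_continuous: "continuous_on S W"
  by (intro continuous_at_imp_continuous_on ballI DERIV_isCont[OF W_DERIV])

text \<open>Makes the supremum in the hypothesis of the theorem a genuine one.\<close>

lemma W_minus_exp_bounded: "W x - exp x \<le> K * F b"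
proof (cases "x < b")
  case True
  then have "K * F x \<le> K * F b" using K_pos F_strict_mono[of x b] by simp
  then have "K * F x - exp x \<le> K * F b" using exp_gt_zero[of x] by linarith
  then show ?thesis using True by (simp add: W_def)
next
  case False
  then show ?thesis using exp_b cs_pos by (simp add: W_def K_F_b)
qed

end

section \<open>The entry problem and its candidate value function\<close>

locale ou_entry = ou_exit +
  fixes cb a d :: real
  assumes cb_pos: "cb > 0" and a_le_d: "a \<le> d" and d_less_b: "d < b"
    and h_a: "W a - exp a - cb > 0" and h_d: "W d - exp d - cb > 0"
    and F_majorant: "W x - exp x - cb \<le> (W a - exp a - cb) / F a * F x"
    and G_majorant: "W x - exp x - cb \<le> (W d - exp d - cb) / G d * G x"
begin

definition "h x = W x - exp x - cb"
definition "h' x = W' x - exp x"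
definition "P = h a / F a"
definition "Q = h d / G d"

lemma h_pos: "h a > 0" "h d > 0"
  using h_a h_d by (auto simp: h_def)

lemma h_DERIV: "(h has_real_derivative h' x) (at x)"
  unfolding h_def[abs_def] h'_def by (auto intro!: derivative_eq_intros W_DERIV)

text \<open>The second derivative of \<open>W\<close> jumps at \<open>b\<close> in general, hence
  the restriction to the left of \<open>b\<close> and the condition \<open>d < b\<close> in the
  locale.\<close>

lemma h'_DERIV:
  assumes "x < b"
  shows "(h' has_real_derivative K * F'' x - exp x) (at x)"
proof -
  have "\<forall>\<^sub>F y in nhds x. y < b"
    using assms by (intro eventually_nhds_in_open[of "{..<b}", simplified]) auto
  then have "\<forall>\<^sub>F y in nhds x. h' y = K * F' y - exp y"
    by (rule eventually_mono) (simp add: h'_def W'_def)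
  moreover have "((\<lambda>x. K * F' x - exp x) has_real_derivative K * F'' x - exp x) (at x)"
    by (intro DERIV_diff DERIV_cmult F'_DERIV DERIV_exp)
  ultimately show ?thesis by (subst DERIV_cong_ev[OF refl _ refl])
qed

text \<open>\<open>K * F\<close> solves the ODE, so only the contribution of
  \<open>- exp x - cb\<close> survives.\<close>

lemma h_generator:
  assumes "x < b"
  shows "\<sigma>\<^sup>2 / 2 * (K * F'' x - exp x) + \<mu> * (\<theta> - x) * h' x - r * h x
    = r * cb - (\<sigma>\<^sup>2 / 2 + \<mu> * \<theta> - r - \<mu> * x) * exp x"
  using scaled_ode[OF F_ode, of K x] assms by (simp add: h_def h'_def W_def W'_def algebra_simps)

lemma P_pos: "P > 0" and Q_pos: "Q > 0"
  using h_pos F_pos[of a] G_pos[of d] by (simp_all add: P_def Q_def)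

lemma P_F_a: "h a = P * F a" and Q_G_d: "h d = Q * G d"
  using F_pos[of a] G_pos[of d] by (simp_all add: P_def Q_def)

lemma h_le: "h x \<le> P * F x" "h x \<le> Q * G x"
  using F_majorant[of x] G_majorant[of x] by (simp_all add: P_def Q_def h_def)

lemma entry_conditions:
  shows h'_a: "h' a = P * F' a" and drift_a: "r * cb \<le> (\<sigma>\<^sup>2 / 2 + \<mu> * \<theta> - r - \<mu> * a) * exp a"
    and h'_d: "h' d = Q * G' d" and drift_d: "r * cb \<le> (\<sigma>\<^sup>2 / 2 + \<mu> * \<theta> - r - \<mu> * d) * exp d"
proof -
  have a: "a < b" using a_le_d d_less_b by simp
  have *: "x < b" if "\<bar>x - z\<bar> < b - z" for x z :: real using that by simp
  \<comment> \<open>The radii \<open>b - a\<close> and \<open>b - d\<close> keep the neighbourhoods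
    left of \<open>b\<close>, where \<open>h'\<close> is differentiable.\<close>
  note 1 = touching_conditions[where e = "b - a" and U = h and U' = h' and H = "\<lambda>x. P * F x"
      and a = a and H' = "\<lambda>x. P * F' x" and H'' = "\<lambda>x. P * F'' x" and U'' = "\<lambda>x. K * F'' x - exp x",
      OF DERIV_cmult[OF F_DERIV] DERIV_cmult[OF F'_DERIV] scaled_ode[OF F_ode] _ h_DERIV h'_DERIV[OF *[of _ a]] h_le(1) P_F_a]
  note 2 = touching_conditions[where e = "b - d" and U = h and U' = h' and H = "\<lambda>x. Q * G x"
      and a = d and H' = "\<lambda>x. Q * G' x" and H'' = "\<lambda>x. Q * G'' x" and U'' = "\<lambda>x. K * F'' x - exp x",
      OF DERIV_cmult[OF G_DERIV] DERIV_cmult[OF G'_DERIV] scaled_ode[OF G_ode] _ h_DERIV h'_DERIV[OF *[of _ d]] h_le(2) Q_G_d]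
  have e: "b - a > 0" "b - d > 0" using a d_less_b by auto
  show "h' a = P * F' a" "h' d = Q * G' d" using 1(1) 2(1) e by auto
  show "r * cb \<le> (\<sigma>\<^sup>2 / 2 + \<mu> * \<theta> - r - \<mu> * a) * exp a"
    "r * cb \<le> (\<sigma>\<^sup>2 / 2 + \<mu> * \<theta> - r - \<mu> * d) * exp d"
    using 1(2) 2(2) e h_generator[OF a] h_generator[OF d_less_b] by simp_all
qed

text \<open>The condition reads \<open>r * cb * exp (- x) \<le> linear x\<close>, so the set where it holds is an interval.\<close>

lemma drift_between:
  assumes "a \<le> x" "x \<le> d"
  shows "r * cb \<le> (\<sigma>\<^sup>2 / 2 + \<mu> * \<theta> - r - \<mu> * x) * exp x"
proof -
  let ?l = "\<lambda>x. \<sigma>\<^sup>2 / 2 + \<mu> * \<theta> - r - \<mu> * x" and ?g = "\<lambda>x. r * cb * exp (- x) - (\<sigma>\<^sup>2 / 2 + \<mu> * \<theta> - r - \<mu> * x)"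
  have iff: "r * cb \<le> ?l x * exp x \<longleftrightarrow> ?g x \<le> 0" for x
    by (simp add: exp_minus field_simps)
  have conv: "convex_on UNIV ?g"
  proof (rule f''_ge0_imp_convex)
    show "(?g has_real_derivative (- r * cb * exp (- x) + \<mu>)) (at x)" for x
      by (auto intro!: derivative_eq_intros)
    show "((\<lambda>x. - r * cb * exp (- x) + \<mu>) has_real_derivative r * cb * exp (- x)) (at x)" for x
      by (auto intro!: derivative_eq_intros)
    show "r * cb * exp (- x) \<ge> 0" for x using r_pos cb_pos by simp
  qed auto
  have "x \<in> closed_segment a d" using assms by (simp add: closed_segment_eq_real_ivl)
  then obtain u where u: "0 \<le> u" "u \<le> 1" "x = (1 - u) *\<^sub>R a + u *\<^sub>R d" by (auto simp: in_segment)
  have "?g x \<le> (1 - u) * ?g a + u * ?g d"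
    unfolding u(3) by (rule convex_onD[OF conv]) (use u in auto)
  also have "\<dots> \<le> 0"
    using drift_a drift_d u(1,2) unfolding iff by (intro add_nonpos_nonpos mult_nonneg_nonpos) auto
  finally show ?thesis unfolding iff .
qed

text \<open>Minimum principle: at a negative interior minimum the slope is 0 and the second
  derivative nonnegative, so the expression in \<open>h_generator\<close> would be positive, against
  \<open>drift_between\<close>. The values at both ends are positive.\<close>

lemma h_nonneg:
  assumes "a \<le> x" "x \<le> d"
  shows "h x \<ge> 0"
proof -
  have "continuous_on {a..d} h"
    by (intro continuous_at_imp_continuous_on ballI DERIV_isCont[OF h_DERIV])
  then obtain z where z: "z \<in> {a..d}" "\<And>y. y \<in> {a..d} \<Longrightarrow> h z \<le> h y"
    using continuous_attains_inf[OF compact_Icc, of a d h] a_le_d by auto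
  have "h z \<ge> 0"
  proof (rule ccontr)
    assume n: "\<not> h z \<ge> 0"
    then have z': "a < z" "z < d" using z(1) h_pos by (auto simp: less_le)
    have zb: "z < b" using z' d_less_b by simp
    define e where "e = min (z - a) (d - z)"
    have e: "e > 0" "\<And>y. \<bar>y - z\<bar> < e \<Longrightarrow> y \<in> {a..d}" using z' by (auto simp: e_def)
    have "h' z = 0"
      by (rule local_min_second_derivative(1)[OF h_DERIV h'_DERIV[OF zb] e(1)]) (use e(2) z(2) in blast)
    moreover have "K * F'' z - exp z \<ge> 0"
      by (rule local_min_second_derivative(2)[OF h_DERIV h'_DERIV[OF zb] e(1)]) (use e(2) z(2) in blast)
    ultimately have "\<sigma>\<^sup>2 / 2 * (K * F'' z - exp z) + \<mu> * (\<theta> - z) * h' z - r * h z > 0"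
      using mult_pos_neg[OF r_pos, of "h z"] n mult_nonneg_nonneg[of "\<sigma>\<^sup>2 / 2" "K * F'' z - exp z"]
      by (simp del: mult_nonneg_nonneg zero_le_mult_iff)
    then show False using h_generator[OF zb] drift_between[of z] z' by simp
  qed
  then show ?thesis using z(2)[of x] assms by simp
qed

definition "Y x = (if x < a then P * F x else if x \<le> d then h x else Q * G x)"
definition "Y' x = (if x < a then P * F' x else if x \<le> d then h' x else Q * G' x)"

lemma Y_DERIV: "(Y has_real_derivative Y' x) (at x)"
proof -
  define Z where "Z = (\<lambda>x. if x < d then h x else Q * G x)"
  define Z' where "Z' = (\<lambda>x. if x < d then h' x else Q * G' x)"
  have Z: "(Z has_real_derivative Z' x) (at x)" for x
    unfolding Z_def Z'_def
    by (rule DERIV_if_less[where f = h and f' = h' and g = "\<lambda>x. Q * G x" and g' = "\<lambda>x. Q * G' x"])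
       (auto intro!: h_DERIV DERIV_cmult G_DERIV simp: Q_G_d h'_d)
  have "((\<lambda>x. if x < a then P * F x else Z x) has_real_derivative (if x < a then P * F' x else Z' x)) (at x)"
  proof (rule DERIV_if_less[where f = "\<lambda>x. P * F x" and f' = "\<lambda>x. P * F' x" and g = Z and g' = Z'])
    show "P * F a = Z a" "P * F' a = Z' a"
      using a_le_d P_F_a h'_a Q_G_d h'_d by (auto simp: Z_def Z'_def)
  qed (intro Z DERIV_cmult F_DERIV)+
  moreover have "(\<lambda>x. if x < a then P * F x else Z x) = Y" "(\<lambda>x. if x < a then P * F' x else Z' x) = Y'"
    using Q_G_d h'_d by (auto simp: fun_eq_iff Z_def Z'_def Y_def Y'_def)
  ultimately show ?thesis by metis
qed

lemma Y_continuous: "continuous_on S Y"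
  by (intro continuous_at_imp_continuous_on ballI DERIV_isCont[OF Y_DERIV])

lemma Y_ge: "h x \<le> Y x"
  using h_le[of x] by (simp add: Y_def)

lemma Y_nonneg: "Y x \<ge> 0"
  using P_pos Q_pos F_pos[of x] G_pos[of x] h_nonneg[of x] by (auto simp: Y_def)

text \<open>Pasting with three pieces: the weighted Wronskian is constant left of \<open>a\<close>,
  decreasing on [a, d] by \<open>drift_between\<close>, and zero right of \<open>d\<close>, with
  smooth fit at both levels.\<close>

lemma superharmonic_Y: "superharmonic Y"
proof (rule superharmonicI[OF Y_nonneg Y_DERIV])
  have 1: "wr Y Y' y \<le> wr Y Y' x" if "x \<le> y" "y \<le> a" for x y
  proof -
    have "wr Y Y' z = wr (\<lambda>x. P * F x) (\<lambda>x. P * F' x) z" if "z \<le> a" for z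
      using that P_F_a h'_a a_le_d by (cases "z = a") (auto simp: wr_def Y_def Y'_def)
    moreover have "wr (\<lambda>x. P * F x) (\<lambda>x. P * F' x) y \<le> wr (\<lambda>x. P * F x) (\<lambda>x. P * F' x) x"
      by (rule wr_decreasing[where ?U2.0 = "\<lambda>x. P * F'' x"])
         (use that scaled_ode[OF F_ode, of P] in \<open>auto intro!: DERIV_cmult F_DERIV F'_DERIV\<close>)
    ultimately show ?thesis using that by simp
  qed
  have 2: "wr Y Y' y \<le> wr Y Y' x" if "a \<le> x" "x \<le> y" "y \<le> d" for x y
  proof -
    have "wr Y Y' z = wr h h' z" if "a \<le> z" "z \<le> d" for z
      using that by (auto simp: wr_def Y_def Y'_def)
    moreover have "wr h h' y \<le> wr h h' x"
    proof (rule wr_decreasing[where ?U2.0 = "\<lambda>x. K * F'' x - exp x"])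
      fix z assume "x \<le> z" "z \<le> y"
      then have z: "a \<le> z" "z \<le> d" "z < b" using that d_less_b by auto
      show "(h has_real_derivative h' z) (at z)" by (rule h_DERIV)
      show "(h' has_real_derivative K * F'' z - exp z) (at z)" by (rule h'_DERIV[OF z(3)])
      show "\<sigma>\<^sup>2 / 2 * (K * F'' z - exp z) + \<mu> * (\<theta> - z) * h' z - r * h z \<le> 0"
        using h_generator[OF z(3)] drift_between[OF z(1,2)] by simp
    qed (fact that)
    ultimately show ?thesis using that by simp
  qed
  have 3: "wr Y Y' y \<le> wr Y Y' x" if "d \<le> x" "x \<le> y" for x y
  proof -
    have "wr Y Y' z = wr (\<lambda>x. Q * G x) (\<lambda>x. Q * G' x) z" if "d \<le> z" for z
      using that Q_G_d h'_d a_le_d by (cases "z = d") (auto simp: wr_def Y_def Y'_def)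
    moreover have "wr (\<lambda>x. Q * G x) (\<lambda>x. Q * G' x) y \<le> wr (\<lambda>x. Q * G x) (\<lambda>x. Q * G' x) x"
      by (rule wr_decreasing[where ?U2.0 = "\<lambda>x. Q * G'' x"])
         (use that scaled_ode[OF G_ode, of Q] in \<open>auto intro!: DERIV_cmult G_DERIV G'_DERIV\<close>)
    ultimately show ?thesis using that by simp
  qed
  have 12: "wr Y Y' y \<le> wr Y Y' x" if "x \<le> y" "y \<le> d" for x y
  proof -
    consider "y \<le> a" | "a \<le> x" | "x \<le> a" "a \<le> y" by linarith
    then show ?thesis
    proof cases
      case 3
      have "wr Y Y' y \<le> wr Y Y' a" "wr Y Y' a \<le> wr Y Y' x"
        using 3 that 1[of x a] 2[of a y] by auto
      then show ?thesis by simp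
    qed (use 1 2 that in auto)
  qed
  show "wr Y Y' y \<le> wr Y Y' x" if "x \<le> y" for x y
    by (rule antimono_glue[OF 12 3 that])
qed

end

section \<open>Existence of the entry levels\<close>

context ou_exit
begin

lemma exists_entry_levels:
  assumes cb: "cb > 0" and x0: "W x0 - exp x0 - cb > 0"
  obtains a d where "ou_entry \<mu> \<sigma> \<theta> r cs b cb a d"
proof -
  define h where "h x = W x - exp x - cb" for x
  have hc: "continuous_on S h" for S
    unfolding h_def[abs_def] by (intro continuous_intros W_continuous)
  \<comment> \<open>From \<open>b\<close> on, buying is followed by an immediate sale, which loses
    \<open>cs + cb\<close>.\<close>
  have right: "h x < 0" if "x \<ge> b" for x
    using that cb cs_pos by (simp add: h_def W_def)
  obtain L where L: "\<And>x. x < L \<Longrightarrow> F x < cb / K"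
    using F_small[of "cb / K"] cb K_pos by auto
  have left: "h x < 0" if "x < min L b" for x
  proof -
    have "K * F x < cb" using L[of x] that K_pos by (simp add: pos_less_divide_eq mult.commute)
    then show ?thesis using that exp_gt_zero[of x] by (simp add: h_def W_def del: exp_gt_zero)
  qed
  have out: "h x < 0" if "x \<notin> {min L b..b}" for x
    using that left[of x] right[of x] by force
  \<comment> \<open>\<open>h\<close> is negative outside a compact interval and positive at
    \<open>x0\<close>, so its quotient by any positive continuous \<open>H\<close> attains a
    maximum; applied to \<open>F\<close> and to \<open>G\<close>.\<close>
  have mx: "\<exists>a. \<forall>x. h x / H x \<le> h a / H a" if H: "\<And>x. H x > 0" and Hc: "\<And>S. continuous_on S H" for H
  proof -
    have p: "h x0 / H x0 > 0" using x0 H by (simp add: h_def)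
    have "continuous_on {min L b..b} (\<lambda>x. h x / H x)"
      using H by (intro continuous_intros hc Hc) (metis less_irrefl)
    moreover have "h x / H x < h x0 / H x0" if "x \<notin> {min L b..b}" for x
      using divide_neg_pos[OF out[OF that] H[of x]] p by linarith
    ultimately show ?thesis using exists_max_of_signs[of "min L b" b "\<lambda>x. h x / H x" x0] p by blast
  qed
  obtain a where a: "\<And>x. h x / F x \<le> h a / F a" using mx[OF F_pos F_continuous] by auto
  obtain d where d: "\<And>x. h x / G x \<le> h d / G d" using mx[OF G_pos G_continuous] by auto
  have ha: "h a > 0"
  proof -
    have "0 < h x0 / F x0" using x0 F_pos by (simp add: h_def)
    also have "\<dots> \<le> h a / F a" by (rule a)
    finally show ?thesis using F_pos[of a] by (simp add: zero_less_divide_iff)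
  qed
  have hd: "h d > 0"
  proof -
    have "0 < h x0 / G x0" using x0 G_pos by (simp add: h_def)
    also have "\<dots> \<le> h d / G d" by (rule d)
    finally show ?thesis using G_pos[of d] by (simp add: zero_less_divide_iff)
  qed
  \<comment> \<open>If \<open>d < a\<close>, maximality of \<open>h / F\<close> at \<open>a\<close>
    with \<open>F\<close> increasing gives \<open>h d < h a\<close>, while maximality of
    \<open>h / G\<close> at \<open>d\<close> with \<open>G\<close> decreasing gives the
    reverse.\<close>
  have "a \<le> d"
  proof (rule ccontr)
    assume "\<not> a \<le> d"
    then have da: "d < a" by simp
    have "h d * F a \<le> h a * F d" using a[of d] F_pos[of a] F_pos[of d] by (simp add: field_simps)
    also have "\<dots> < h a * F a" using F_strict_mono[OF da] ha by simp
    finally have 1: "h d < h a" using F_pos[of a] by simp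
    have "h a * G d \<le> h d * G a" using d[of a] G_pos[of a] G_pos[of d] by (simp add: field_simps)
    also have "\<dots> < h d * G d" using G_strict_antimono[OF da] hd by simp
    finally have 2: "h a < h d" using G_pos[of d] by simp
    show False using 1 2 by simp
  qed
  moreover have "d < b" using hd right[of d] by force
  ultimately have "ou_entry \<mu> \<sigma> \<theta> r cs b cb a d"
    using ha hd cb a d F_pos G_pos
    by unfold_locales (auto simp: h_def pos_divide_le_eq)
  then show ?thesis by (rule that)
qed

end

section \<open>Independence of Brownian past and future\<close>

text \<open>Independence of increments is assumed along infinite strictly increasing time sequences,
  so a finite set of times has to be an initial segment of one.\<close>

lemma finite_set_strict_mono_enum:
  fixes T :: "real set"
  assumes "finite T" "T \<noteq> {}"
  obtains ts m where "strict_mono ts" "T = ts ` {..m::nat}"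
proof -
  have "T \<noteq> {} \<longrightarrow> (\<exists>ts m. strict_mono ts \<and> T = ts ` {..m::nat})"
    using assms(1)
  proof (induction rule: finite_linorder_max_induct)
    case (insert b A)
    show ?case
    proof (cases "A = {}")
      case True
      have "strict_mono (\<lambda>i. b + real i)" by (simp add: strict_mono_def)
      moreover have "insert b A = (\<lambda>i. b + real i) ` {..0}" using True by simp
      ultimately show ?thesis by blast
    next
      case False
      with insert obtain ts and m :: nat where ts: "strict_mono ts" "A = ts ` {..m}" by auto
      \<comment> \<open>Index \<open>Suc m\<close> gives \<open>b\<close> itself; later indices
        merely continue the sequence.\<close>
      define us where "us i = (if i \<le> m then ts i else b + real (i - Suc m))" for i
      have "us i < us (Suc i)" for i
      proof (cases "i < m")
        case True then show ?thesis using ts(1) by (simp add: us_def strict_mono_def)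
      next
        case False
        then show ?thesis using insert(2) ts(2) by (cases "i = m") (auto simp: us_def)
      qed
      then have "strict_mono us" by (simp add: strict_mono_Suc_iff)
      moreover have "insert b A = us ` {..Suc m}"
        unfolding ts(2) atMost_Suc image_insert by (auto simp: us_def)
      ultimately show ?thesis by blast
    qed
  qed simp
  then show ?thesis using assms(2) that by blast
qed

lemma char_distr_scale:
  assumes [measurable]: "f \<in> borel_measurable M"
  shows "char (distr M borel (\<lambda>x. c * f x)) \<xi> = char (distr M borel f) (\<xi> * c)"
  unfolding char_def by (subst (1 2) integral_distr) (auto simp: mult.assoc)

locale brownian =
  fixes M :: "'a measure" and B :: "real \<Rightarrow> 'a \<Rightarrow> real"
  assumes BM: "brownian_motion M B"
begin

sublocale prob_space M
  using BM by (simp add: brownian_motion_def)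

lemma B_measurable [measurable]: "B t \<in> borel_measurable M"
  and B_0: "\<omega> \<in> space M \<Longrightarrow> B 0 \<omega> = 0"
  and B_distributed: "0 \<le> s \<Longrightarrow> s < t \<Longrightarrow> distributed M lborel (\<lambda>\<omega>. B t \<omega> - B s \<omega>)
          (\<lambda>y. ennreal (normal_density 0 (sqrt (t - s)) y))"
  and B_indep: "0 \<le> ts (0::nat) \<Longrightarrow> strict_mono ts \<Longrightarrow>
      indep_vars (\<lambda>_. borel) (\<lambda>i \<omega>. B (ts (Suc i)) \<omega> - B (ts i) \<omega>) {..<n}"
  using BM by (auto simp: brownian_motion_def)

definition "events_of Y T = (\<Union>q\<in>T. {Y q -` A \<inter> space M | A. A \<in> sets (borel :: real measure)})"
text \<open>A measure space used only for its sigma-algebra, the raw filtration at \<open>s\<close>,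
  so that adaptedness becomes ordinary measurability.\<close>

definition "past s = sigma (space M) (events_of B {0..s})"
definition "future s = sigma (space M) (events_of (\<lambda>q \<omega>. B q \<omega> - B s \<omega>) {s..})"

lemma events_of_Pow: "events_of Y T \<subseteq> Pow (space M)"
  by (auto simp: events_of_def)

lemma sets_past_future:
  "sets (past s) = sigma_sets (space M) (events_of B {0..s})"
  "sets (future s) = sigma_sets (space M) (events_of (\<lambda>q \<omega>. B q \<omega> - B s \<omega>) {s..})"
  unfolding past_def future_def by (rule sets_measure_of[OF events_of_Pow])+

lemma sets_past: "sets (past s) = nat_filtration M B s"
  unfolding sets_past_future nat_filtration_def events_of_def ..

lemma space_past [simp]: "space (past s) = space M" and space_future [simp]: "space (future s) = space M"
  unfolding past_def future_def by (rule space_measure_of[OF events_of_Pow])+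

lemma past_subset: "sets (past s) \<subseteq> sets M"
  unfolding sets_past_future by (rule sets.sigma_sets_subset) (auto simp: events_of_def)

lemma future_subset: "sets (future s) \<subseteq> sets M"
  unfolding sets_past_future by (rule sets.sigma_sets_subset) (auto simp: events_of_def)

lemma B_past_measurable:
  assumes "0 \<le> q" "q \<le> s"
  shows "B q \<in> borel_measurable (past s)"
proof (rule measurableI)
  fix A :: "real set" assume "A \<in> sets borel"
  then have "B q -` A \<inter> space M \<in> events_of B {0..s}" using assms unfolding events_of_def by fastforce
  then show "B q -` A \<inter> space (past s) \<in> sets (past s)" by (simp add: sets_past_future sigma_sets.Basic)
qed simp

lemma B_future_measurable: "s \<le> q \<Longrightarrow> (\<lambda>\<omega>. B q \<omega> - B s \<omega>) \<in> borel_measurable (future s)"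
  by (rule measurableI) (auto simp: sets_past_future events_of_def intro!: sigma_sets.Basic)

text \<open>With 0 and \<open>s\<close> adjoined to the times, events at \<open>T1\<close> depend on
  the increments before \<open>s\<close>, by telescoping from \<open>B 0 = 0\<close>, and events at
  \<open>T2\<close> on the increments after \<open>s\<close>; these two blocks of increments are
  independent.\<close>

lemma finite_past_future_indep:
  assumes T1: "finite T1" "T1 \<subseteq> {0..s}" and T2: "finite T2" "T2 \<subseteq> {s..}" and s: "s \<ge> 0"
    and A: "A \<in> sigma_sets (space M) (events_of B T1)"
    and C: "C \<in> sigma_sets (space M) (events_of (\<lambda>q \<omega>. B q \<omega> - B s \<omega>) T2)"
  shows "prob (A \<inter> C) = prob A * prob C"
proof -
  define T where "T = {0, s} \<union> T1 \<union> T2"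
  obtain ts m where ts: "strict_mono ts" "T = ts ` {..m::nat}"
    by (rule finite_set_strict_mono_enum[of T]) (use T1 T2 in \<open>auto simp: T_def\<close>)
  have mono: "ts i \<le> ts j \<longleftrightarrow> i \<le> j" for i j using ts(1) by (rule strict_mono_less_eq)
  have T_nonneg: "u \<ge> 0" if "u \<in> T" for u using that T1 T2 s by (auto simp: T_def)
  have "0 \<in> ts ` {..m}" unfolding ts(2)[symmetric] by (simp add: T_def)
  then obtain i0 where i0: "ts i0 = 0" by force
  have "ts 0 \<in> T" unfolding ts(2) by auto
  then have ts0: "ts 0 = 0" using T_nonneg[of "ts 0"] mono[of 0 i0] i0 by simp
  have "s \<in> ts ` {..m}" unfolding ts(2)[symmetric] by (simp add: T_def)
  then obtain l where l: "l \<le> m" "ts l = s" by force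
  define I where "I i \<omega> = B (ts (Suc i)) \<omega> - B (ts i) \<omega>" for i \<omega>
  have "indep_vars (\<lambda>_. borel) I {..<m}"
    unfolding I_def[abs_def] using ts0 ts(1) by (intro B_indep) auto
  then have "indep_var (PiM {0..<l} (\<lambda>_. borel)) (\<lambda>\<omega>. restrict (\<lambda>i. I i \<omega>) {0..<l})
      (PiM {l..<m} (\<lambda>_. borel)) (\<lambda>\<omega>. restrict (\<lambda>i. I i \<omega>) {l..<m})" (is "indep_var ?P1 ?R1 ?P2 ?R2")
    by (rule indep_var_restrict) (use l in auto)
  then have ind: "indep_set (sigma_sets (space M) {?R1 -` A \<inter> space M |A. A \<in> sets ?P1})
      (sigma_sets (space M) {?R2 -` A \<inter> space M |A. A \<in> sets ?P2})"
    unfolding indep_var_eq by blast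
  have gen: "Y -` D \<inter> space M \<in> {(\<lambda>\<omega>. restrict (\<lambda>i. I i \<omega>) J) -` A \<inter> space M |A. A \<in> sets (PiM J (\<lambda>_. borel))}"
    if D: "D \<in> sets borel" and K: "K \<subseteq> J" and Y: "\<And>\<omega>. \<omega> \<in> space M \<Longrightarrow> Y \<omega> = (\<Sum>i\<in>K. I i \<omega>)"
    for Y :: "'a \<Rightarrow> real" and D J K
  proof -
    let ?f = "\<lambda>x. \<Sum>i\<in>K. x i :: real"
    have m: "?f \<in> borel_measurable (PiM J (\<lambda>_. borel))"
      using K by (intro borel_measurable_sum measurable_component_singleton) auto
    have "Y -` D \<inter> space M = (\<lambda>\<omega>. restrict (\<lambda>i. I i \<omega>) J) -` (?f -` D \<inter> space (PiM J (\<lambda>_. borel))) \<inter> space M"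
    proof -
      have "?f (restrict (\<lambda>i. I i \<omega>) J) = (\<Sum>i\<in>K. I i \<omega>)" for \<omega>
        using K by (intro sum.cong) auto
      then show ?thesis using Y by (auto simp: space_PiM)
    qed
    moreover have "?f -` D \<inter> space (PiM J (\<lambda>_. borel)) \<in> sets (PiM J (\<lambda>_. borel))"
      using m D by (rule measurable_sets)
    ultimately show ?thesis by blast
  qed
  have incr: "(\<Sum>i\<in>{i..<j}. I i \<omega>) = B (ts j) \<omega> - B (ts i) \<omega>" if "i \<le> j" for i j \<omega>
    unfolding I_def using sum_Suc_diff'[OF that, of "\<lambda>i. B (ts i) \<omega>"] .
  have "events_of B T1 \<subseteq> {?R1 -` A \<inter> space M |A. A \<in> sets ?P1}"
  proof
    fix E assume "E \<in> events_of B T1"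
    then obtain q D where q: "q \<in> T1" "D \<in> sets borel" "E = B q -` D \<inter> space M" by (auto simp: events_of_def)
    have "q \<in> T" using q(1) unfolding T_def by blast
    then have "q \<in> ts ` {..m}" unfolding ts(2) .
    then obtain j where j: "q = ts j" by auto
    have "j \<le> l" using q T1 mono[of j l] j l by auto
    then show "E \<in> {?R1 -` A \<inter> space M |A. A \<in> sets ?P1}"
      unfolding q(3) using incr[of 0 j] ts0 B_0 j by (intro gen[OF q(2), of "{0..<j}"]) auto
  qed
  note A' = subsetD[OF sigma_sets_mono'[OF this] A]
  have "events_of (\<lambda>q \<omega>. B q \<omega> - B s \<omega>) T2 \<subseteq> {?R2 -` A \<inter> space M |A. A \<in> sets ?P2}"
  proof
    fix E assume "E \<in> events_of (\<lambda>q \<omega>. B q \<omega> - B s \<omega>) T2"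
    then obtain q D where q: "q \<in> T2" "D \<in> sets borel" "E = (\<lambda>\<omega>. B q \<omega> - B s \<omega>) -` D \<inter> space M"
      unfolding events_of_def by blast
    have "q \<in> T" using q(1) unfolding T_def by blast
    then have "q \<in> ts ` {..m}" unfolding ts(2) .
    then obtain j where j: "q = ts j" "j \<le> m" by auto
    have "l \<le> j" using q T2 mono[of l j] j l by auto
    then show "E \<in> {?R2 -` A \<inter> space M |A. A \<in> sets ?P2}"
      unfolding q(3)
    proof (intro gen[OF q(2), of "{l..<j}"])
      show "{l..<j} \<subseteq> {l..<m}" using j(2) by auto
      show "B q \<omega> - B s \<omega> = (\<Sum>i\<in>{l..<j}. I i \<omega>)" for \<omega>
        unfolding incr[OF \<open>l \<le> j\<close>] j(1) l(2) ..
    qed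
  qed
  note C' = subsetD[OF sigma_sets_mono'[OF this] C]
  show ?thesis by (rule indep_setD[OF ind A' C'])
qed

text \<open>Events of finitely many times form a pi-system, whereas the generator
  \<open>events_of\<close> is in general not closed under intersection.\<close>

definition "cylinders Y S =
  {A. \<exists>T. finite T \<and> T \<subseteq> S \<and> A \<in> sigma_sets (space M) (events_of Y T)}"

lemma Int_stable_cylinders: "Int_stable (cylinders Y S)"
proof (rule Int_stableI)
  fix a b assume "a \<in> cylinders Y S" "b \<in> cylinders Y S"
  then obtain T U where T: "finite T" "T \<subseteq> S" "a \<in> sigma_sets (space M) (events_of Y T)"
    and U: "finite U" "U \<subseteq> S" "b \<in> sigma_sets (space M) (events_of Y U)"
    by (auto simp: cylinders_def)
  have "events_of Y T \<subseteq> events_of Y (T \<union> U)" "events_of Y U \<subseteq> events_of Y (T \<union> U)"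
    by (auto simp: events_of_def)
  note ab = subsetD[OF sigma_sets_mono'[OF this(1)] T(3)] subsetD[OF sigma_sets_mono'[OF this(2)] U(3)]
  interpret sigma_algebra "space M" "sigma_sets (space M) (events_of Y (T \<union> U))"
    by (rule sigma_algebra_sigma_sets[OF events_of_Pow])
  show "a \<inter> b \<in> cylinders Y S"
    unfolding cylinders_def using T U Int[OF ab] by (auto intro!: exI[of _ "T \<union> U"])
qed

lemma events_of_subset_cylinders: "events_of Y S \<subseteq> cylinders Y S"
proof
  fix E assume "E \<in> events_of Y S"
  then obtain q where "q \<in> S" "E \<in> events_of Y {q}" by (auto simp: events_of_def)
  then show "E \<in> cylinders Y S"
    unfolding cylinders_def by (auto intro!: exI[of _ "{q}"])
qed

lemma past_future_indep:
  assumes "s \<ge> 0"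
  shows "indep_set (sets (past s)) (sets (future s))"
proof -
  let ?B = "\<lambda>q \<omega>. B q \<omega> - B s \<omega>"
  have "cylinders Y S \<subseteq> events" if "\<And>q. Y q \<in> borel_measurable M" for Y :: "real \<Rightarrow> 'a \<Rightarrow> real" and S
  proof -
    have "events_of Y T \<subseteq> events" for T
      using measurable_sets[OF that] unfolding events_of_def by blast
    then have "sigma_sets (space M) (events_of Y T) \<subseteq> events" for T
      by (rule sets.sigma_sets_subset)
    then show ?thesis unfolding cylinders_def by blast
  qed
  then have ev: "cylinders B {0..s} \<subseteq> events" "cylinders ?B {s..} \<subseteq> events"
    by (auto simp del: subset_iff)
  have "indep_set (cylinders B {0..s}) (cylinders ?B {s..})"
    by (rule indep_setI[OF ev])
       (unfold cylinders_def, use assms finite_past_future_indep in blast)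
  then have *: "indep_set (sigma_sets (space M) (cylinders B {0..s})) (sigma_sets (space M) (cylinders ?B {s..}))"
    by (rule indep_set_sigma_sets[OF _ Int_stable_cylinders Int_stable_cylinders])
  have p: "sets (past s) \<subseteq> sigma_sets (space M) (cylinders B {0..s})"
    and f: "sets (future s) \<subseteq> sigma_sets (space M) (cylinders ?B {s..})"
    unfolding sets_past_future by (rule sigma_sets_mono'[OF events_of_subset_cylinders])+
  show ?thesis
    by (rule indep_setI[OF past_subset future_subset]) (rule indep_setD[OF * subsetD[OF p] subsetD[OF f]])
qed

lemma char_increment:
  assumes "0 \<le> s" "s < t"
  shows "char (distr M borel (\<lambda>\<omega>. c * (B t \<omega> - B s \<omega>))) \<xi> = exp (- ((\<xi> * c)\<^sup>2 * (t - s) / 2))"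
proof -
  let ?Z = "\<lambda>\<omega>. (B t \<omega> - B s \<omega> - 0) / sqrt (t - s)"
  have v: "sqrt (t - s) > 0" using assms by simp
  have "distributed M lborel ?Z std_normal_density"
    using B_distributed[OF assms] normal_standard_normal_convert[OF v, of "\<lambda>\<omega>. B t \<omega> - B s \<omega>" 0] by simp
  then have d: "distr M borel ?Z = std_normal_distribution"
    using distributed_distr_eq_density[of M lborel ?Z std_normal_density]
    by (simp cong: distr_cong)
  have "(\<lambda>\<omega>. c * (B t \<omega> - B s \<omega>)) = (\<lambda>\<omega>. (c * sqrt (t - s)) * ?Z \<omega>)"
    using v by (simp add: fun_eq_iff del: real_sqrt_gt_0_iff)
  then have "char (distr M borel (\<lambda>\<omega>. c * (B t \<omega> - B s \<omega>))) \<xi> = char std_normal_distribution (\<xi> * (c * sqrt (t - s)))"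
    using char_distr_scale[of ?Z M "c * sqrt (t - s)" \<xi>] by (simp only: d) measurable
  also have "\<dots> = exp (- ((\<xi> * c)\<^sup>2 * (t - s) / 2))"
    using assms by (simp add: char_std_normal_distribution power_mult_distrib mult.assoc)
  finally show ?thesis .
qed

end

section \<open>Markov property of the Ornstein-Uhlenbeck process\<close>

locale ou = brownian M B + ou_params \<mu> \<sigma> \<theta> r
  for M :: "'a measure" and B :: "real \<Rightarrow> 'a \<Rightarrow> real" and \<mu> \<sigma> \<theta> r :: real +
  fixes X :: "real \<Rightarrow> real \<Rightarrow> 'a \<Rightarrow> real"
  assumes OU: "OU_process M B \<mu> \<theta> \<sigma> X"
begin

lemma X_continuous: "\<omega> \<in> space M \<Longrightarrow> continuous_on {0..} (\<lambda>t. X x t \<omega>)"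
  using OU by (auto simp: OU_process_def)

lemma X_eq: "\<omega> \<in> space M \<Longrightarrow> t \<ge> 0 \<Longrightarrow>
    X x t \<omega> = x + integral {0..t} (\<lambda>s. \<mu> * (\<theta> - X x s \<omega>)) + \<sigma> * B t \<omega>"
  using OU by (auto simp: OU_process_def)

lemma X_0: "\<omega> \<in> space M \<Longrightarrow> X x 0 \<omega> = x"
  using X_eq[of \<omega> 0 x] B_0 by simp

lemma X_increment:
  assumes \<omega>: "\<omega> \<in> space M" and pq: "0 \<le> p" "p \<le> q"
  shows "((\<lambda>s. \<mu> * (\<theta> - X x s \<omega>)) has_integral X x q \<omega> - X x p \<omega> - \<sigma> * (B q \<omega> - B p \<omega>)) {p..q}"
proof -
  have int: "(\<lambda>s. \<mu> * (\<theta> - X x s \<omega>)) integrable_on {u..v}" if "0 \<le> u" for u v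
    using that by (intro integrable_continuous_interval continuous_intros
        continuous_on_subset[OF X_continuous[OF \<omega>]]) auto
  have "integral {0..p} (\<lambda>s. \<mu> * (\<theta> - X x s \<omega>)) + integral {p..q} (\<lambda>s. \<mu> * (\<theta> - X x s \<omega>))
      = integral {0..q} (\<lambda>s. \<mu> * (\<theta> - X x s \<omega>))"
    using pq by (intro Henstock_Kurzweil_Integration.integral_combine int) auto
  then have "integral {p..q} (\<lambda>s. \<mu> * (\<theta> - X x s \<omega>)) = X x q \<omega> - X x p \<omega> - \<sigma> * (B q \<omega> - B p \<omega>)"
    using X_eq[OF \<omega> pq(1), of x] X_eq[OF \<omega>, of q x] pq by (simp add: algebra_simps)
  then show ?thesis using int[OF pq(1), of q] by (metis has_integral_integral)
qed

text \<open>The stochastic convolution, \<open>\<sigma>\<close> times the integral of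
  \<open>exp (- \<mu> * (t - u))\<close> against \<open>B\<close> over [s, t]. Defined as the
  deviation of \<open>X\<close> from its conditional mean, it involves no stochastic
  integral.\<close>

definition "noise x s t \<omega> = X x t \<omega> - (\<theta> + exp (- \<mu> * (t - s)) * (X x s \<omega> - \<theta>))"

definition "grid s t n i = s + (t - s) * real i / real n"

text \<open>Left-endpoint sums of that integral. They do not involve the start \<open>x\<close>,
  hence neither does their limit.\<close>

definition "riemann s t n \<omega> =
  (\<Sum>i<n. \<sigma> * exp (- \<mu> * (t - grid s t n i)) * (B (grid s t n (Suc i)) \<omega> - B (grid s t n i) \<omega>))"

lemma grid_bounds:
  "s \<le> t \<Longrightarrow> s \<le> grid s t n i"
  "s \<le> t \<Longrightarrow> i \<le> n \<Longrightarrow> grid s t n i \<le> t"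
  "s \<le> t \<Longrightarrow> grid s t n i \<le> grid s t n (Suc i)"
  and grid_0: "grid s t n 0 = s"
  and grid_n: "n > 0 \<Longrightarrow> grid s t n n = t"
  and grid_diff: "grid s t n (Suc i) - grid s t n i = (t - s) / real n"
proof -
  show d: "grid s t n (Suc i) - grid s t n i = (t - s) / real n"
    by (simp add: grid_def diff_divide_distrib[symmetric] algebra_simps)
  show "s \<le> grid s t n i" if "s \<le> t" using that by (simp add: grid_def)
  show "grid s t n i \<le> grid s t n (Suc i)" if "s \<le> t"
  proof -
    have "0 \<le> (t - s) / real n" using that by simp
    then show ?thesis using d by linarith
  qed
  show "grid s t n i \<le> t" if "s \<le> t" "i \<le> n"
  proof -
    have "(t - s) * (real i / real n) \<le> (t - s) * 1"
      using that by (intro mult_left_mono) (auto simp: divide_le_eq_1)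
    then show ?thesis by (simp add: grid_def)
  qed
qed (simp_all add: grid_def)

text \<open>Product rule in discrete form for
  \<open>exp (\<mu> * u) * (X x u \<omega> - \<theta>)\<close>: the increment of the first factor
  goes with the final value of the second, the increment of the second with the initial value of the
  first. The drift terms nearly cancel, leaving an integrand bounded by
  \<open>\<mu> * e\<close>.\<close>

lemma one_step:
  fixes E :: "real \<Rightarrow> real"
  assumes \<omega>: "\<omega> \<in> space M" and pq: "0 \<le> p" "p \<le> q"
    and eps: "\<And>u. p \<le> u \<Longrightarrow> u \<le> q \<Longrightarrow>
      \<bar>exp (\<mu> * u) * (X x q \<omega> - \<theta>) - exp (\<mu> * p) * (X x u \<omega> - \<theta>)\<bar> \<le> e"
  shows "\<bar>exp (\<mu> * q) * (X x q \<omega> - \<theta>) - exp (\<mu> * p) * (X x p \<omega> - \<theta>)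
     - \<sigma> * exp (\<mu> * p) * (B q \<omega> - B p \<omega>)\<bar> \<le> \<mu> * e * (q - p)"
proof -
  let ?R = "exp (\<mu> * q) * (X x q \<omega> - \<theta>) - exp (\<mu> * p) * (X x p \<omega> - \<theta>)
     - \<sigma> * exp (\<mu> * p) * (B q \<omega> - B p \<omega>)"
  have "((\<lambda>u. \<mu> * exp (\<mu> * u)) has_integral exp (\<mu> * q) - exp (\<mu> * p)) {p..q}"
    by (rule fundamental_theorem_of_calculus[OF pq(2)])
       (auto intro!: derivative_eq_intros simp: has_real_derivative_iff_has_vector_derivative[symmetric])
  then have "((\<lambda>u. \<mu> * exp (\<mu> * u) * (X x q \<omega> - \<theta>)) has_integral (exp (\<mu> * q) - exp (\<mu> * p)) * (X x q \<omega> - \<theta>)) {p..q}"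
    by (rule has_integral_mult_left)
  then have "((\<lambda>u. \<mu> * exp (\<mu> * u) * (X x q \<omega> - \<theta>) + exp (\<mu> * p) * (\<mu> * (\<theta> - X x u \<omega>))) has_integral
     (exp (\<mu> * q) - exp (\<mu> * p)) * (X x q \<omega> - \<theta>) + exp (\<mu> * p) * (X x q \<omega> - X x p \<omega> - \<sigma> * (B q \<omega> - B p \<omega>))) {p..q}"
    by (rule has_integral_add[OF _ has_integral_mult_right[OF X_increment[OF \<omega> pq]]])
  moreover have "(exp (\<mu> * q) - exp (\<mu> * p)) * (X x q \<omega> - \<theta>) + exp (\<mu> * p) * (X x q \<omega> - X x p \<omega> - \<sigma> * (B q \<omega> - B p \<omega>)) = ?R"
    by (simp add: algebra_simps)
  moreover have "(\<lambda>u. \<mu> * exp (\<mu> * u) * (X x q \<omega> - \<theta>) + exp (\<mu> * p) * (\<mu> * (\<theta> - X x u \<omega>)))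
      = (\<lambda>u. \<mu> * (exp (\<mu> * u) * (X x q \<omega> - \<theta>) - exp (\<mu> * p) * (X x u \<omega> - \<theta>)))"
    by (simp add: fun_eq_iff algebra_simps)
  ultimately have I: "((\<lambda>u. \<mu> * (exp (\<mu> * u) * (X x q \<omega> - \<theta>) - exp (\<mu> * p) * (X x u \<omega> - \<theta>))) has_integral ?R) {p..q}"
    by simp
  have e0: "0 \<le> e" using eps[of p] pq by linarith
  have "norm ?R \<le> \<mu> * e * measure lborel {p..q}"
    by (rule has_integral_bound_real[OF _ finite.emptyI I])
       (use eps e0 mu_pos in \<open>auto simp: abs_mult intro!: mult_left_mono\<close>)
  then show ?thesis using pq by simp
qed

text \<open>With the integrating factor \<open>exp (\<mu> u)\<close> the stochastic convolution is a pathwise limit of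
  Riemann sums, because the remaining integrand is continuous.\<close>

lemma riemann_tendsto:
  assumes \<omega>: "\<omega> \<in> space M" and st: "0 \<le> s" "s \<le> t"
  shows "(\<lambda>n. riemann s t (Suc n) \<omega>) \<longlonglongrightarrow> noise x s t \<omega>"
proof -
  \<comment> \<open>Two time variables, because the error integrand on a cell [p, q] compares the
    points \<open>(u, q)\<close> and \<open>(p, u)\<close>, whose distance is at most
    \<open>q - p\<close>.\<close>
  define f where "f = (\<lambda>(u, v). exp (\<mu> * u) * (X x v \<omega> - \<theta>))"
  have "continuous_on ({s..t} \<times> {s..t}) f"
  proof -
    have "continuous_on ({s..t} \<times> {s..t}) (\<lambda>z. X x (snd z) \<omega>)"
      by (rule continuous_on_compose2[OF X_continuous[OF \<omega>] continuous_on_snd[OF continuous_on_id]])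
         (use st in auto)
    then show ?thesis unfolding f_def case_prod_beta by (intro continuous_intros) 
  qed
  then have uc: "uniformly_continuous_on ({s..t} \<times> {s..t}) f"
    by (intro compact_uniformly_continuous compact_Times) auto
  define E where "E u = exp (\<mu> * u) * (X x u \<omega> - \<theta>)" for u
  let ?S = "\<lambda>n. \<Sum>i<n. \<sigma> * exp (\<mu> * grid s t n i) * (B (grid s t n (Suc i)) \<omega> - B (grid s t n i) \<omega>)"
  have "(\<lambda>n. ?S (Suc n)) \<longlonglongrightarrow> E t - E s"
  proof (rule LIMSEQ_I)
    fix e :: real assume e: "e > 0"
    \<comment> \<open>The errors add up to \<open>\<mu> * e' * (t - s)\<close>, at most
      \<open>e / 2\<close>; the summand 1 covers \<open>s = t\<close>.\<close>
    define e' where "e' = e / (2 * \<mu> * (t - s + 1))"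
    have e': "e' > 0" using e mu_pos st by (simp add: e'_def)
    obtain d where d: "d > 0" "\<And>z z'. z \<in> {s..t} \<times> {s..t} \<Longrightarrow> z' \<in> {s..t} \<times> {s..t} \<Longrightarrow> dist z' z < d \<Longrightarrow> dist (f z') (f z) < e'"
      using uc e' unfolding uniformly_continuous_on_def by metis
    obtain N where N: "real N > 2 * (t - s + 1) / d" using reals_Archimedean2 by blast
    have "norm (?S (Suc n) - (E t - E s)) < e" if n: "n \<ge> N" for n
    proof -
      let ?g = "grid s t (Suc n)"
      have mesh: "(t - s) / real (Suc n) < d / 2"
      proof -
        have "2 * (t - s + 1) / d < real (Suc n)" using N n by (simp add: order_less_le_trans)
        then have "2 * (t - s + 1) < real (Suc n) * d" using d(1) by (simp add: pos_divide_less_eq)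
        then show ?thesis using st by (simp add: field_simps)
      qed
      have step: "\<bar>E (?g (Suc i)) - E (?g i) - \<sigma> * exp (\<mu> * ?g i) * (B (?g (Suc i)) \<omega> - B (?g i) \<omega>)\<bar>
          \<le> \<mu> * e' * ((t - s) / real (Suc n))" if i: "i < Suc n" for i
      proof -
        have g: "s \<le> ?g i" "?g i \<le> ?g (Suc i)" "?g (Suc i) \<le> t"
          using grid_bounds[OF st(2)] i by simp_all
        have "\<bar>E (?g (Suc i)) - E (?g i) - \<sigma> * exp (\<mu> * ?g i) * (B (?g (Suc i)) \<omega> - B (?g i) \<omega>)\<bar>
          \<le> \<mu> * e' * (?g (Suc i) - ?g i)"
          unfolding E_def
        proof (rule one_step[OF \<omega>])
          fix u assume u: "?g i \<le> u" "u \<le> ?g (Suc i)"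
          have "dist (u, ?g (Suc i)) (?g i, u) \<le> dist u (?g i) + dist (?g (Suc i)) u"
            unfolding dist_Pair_Pair by (rule sqrt_sum_squares_le_sum) auto
          also have "\<dots> = (t - s) / real (Suc n)"
            using u grid_diff[of s t "Suc n" i] by (simp add: dist_real_def)
          also have "\<dots> < d" using mesh d(1) by linarith
          finally have "dist (f (u, ?g (Suc i))) (f (?g i, u)) < e'"
            using u g by (intro d(2)) auto
          then show "\<bar>exp (\<mu> * u) * (X x (?g (Suc i)) \<omega> - \<theta>) - exp (\<mu> * ?g i) * (X x u \<omega> - \<theta>)\<bar> \<le> e'"
            by (simp add: f_def dist_real_def)
        qed (use g st in auto)
        then show ?thesis by (simp only: grid_diff)
      qed
      have "(\<Sum>i<Suc n. E (?g (Suc i)) - E (?g i)) = E t - E s"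
        using sum_lessThan_telescope[of "\<lambda>i. E (?g i)" "Suc n"] grid_0[of s t] grid_n[of _ s t] by simp
      then have eq: "?S (Suc n) - (E t - E s) = - (\<Sum>i<Suc n. E (?g (Suc i)) - E (?g i) -
          \<sigma> * exp (\<mu> * ?g i) * (B (?g (Suc i)) \<omega> - B (?g i) \<omega>))"
        by (simp add: sum_subtractf)
      have "norm (?S (Suc n) - (E t - E s)) \<le> (\<Sum>i<Suc n. \<mu> * e' * ((t - s) / real (Suc n)))"
        unfolding eq norm_minus_cancel
        by (rule sum_norm_le) (use step in auto)
      also have "\<dots> = \<mu> * e' * (t - s)" by simp
      also have "\<dots> \<le> \<mu> * e' * (t - s + 1)"
        using mu_pos e' by (intro mult_left_mono) auto
      also have "\<dots> = e / 2"
      proof -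
        have "\<mu> * (e / (2 * \<mu> * D)) * D = e / 2" if "D > 0" for D
          using that mu_pos by simp
        from this[of "t - s + 1"] show ?thesis using st unfolding e'_def by linarith
      qed
      also have "\<dots> < e" using e by simp
      finally show ?thesis .
    qed
    then show "\<exists>N. \<forall>n\<ge>N. norm (?S (Suc n) - (E t - E s)) < e" by blast
  qed
  then have "(\<lambda>n. exp (- \<mu> * t) * ?S (Suc n)) \<longlonglongrightarrow> exp (- \<mu> * t) * (E t - E s)"
    by (rule tendsto_mult_left)
  moreover have "exp (- \<mu> * t) * ?S n = riemann s t n \<omega>" for n
  proof -
    have "- \<mu> * (t - u) = - \<mu> * t + \<mu> * u" for u by (simp add: algebra_simps)
    then have "exp (- \<mu> * (t - u)) = exp (- \<mu> * t) * exp (\<mu> * u)" for u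
      by (simp only: exp_add)
    then show ?thesis
      unfolding riemann_def sum_distrib_left
      by (intro sum.cong refl) (simp only: mult.assoc mult.left_commute[of "exp (- \<mu> * t)"])
  qed
  moreover have "exp (- \<mu> * t) * (E t - E s) = noise x s t \<omega>"
  proof -
    have 1: "- \<mu> * t + \<mu> * t = 0" "- \<mu> * (t - s) = - \<mu> * t + \<mu> * s" by (simp_all add: algebra_simps)
    have "exp (- \<mu> * t) * exp (\<mu> * t) = 1" "exp (- \<mu> * (t - s)) = exp (- \<mu> * t) * exp (\<mu> * s)"
      by (simp_all only: 1 exp_add[symmetric] exp_zero)
    then show ?thesis
      unfolding E_def noise_def right_diff_distrib[of "exp _"] mult.assoc[symmetric] by simp
  qed
  ultimately show ?thesis by (simp only:)
qed

text \<open>Grid increments are differences of increments counted from \<open>s\<close>, so the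
  Riemann sums and their pointwise limit belong to the future.\<close>

lemma noise_future_measurable:
  assumes "0 \<le> s" "s \<le> t"
  shows "noise x s t \<in> borel_measurable (future s)"
proof (rule borel_measurable_LIMSEQ_real)
  show "(\<lambda>n. riemann s t (Suc n) \<omega>) \<longlonglongrightarrow> noise x s t \<omega>" if "\<omega> \<in> space (future s)" for \<omega>
    using riemann_tendsto[of \<omega> s t x] that assms by simp
  have *: "(\<lambda>\<omega>. B (grid s t n (Suc i)) \<omega> - B (grid s t n i) \<omega>) \<in> borel_measurable (future s)" for n i
  proof -
    have "(\<lambda>\<omega>. (B (grid s t n (Suc i)) \<omega> - B s \<omega>) - (B (grid s t n i) \<omega> - B s \<omega>)) \<in> borel_measurable (future s)"
      by (intro borel_measurable_diff B_future_measurable grid_bounds assms)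
    then show ?thesis by simp
  qed
  show "riemann s t (Suc n) \<in> borel_measurable (future s)" for n
    unfolding riemann_def[abs_def] by (intro borel_measurable_sum borel_measurable_times * measurable_const) auto
qed

text \<open>\<open>X x s\<close> differs by a constant from the noise accumulated since time 0, a
  limit of sums that use \<open>B\<close> up to time \<open>s\<close> only.\<close>

lemma X_past_measurable:
  assumes "0 \<le> s" "s \<le> t"
  shows "X x s \<in> borel_measurable (past t)"
proof -
  have "noise x 0 s \<in> borel_measurable (past t)"
  proof (rule borel_measurable_LIMSEQ_real)
    show "(\<lambda>n. riemann 0 s (Suc n) \<omega>) \<longlonglongrightarrow> noise x 0 s \<omega>" if "\<omega> \<in> space (past t)" for \<omega>
      using riemann_tendsto[of \<omega> 0 s x] that assms by simp
    have g: "0 \<le> grid 0 s (Suc n) i" "i \<le> Suc n \<Longrightarrow> grid 0 s (Suc n) i \<le> t" for n i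
      using grid_bounds(1)[OF assms(1)] grid_bounds(2)[OF assms(1), of i "Suc n"] assms(2) by auto
    show "riemann 0 s (Suc n) \<in> borel_measurable (past t)" for n
      unfolding riemann_def[abs_def]
      by (intro borel_measurable_sum borel_measurable_times borel_measurable_diff B_past_measurable g measurable_const) auto
  qed
  then have "(\<lambda>\<omega>. noise x 0 s \<omega> + (\<theta> + exp (- \<mu> * s) * (x - \<theta>))) \<in> borel_measurable (past t)"
    by (intro borel_measurable_add) auto
  then show ?thesis
    by (rule measurable_cong[THEN iffD1, rotated]) (simp add: noise_def X_0)
qed

lemma X_measurable [measurable]: "0 \<le> s \<Longrightarrow> X x s \<in> borel_measurable M"
  using measurable_from_subalg[of M "past s"] X_past_measurable[of s s x] past_subset
  by (auto simp: subalgebra_def)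

lemma noise_measurable:
  assumes "0 \<le> s" "s \<le> t"
  shows "noise x s t \<in> borel_measurable M"
  using measurable_from_subalg[of M "future s"] noise_future_measurable[OF assms] future_subset
  by (auto simp: subalgebra_def)

text \<open>Square root of the Ito isometry variance: \<open>\<sigma>\<^sup>2\<close> times the
  integral of \<open>exp (- 2 * \<mu> * v)\<close> over [0, h].\<close>

definition "noise_sd h = \<sigma> * sqrt ((1 - exp (- 2 * \<mu> * h)) / (2 * \<mu>))"

lemma noise_sd_sq: "h \<ge> 0 \<Longrightarrow> (noise_sd h)\<^sup>2 = \<sigma>\<^sup>2 * (1 - exp (- 2 * \<mu> * h)) / (2 * \<mu>)"
  using mu_pos by (simp add: noise_sd_def power_mult_distrib)

text \<open>A geometric series with ratio \<open>exp (2 * \<mu> * h / real (Suc n))\<close>; the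
  limit comes from (exp y - 1) / y tending to 1 at 0.\<close>

lemma riemann_variance_tendsto:
  assumes h: "h > 0"
  shows "(\<lambda>n. \<Sum>i<Suc n. (\<sigma> * exp (- \<mu> * (h - h * real i / real (Suc n))))\<^sup>2 * (h / real (Suc n)))
    \<longlonglongrightarrow> (noise_sd h)\<^sup>2"
proof -
  define q where "q n = exp (2 * \<mu> * h / real (Suc n))" for n
  have q: "q n \<noteq> 1" for n using mu_pos h by (simp add: q_def)
  have qp: "q n ^ Suc n = exp (2 * \<mu> * h)" for n
    unfolding q_def exp_of_nat_mult[symmetric] by simp
  have "(\<Sum>i<Suc n. (\<sigma> * exp (- \<mu> * (h - h * real i / real (Suc n))))\<^sup>2 * (h / real (Suc n)))
     = \<sigma>\<^sup>2 * exp (- 2 * \<mu> * h) * (h / real (Suc n)) * ((exp (2 * \<mu> * h) - 1) / (q n - 1))" for n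
  proof -
    have "(\<sigma> * exp (- \<mu> * (h - h * real i / real (Suc n))))\<^sup>2 = \<sigma>\<^sup>2 * exp (- 2 * \<mu> * h) * q n ^ i" for i
      unfolding q_def exp_of_nat_mult[symmetric] power_mult_distrib exp_double[symmetric] mult.assoc exp_add[symmetric]
      by (simp add: field_simps)
    then have "(\<Sum>i<Suc n. (\<sigma> * exp (- \<mu> * (h - h * real i / real (Suc n))))\<^sup>2 * (h / real (Suc n)))
       = \<sigma>\<^sup>2 * exp (- 2 * \<mu> * h) * (h / real (Suc n)) * (\<Sum>i<Suc n. q n ^ i)"
      unfolding sum_distrib_left by (intro sum.cong refl) (simp only: ac_simps)
    also have "(\<Sum>i<Suc n. q n ^ i) = (exp (2 * \<mu> * h) - 1) / (q n - 1)"
      unfolding geometric_sum[OF q] qp ..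
    finally show ?thesis .
  qed
  moreover have "(\<lambda>n. (h / real (Suc n)) / (q n - 1)) \<longlonglongrightarrow> 1 / (2 * \<mu>)"
  proof -
    have "(\<lambda>n. (h / real (Suc n)) / (q n - 1)) \<longlonglongrightarrow> h * (inverse \<mu> * inverse h) / 2"
      unfolding q_def using h mu_pos by real_asymp
    then show ?thesis using h mu_pos by (simp add: field_simps)
  qed
  then have "(\<lambda>n. \<sigma>\<^sup>2 * exp (- 2 * \<mu> * h) * (exp (2 * \<mu> * h) - 1) * ((h / real (Suc n)) / (q n - 1)))
     \<longlonglongrightarrow> \<sigma>\<^sup>2 * exp (- 2 * \<mu> * h) * (exp (2 * \<mu> * h) - 1) * (1 / (2 * \<mu>))"
    by (rule tendsto_mult_left)
  moreover have "\<sigma>\<^sup>2 * exp (- 2 * \<mu> * h) * (exp (2 * \<mu> * h) - 1) * (1 / (2 * \<mu>)) = (noise_sd h)\<^sup>2"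
    using h mu_pos by (simp add: noise_sd_sq algebra_simps exp_add[symmetric] diff_divide_distrib)
  ultimately show ?thesis by (simp add: ac_simps)
qed

lemma char_riemann:
  assumes st: "0 \<le> s" "s < t"
  shows "char (distr M borel (riemann s t (Suc n))) \<xi> =
    exp (- (\<xi>\<^sup>2 * (\<Sum>i<Suc n. (\<sigma> * exp (- \<mu> * ((t - s) - (t - s) * real i / real (Suc n))))\<^sup>2 * ((t - s) / real (Suc n))) / 2))"
proof -
  let ?g = "grid s t (Suc n)"
  let ?c = "\<lambda>i. \<sigma> * exp (- \<mu> * (t - ?g i))"
  have sm: "strict_mono ?g"
    unfolding strict_mono_Suc_iff
  proof
    fix i
    have "0 < (t - s) / real (Suc n)" using st by simp
    then show "?g i < ?g (Suc i)" using grid_diff[of s t "Suc n" i] by linarith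
  qed
  have g0: "0 \<le> ?g i" for i using grid_bounds(1)[of s t "Suc n" i] st by linarith
  have "indep_vars (\<lambda>_. borel) (\<lambda>i \<omega>. B (?g (Suc i)) \<omega> - B (?g i) \<omega>) {..<Suc n}"
    by (rule B_indep[OF g0 sm])
  then have "indep_vars (\<lambda>_. borel) (\<lambda>i \<omega>. ?c i * (B (?g (Suc i)) \<omega> - B (?g i) \<omega>)) {..<Suc n}"
    by (rule indep_vars_compose2) measurable
  then have "char (distr M borel (riemann s t (Suc n))) \<xi>
      = (\<Prod>i<Suc n. char (distr M borel (\<lambda>\<omega>. ?c i * (B (?g (Suc i)) \<omega> - B (?g i) \<omega>))) \<xi>)"
    unfolding riemann_def[abs_def] by (rule char_distr_sum)
  also have "\<dots> = (\<Prod>i<Suc n. of_real (exp (- ((\<xi> * ?c i)\<^sup>2 * (?g (Suc i) - ?g i) / 2))))"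
    by (intro prod.cong refl char_increment g0 strict_monoD[OF sm]) simp
  also have "\<dots> = of_real (exp (\<Sum>i<Suc n. - ((\<xi> * ?c i)\<^sup>2 * (?g (Suc i) - ?g i) / 2)))"
    by (subst exp_sum) (auto simp del: sum.lessThan_Suc prod.lessThan_Suc)
  also have "(\<Sum>i<Suc n. - ((\<xi> * ?c i)\<^sup>2 * (?g (Suc i) - ?g i) / 2)) =
     - (\<xi>\<^sup>2 * (\<Sum>i<Suc n. (?c i)\<^sup>2 * ((t - s) / real (Suc n))) / 2)"
    unfolding grid_diff power_mult_distrib[of \<xi>]
    by (simp add: sum_negf sum_distrib_left sum_divide_distrib mult.assoc del: sum.lessThan_Suc)
  finally have e: "char (distr M borel (riemann s t (Suc n))) \<xi> =
    exp (- (\<xi>\<^sup>2 * (\<Sum>i<Suc n. (?c i)\<^sup>2 * ((t - s) / real (Suc n))) / 2))" .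
  have c: "?c i = \<sigma> * exp (- \<mu> * ((t - s) - (t - s) * real i / real (Suc n)))" for i
    by (simp add: grid_def)
  show ?thesis using e unfolding c .
qed

text \<open>Pathwise convergence carries the Gaussian characteristic functions of the Riemann sums
  to the noise, and the characteristic function determines the law.\<close>

lemma distr_noise:
  assumes st: "0 \<le> s" "s < t"
  shows "distr M borel (noise x s t) = distr std_normal_distribution borel (\<lambda>w. noise_sd (t - s) * w)"
proof (rule Levy_uniqueness)
  interpret N: real_distribution std_normal_distribution by (rule real_dist_normal_dist)
  have nm [measurable]: "noise x s t \<in> borel_measurable M" using st by (intro noise_measurable) auto
  have rm [measurable]: "riemann s t n \<in> borel_measurable M" for n
    unfolding riemann_def[abs_def] by measurable
  show "real_distribution (distr M borel (noise x s t))" by simp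
  show "real_distribution (distr std_normal_distribution borel (\<lambda>w. noise_sd (t - s) * w))"
    by (rule N.real_distribution_distr) simp
  show "char (distr M borel (noise x s t)) = char (distr std_normal_distribution borel (\<lambda>w. noise_sd (t - s) * w))"
  proof
    fix \<xi>
    let ?v = "\<lambda>n. \<Sum>i<Suc n. (\<sigma> * exp (- \<mu> * ((t - s) - (t - s) * real i / real (Suc n))))\<^sup>2 * ((t - s) / real (Suc n))"
    have "(\<lambda>n. char (distr M borel (riemann s t (Suc n))) \<xi>) \<longlonglongrightarrow> char (distr M borel (noise x s t)) \<xi>"
    proof -
      have "(\<lambda>n. CLINT \<omega>|M. iexp (\<xi> * riemann s t (Suc n) \<omega>)) \<longlonglongrightarrow> (CLINT \<omega>|M. iexp (\<xi> * noise x s t \<omega>))"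
      proof (rule integral_dominated_convergence[where w = "\<lambda>_. 1"])
        show "AE \<omega> in M. (\<lambda>n. iexp (\<xi> * riemann s t (Suc n) \<omega>)) \<longlonglongrightarrow> iexp (\<xi> * noise x s t \<omega>)"
          using st by (intro AE_I2 tendsto_intros riemann_tendsto) auto
      qed auto
      then show ?thesis unfolding char_def by (subst (1 2) integral_distr) auto
    qed
    then have "(\<lambda>n. of_real (exp (- (\<xi>\<^sup>2 * ?v n / 2)))) \<longlonglongrightarrow> char (distr M borel (noise x s t)) \<xi>"
      unfolding char_riemann[OF st] .
    moreover have "(\<lambda>n. complex_of_real (exp (- (\<xi>\<^sup>2 * ?v n / 2)))) \<longlonglongrightarrow> of_real (exp (- (\<xi>\<^sup>2 * (noise_sd (t - s))\<^sup>2 / 2)))"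
      using st by (intro tendsto_intros riemann_variance_tendsto) auto
    ultimately have "char (distr M borel (noise x s t)) \<xi> = of_real (exp (- (\<xi>\<^sup>2 * (noise_sd (t - s))\<^sup>2 / 2)))"
      by (rule LIMSEQ_unique)
    also have "\<dots> = char std_normal_distribution (\<xi> * noise_sd (t - s))"
      by (simp add: char_std_normal_distribution power_mult_distrib)
    also have "\<dots> = char (distr std_normal_distribution borel (\<lambda>w. noise_sd (t - s) * w)) \<xi>"
      unfolding char_def by (subst integral_distr) (auto simp: mult.assoc)
    finally show "char (distr M borel (noise x s t)) \<xi> = char (distr std_normal_distribution borel (\<lambda>w. noise_sd (t - s) * w)) \<xi>" .
  qed
qed

definition "transition h y w = \<theta> + exp (- \<mu> * h) * (y - \<theta>) + noise_sd h * w"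

text \<open>Testing on past events avoids conditional expectations. \<open>X x t\<close> is a
  function of \<open>X x s\<close> and the noise, and the noise is independent of the past.\<close>

lemma markov:
  assumes st: "0 \<le> s" "s < t" and A: "A \<in> sets (past s)"
    and f: "f \<in> borel_measurable borel"
  shows "(\<integral>\<^sup>+\<omega>. indicator A \<omega> * f (X x t \<omega>) \<partial>M)
    = (\<integral>\<^sup>+\<omega>. indicator A \<omega> * (\<integral>\<^sup>+w. f (transition (t - s) (X x s \<omega>) w) \<partial>std_normal_distribution) \<partial>M)"
proof -
  interpret N: prob_space std_normal_distribution by (rule prob_space_normal_density) simp
  note f [measurable]
  have A' [measurable]: "A \<in> sets M" using A past_subset by blast
  have nm [measurable]: "noise x s t \<in> borel_measurable M" using st by (intro noise_measurable) auto
  \<comment> \<open>The identity into the coarser space \<open>past s\<close> treats the whole past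
    as one random variable; its joint law with the noise is a product measure.\<close>
  have idm: "(\<lambda>\<omega>. \<omega>) \<in> measurable M (past s)"
    using past_subset by (intro measurableI) (auto simp: sets.sets_into_space)
  have Xm [measurable]: "X x s \<in> borel_measurable (past s)" using st by (intro X_past_measurable) auto
  define g where "g = (\<lambda>(\<omega>, n). indicator A \<omega> * f (\<theta> + exp (- \<mu> * (t - s)) * (X x s \<omega> - \<theta>) + n))"
  have Ap [measurable]: "A \<in> sets (past s)" by fact
  have gm [measurable]: "g \<in> borel_measurable (past s \<Otimes>\<^sub>M borel)"
    unfolding g_def by measurable
  interpret D1: prob_space "distr M (past s) (\<lambda>\<omega>. \<omega>)" by (rule prob_space_distr[OF idm])
  interpret D2: prob_space "distr M borel (noise x s t)" by (rule prob_space_distr[OF nm])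
  have pm: "(\<lambda>\<omega>. (\<omega>, noise x s t \<omega>)) \<in> measurable M (past s \<Otimes>\<^sub>M borel)"
    using idm nm by (rule measurable_Pair)
  have "(\<integral>\<^sup>+\<omega>. indicator A \<omega> * f (X x t \<omega>) \<partial>M) = (\<integral>\<^sup>+\<omega>. g (\<omega>, noise x s t \<omega>) \<partial>M)"
    by (simp add: g_def noise_def)
  also have "\<dots> = (\<integral>\<^sup>+z. g z \<partial>distr M (past s \<Otimes>\<^sub>M borel) (\<lambda>\<omega>. (\<omega>, noise x s t \<omega>)))"
    by (subst nn_integral_distr[OF pm]) (use gm in simp_all)
  also have "distr M (past s \<Otimes>\<^sub>M borel) (\<lambda>\<omega>. (\<omega>, noise x s t \<omega>))
      = distr M (past s) (\<lambda>\<omega>. \<omega>) \<Otimes>\<^sub>M distr M borel (noise x s t)"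
  proof (rule pair_measure_eqI[symmetric])
    show "sigma_finite_measure (distr M (past s) (\<lambda>\<omega>. \<omega>))" "sigma_finite_measure (distr M borel (noise x s t))"
      by unfold_locales
    fix C D assume C: "C \<in> sets (distr M (past s) (\<lambda>\<omega>. \<omega>))" and D: "D \<in> sets (distr M borel (noise x s t))"
    have C': "C \<in> sets (past s)" "C \<in> sets M" using C past_subset by auto
    have CM: "(\<lambda>\<omega>. \<omega>) -` C \<inter> space M = C" using sets.sets_into_space[OF C'(2)] by auto
    have D': "noise x s t -` D \<inter> space M \<in> sets (future s)"
      using measurable_sets[OF noise_future_measurable[of s t x], of D] st D by simp
    have "(\<lambda>\<omega>. (\<omega>, noise x s t \<omega>)) -` (C \<times> D) \<inter> space M = C \<inter> (noise x s t -` D \<inter> space M)"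
      using sets.sets_into_space[OF C'(2)] by auto
    moreover have "prob (C \<inter> (noise x s t -` D \<inter> space M)) = prob C * prob (noise x s t -` D \<inter> space M)"
      by (rule indep_setD[OF past_future_indep[OF st(1)] C'(1) D'])
    ultimately show "emeasure (distr M (past s) (\<lambda>\<omega>. \<omega>)) C * emeasure (distr M borel (noise x s t)) D
        = emeasure (distr M (past s \<Otimes>\<^sub>M borel) (\<lambda>\<omega>. (\<omega>, noise x s t \<omega>))) (C \<times> D)"
      using C' D pm idm nm
      by (simp add: emeasure_distr CM emeasure_eq_measure ennreal_mult)
  qed simp
  also have "(\<integral>\<^sup>+z. g z \<partial>(distr M (past s) (\<lambda>\<omega>. \<omega>) \<Otimes>\<^sub>M distr M borel (noise x s t)))
    = (\<integral>\<^sup>+\<omega>. (\<integral>\<^sup>+n. g (\<omega>, n) \<partial>distr M borel (noise x s t)) \<partial>distr M (past s) (\<lambda>\<omega>. \<omega>))"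
    by (rule D2.nn_integral_fst[symmetric]) (use gm in simp)
  also have "\<dots> = (\<integral>\<^sup>+\<omega>. (\<integral>\<^sup>+n. g (\<omega>, n) \<partial>distr M borel (noise x s t)) \<partial>M)"
    by (subst nn_integral_distr[OF idm])
       (use D2.borel_measurable_nn_integral_fst[of g "past s"] gm in simp_all)
  also have "\<dots> = (\<integral>\<^sup>+\<omega>. indicator A \<omega> * (\<integral>\<^sup>+w. f (transition (t - s) (X x s \<omega>) w) \<partial>std_normal_distribution) \<partial>M)"
  proof (intro nn_integral_cong)
    fix \<omega>
    have "(\<integral>\<^sup>+n. g (\<omega>, n) \<partial>distr M borel (noise x s t))
        = (\<integral>\<^sup>+w. g (\<omega>, noise_sd (t - s) * w) \<partial>std_normal_distribution)"
      unfolding distr_noise[OF st] g_def by (subst nn_integral_distr) auto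
    also have "\<dots> = indicator A \<omega> * (\<integral>\<^sup>+w. f (transition (t - s) (X x s \<omega>) w) \<partial>std_normal_distribution)"
      unfolding g_def transition_def case_prod_conv by (rule nn_integral_cmult) measurable
    finally show "(\<integral>\<^sup>+n. g (\<omega>, n) \<partial>distr M borel (noise x s t))
      = indicator A \<omega> * (\<integral>\<^sup>+w. f (transition (t - s) (X x s \<omega>) w) \<partial>std_normal_distribution)" .
  qed
  finally show ?thesis .
qed

end

section \<open>Optional stopping\<close>

context brownian
begin

text \<open>Values in \<open>ennreal\<close> dispense with integrability conditions.\<close>

definition "supermart Z \<longleftrightarrow> (\<forall>t\<ge>0. Z t \<in> borel_measurable M) \<and>
  (\<forall>s t A. 0 \<le> s \<longrightarrow> s < t \<longrightarrow> A \<in> sets (past s) \<longrightarrow>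
    (\<integral>\<^sup>+\<omega>. indicator A \<omega> * Z t \<omega> \<partial>M) \<le> (\<integral>\<^sup>+\<omega>. indicator A \<omega> * (Z s \<omega> :: ennreal) \<partial>M))"

lemma supermart_exchange:
  assumes Z: "supermart Z" and st: "0 \<le> s" "s < t" and A: "A \<in> sets (past s)"
    and W: "W \<in> borel_measurable M"
  shows "(\<integral>\<^sup>+\<omega>. (if \<omega> \<in> A then Z t \<omega> else W \<omega>) \<partial>M) \<le> (\<integral>\<^sup>+\<omega>. (if \<omega> \<in> A then Z s \<omega> else W \<omega>) \<partial>M)"
proof -
  have Zm [measurable]: "Z t \<in> borel_measurable M" "Z s \<in> borel_measurable M"
    using Z st by (auto simp: supermart_def)
  have A' [measurable]: "A \<in> sets M" using A past_subset by blast
  note W [measurable]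
  have eq: "(\<integral>\<^sup>+\<omega>. (if \<omega> \<in> A then Z u \<omega> else W \<omega>) \<partial>M)
      = (\<integral>\<^sup>+\<omega>. indicator A \<omega> * Z u \<omega> \<partial>M) + (\<integral>\<^sup>+\<omega>. indicator (space M - A) \<omega> * W \<omega> \<partial>M)"
    if [measurable]: "Z u \<in> borel_measurable M" for u
    by (subst nn_integral_add[symmetric]) (auto intro!: nn_integral_cong)
  show ?thesis
    unfolding eq[OF Zm(1)] eq[OF Zm(2)]
    using Z st A by (intro add_right_mono) (auto simp: supermart_def)
qed

text \<open>One grid step at a time: raising \<open>j\<close> by one alters
  \<open>min (\<kappa> \<omega>) j\<close> only where \<open>\<kappa>\<close> exceeds
  \<open>j\<close> and \<open>max (\<kappa> \<omega>) j\<close> only where it does not, and both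
  events are known at time \<open>tt j\<close>.\<close>

lemma supermart_discrete_stopping:
  fixes \<kappa> :: "'a \<Rightarrow> nat"
  assumes Z: "supermart Z" and tt: "strict_mono tt" "tt 0 \<ge> 0"
    and \<kappa>: "\<And>j. {\<omega> \<in> space M. \<kappa> \<omega> \<le> j} \<in> sets (past (tt j))"
    and N: "\<And>\<omega>. \<kappa> \<omega> \<le> N"
  shows "(\<lambda>\<omega>. Z (tt (\<kappa> \<omega>)) \<omega>) \<in> borel_measurable M"
    and "(\<integral>\<^sup>+\<omega>. Z (tt (\<kappa> \<omega>)) \<omega> \<partial>M) \<le> (\<integral>\<^sup>+\<omega>. Z (tt 0) \<omega> \<partial>M)"
    and "(\<integral>\<^sup>+\<omega>. Z (tt N) \<omega> \<partial>M) \<le> (\<integral>\<^sup>+\<omega>. Z (tt (\<kappa> \<omega>)) \<omega> \<partial>M)"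
proof -
  have tt0: "tt j \<ge> 0" for j
    using tt strict_mono_less_eq[OF tt(1), of 0 j] by simp
  have Zm: "Z (tt j) \<in> borel_measurable M" for j
    using Z tt0 by (simp add: supermart_def)
  have \<kappa>M: "{\<omega> \<in> space M. \<kappa> \<omega> \<le> j} \<in> sets M" for j using \<kappa> past_subset by blast
  have \<kappa>m [measurable]: "\<kappa> \<in> measurable M (count_space UNIV)"
    unfolding measurable_count_space_eq2_countable
  proof (intro conjI ballI)
    fix j
    have "\<kappa> -` {j} \<inter> space M = {\<omega> \<in> space M. \<kappa> \<omega> \<le> j} - (\<Union>i<j. {\<omega> \<in> space M. \<kappa> \<omega> \<le> i})"
      by (force simp: not_le)
    then show "\<kappa> -` {j} \<inter> space M \<in> sets M" using \<kappa>M by auto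
  qed simp
  have meas: "(\<lambda>\<omega>. Z (tt (f \<omega>)) \<omega>) \<in> borel_measurable M"
    if "f \<in> measurable M (count_space UNIV)" for f :: "'a \<Rightarrow> nat"
    by (rule measurable_compose_countable[OF Zm that])
  show "(\<lambda>\<omega>. Z (tt (\<kappa> \<omega>)) \<omega>) \<in> borel_measurable M" by (rule meas[OF \<kappa>m])
  have lt: "tt j < tt (Suc j)" for j using tt(1) by (simp add: strict_mono_Suc_iff)
  have min: "(\<integral>\<^sup>+\<omega>. Z (tt (min (\<kappa> \<omega>) j)) \<omega> \<partial>M) \<le> (\<integral>\<^sup>+\<omega>. Z (tt 0) \<omega> \<partial>M)" for j
  proof (induction j)
    case (Suc j)
    let ?A = "space M - {\<omega> \<in> space M. \<kappa> \<omega> \<le> j}"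
    have A: "?A \<in> sets (past (tt j))" using sets.compl_sets[OF \<kappa>[of j]] by simp
    have "(\<integral>\<^sup>+\<omega>. Z (tt (min (\<kappa> \<omega>) (Suc j))) \<omega> \<partial>M) =
      (\<integral>\<^sup>+\<omega>. (if \<omega> \<in> ?A then Z (tt (Suc j)) \<omega> else Z (tt (\<kappa> \<omega>)) \<omega>) \<partial>M)"
      by (intro nn_integral_cong) (auto simp: min_def le_Suc_eq)
    also have "\<dots> \<le> (\<integral>\<^sup>+\<omega>. (if \<omega> \<in> ?A then Z (tt j) \<omega> else Z (tt (\<kappa> \<omega>)) \<omega>) \<partial>M)"
      by (rule supermart_exchange[OF Z tt0 lt A meas[OF \<kappa>m]])
    also have "\<dots> = (\<integral>\<^sup>+\<omega>. Z (tt (min (\<kappa> \<omega>) j)) \<omega> \<partial>M)"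
      by (intro nn_integral_cong) (auto simp: min_def)
    finally show ?case using Suc by simp
  qed simp
  show "(\<integral>\<^sup>+\<omega>. Z (tt (\<kappa> \<omega>)) \<omega> \<partial>M) \<le> (\<integral>\<^sup>+\<omega>. Z (tt 0) \<omega> \<partial>M)"
    using min[of N] N by (simp add: min_absorb1)
  have max: "(\<integral>\<^sup>+\<omega>. Z (tt (max (\<kappa> \<omega>) j)) \<omega> \<partial>M) \<le> (\<integral>\<^sup>+\<omega>. Z (tt (\<kappa> \<omega>)) \<omega> \<partial>M)" for j
  proof (induction j)
    case (Suc j)
    let ?A = "{\<omega> \<in> space M. \<kappa> \<omega> \<le> j}"
    have "(\<integral>\<^sup>+\<omega>. Z (tt (max (\<kappa> \<omega>) (Suc j))) \<omega> \<partial>M) =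
      (\<integral>\<^sup>+\<omega>. (if \<omega> \<in> ?A then Z (tt (Suc j)) \<omega> else Z (tt (\<kappa> \<omega>)) \<omega>) \<partial>M)"
      by (intro nn_integral_cong) (auto simp: max_def le_Suc_eq)
    also have "\<dots> \<le> (\<integral>\<^sup>+\<omega>. (if \<omega> \<in> ?A then Z (tt j) \<omega> else Z (tt (\<kappa> \<omega>)) \<omega>) \<partial>M)"
      by (rule supermart_exchange[OF Z tt0 lt \<kappa> meas[OF \<kappa>m]])
    also have "\<dots> = (\<integral>\<^sup>+\<omega>. Z (tt (max (\<kappa> \<omega>) j)) \<omega> \<partial>M)"
      by (intro nn_integral_cong) (auto simp: max_def)
    finally show ?case using Suc by simp
  qed simp
  show "(\<integral>\<^sup>+\<omega>. Z (tt N) \<omega> \<partial>M) \<le> (\<integral>\<^sup>+\<omega>. Z (tt (\<kappa> \<omega>)) \<omega> \<partial>M)"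
    using max[of N] N by (simp add: max_absorb2)
qed

text \<open>Optional stopping at a bounded stopping time \<open>S\<close>, by rounding \<open>S\<close> up to a grid of mesh
  \<open>T / (n + 1)\<close>. For the lower bound the process has to be bounded.\<close>

lemma supermart_bounded_stopping:
  assumes Z: "supermart Z" and cont: "\<And>\<omega>. \<omega> \<in> space M \<Longrightarrow> continuous_on {0..} (\<lambda>t. Z t \<omega>)"
    and T: "T > 0" and S: "\<And>\<omega>. 0 \<le> S \<omega>" "\<And>\<omega>. S \<omega> \<le> T"
    and st: "\<And>t. 0 \<le> t \<Longrightarrow> {\<omega> \<in> space M. S \<omega> \<le> t} \<in> sets (past t)"
  shows "(\<lambda>\<omega>. Z (S \<omega>) \<omega>) \<in> borel_measurable M"
    and "(\<integral>\<^sup>+\<omega>. Z (S \<omega>) \<omega> \<partial>M) \<le> (\<integral>\<^sup>+\<omega>. Z 0 \<omega> \<partial>M)"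
    and "(\<And>t \<omega>. t \<ge> 0 \<Longrightarrow> \<omega> \<in> space M \<Longrightarrow> Z t \<omega> \<le> ennreal C) \<Longrightarrow> (\<integral>\<^sup>+\<omega>. Z T \<omega> \<partial>M) \<le> (\<integral>\<^sup>+\<omega>. Z (S \<omega>) \<omega> \<partial>M)"
proof -
  define tt where "tt n j = T * real j / real (Suc n)" for n j :: nat
  \<comment> \<open>Rounding up makes \<open>\<kappa> n \<omega> \<le> j\<close> the past event
    \<open>S \<omega> \<le> tt n j\<close>.\<close>
  define \<kappa> where "\<kappa> n \<omega> = nat \<lceil>S \<omega> * real (Suc n) / T\<rceil>" for n \<omega>
  have tt: "strict_mono (tt n)" "tt n 0 = 0" "tt n (Suc n) = T" for n
    using T by (auto simp: strict_mono_Suc_iff tt_def divide_strict_right_mono simp del: of_nat_Suc)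
  have \<kappa>_le: "\<kappa> n \<omega> \<le> j \<longleftrightarrow> S \<omega> \<le> tt n j" for n \<omega> j
  proof -
    have "\<kappa> n \<omega> \<le> j \<longleftrightarrow> S \<omega> * real (Suc n) / T \<le> real j"
      by (simp add: \<kappa>_def nat_le_iff ceiling_le_iff)
    also have "\<dots> \<longleftrightarrow> S \<omega> \<le> tt n j"
      using T by (simp add: tt_def field_simps del: of_nat_Suc)
    finally show ?thesis .
  qed
  have \<kappa>1: "{\<omega> \<in> space M. \<kappa> n \<omega> \<le> j} \<in> sets (past (tt n j))" for n j
    unfolding \<kappa>_le using T by (intro st) (simp add: tt_def)
  have \<kappa>2: "\<kappa> n \<omega> \<le> Suc n" for n \<omega>
    unfolding \<kappa>_le tt(3) by (rule S(2))
  note D = supermart_discrete_stopping[OF Z tt(1) eq_refl[OF tt(2)[symmetric]] \<kappa>1 \<kappa>2, unfolded tt(2,3)]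
  have conv: "(\<lambda>n. tt n (\<kappa> n \<omega>)) \<longlonglongrightarrow> S \<omega>" for \<omega>
  proof (rule tendsto_sandwich)
    have "S \<omega> \<le> tt n (\<kappa> n \<omega>)" for n using \<kappa>_le[of n \<omega> "\<kappa> n \<omega>"] by simp
    then show "\<forall>\<^sub>F n in sequentially. S \<omega> \<le> tt n (\<kappa> n \<omega>)" by simp
    have "tt n (\<kappa> n \<omega>) \<le> S \<omega> + T / real (Suc n)" for n
    proof -
      have "real (\<kappa> n \<omega>) \<le> S \<omega> * real (Suc n) / T + 1"
      proof -
        have "0 \<le> S \<omega> * real (Suc n) / T" using S(1)[of \<omega>] T by simp
        then have "0 \<le> \<lceil>S \<omega> * real (Suc n) / T\<rceil>" by linarith
        then have "real (\<kappa> n \<omega>) = of_int \<lceil>S \<omega> * real (Suc n) / T\<rceil>" unfolding \<kappa>_def by simp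
        then show ?thesis by linarith
      qed
      then have "T * real (\<kappa> n \<omega>) / real (Suc n) \<le> T * (S \<omega> * real (Suc n) / T + 1) / real (Suc n)"
        using T by (intro divide_right_mono mult_left_mono) auto
      also have "\<dots> = S \<omega> + T / real (Suc n)" using T by (simp add: field_simps del: of_nat_Suc)
      finally show ?thesis by (simp add: tt_def)
    qed
    then show "\<forall>\<^sub>F n in sequentially. tt n (\<kappa> n \<omega>) \<le> S \<omega> + T / real (Suc n)" by simp
    show "(\<lambda>n. S \<omega> + T / real (Suc n)) \<longlonglongrightarrow> S \<omega>" by real_asymp
  qed simp
  have convZ: "(\<lambda>n. Z (tt n (\<kappa> n \<omega>)) \<omega>) \<longlonglongrightarrow> Z (S \<omega>) \<omega>" if "\<omega> \<in> space M" for \<omega>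
  proof -
    have "tt n (\<kappa> n \<omega>) \<in> {0..}" for n using T by (simp add: tt_def)
    then show ?thesis
      using continuous_on_tendsto_compose[OF cont[OF that] conv[of \<omega>]] S(1)[of \<omega>] by simp
  qed
  show m: "(\<lambda>\<omega>. Z (S \<omega>) \<omega>) \<in> borel_measurable M"
    by (rule borel_measurable_LIMSEQ_order[OF convZ D(1)]) 
  show "(\<integral>\<^sup>+\<omega>. Z (S \<omega>) \<omega> \<partial>M) \<le> (\<integral>\<^sup>+\<omega>. Z 0 \<omega> \<partial>M)"
  proof -
    have "(\<integral>\<^sup>+\<omega>. Z (S \<omega>) \<omega> \<partial>M) = (\<integral>\<^sup>+\<omega>. liminf (\<lambda>n. Z (tt n (\<kappa> n \<omega>)) \<omega>) \<partial>M)"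
      by (intro nn_integral_cong lim_imp_Liminf[symmetric] convZ) auto
    also have "\<dots> \<le> liminf (\<lambda>n. \<integral>\<^sup>+\<omega>. Z (tt n (\<kappa> n \<omega>)) \<omega> \<partial>M)"
      by (rule nn_integral_liminf[OF D(1)])
    also have "\<dots> \<le> limsup (\<lambda>n. \<integral>\<^sup>+\<omega>. Z (tt n (\<kappa> n \<omega>)) \<omega> \<partial>M)"
      by (rule Liminf_le_Limsup) simp
    also have "\<dots> \<le> (\<integral>\<^sup>+\<omega>. Z 0 \<omega> \<partial>M)"
      by (rule Limsup_bounded) (simp add: D(2))
    finally show ?thesis .
  qed
  show "(\<integral>\<^sup>+\<omega>. Z T \<omega> \<partial>M) \<le> (\<integral>\<^sup>+\<omega>. Z (S \<omega>) \<omega> \<partial>M)"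
    if C: "\<And>t \<omega>. t \<ge> 0 \<Longrightarrow> \<omega> \<in> space M \<Longrightarrow> Z t \<omega> \<le> ennreal C"
  proof -
    have "(\<lambda>n. \<integral>\<^sup>+\<omega>. Z (tt n (\<kappa> n \<omega>)) \<omega> \<partial>M) \<longlonglongrightarrow> (\<integral>\<^sup>+\<omega>. Z (S \<omega>) \<omega> \<partial>M)"
    proof (rule nn_integral_dominated_convergence[where w = "\<lambda>_. ennreal C"])
      show "AE \<omega> in M. Z (tt n (\<kappa> n \<omega>)) \<omega> \<le> ennreal C" for n
        using T by (intro AE_I2 C) (auto simp: tt_def)
      show "(\<integral>\<^sup>+\<omega>. ennreal C \<partial>M) < \<infinity>" by (simp add: emeasure_space_1)
    qed (use D(1) m convZ in auto)
    then show ?thesis by (rule LIMSEQ_le_const) (use D(3) in auto)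
  qed
qed

section \<open>Truncated stopping times\<close>

lemma B_stopping_time_past:
  "B_stopping_time M B \<tau> \<Longrightarrow> t \<ge> 0 \<Longrightarrow> {\<omega> \<in> space M. \<tau> \<omega> \<le> ennreal t} \<in> sets (past t)"
  by (simp add: B_stopping_time_def sets_past)

definition "cap \<tau> T \<omega> = enn2real (min (\<tau> \<omega>) (ennreal T))"

lemma cap_bounds:
  assumes "T \<ge> 0"
  shows "0 \<le> cap \<tau> T \<omega>" "cap \<tau> T \<omega> \<le> T"
    and "\<tau> \<omega> \<le> ennreal T \<Longrightarrow> cap \<tau> T \<omega> = enn2real (\<tau> \<omega>)"
    and "ennreal T \<le> \<tau> \<omega> \<Longrightarrow> cap \<tau> T \<omega> = T"
proof -
  have e: "ennreal (cap \<tau> T \<omega>) = min (\<tau> \<omega>) (ennreal T)"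
    unfolding cap_def by (rule ennreal_enn2real) (simp add: min_less_iff_disj)
  show "0 \<le> cap \<tau> T \<omega>" by (simp add: cap_def)
  have "ennreal (cap \<tau> T \<omega>) \<le> ennreal T" unfolding e by simp
  then show "cap \<tau> T \<omega> \<le> T" using assms by simp
  show "\<tau> \<omega> \<le> ennreal T \<Longrightarrow> cap \<tau> T \<omega> = enn2real (\<tau> \<omega>)" by (simp add: cap_def min_absorb1)
  show "ennreal T \<le> \<tau> \<omega> \<Longrightarrow> cap \<tau> T \<omega> = T" using assms by (simp add: cap_def min_absorb2)
qed

lemma cap_stopping:
  assumes \<tau>: "B_stopping_time M B \<tau>" and T: "T \<ge> 0" and t: "t \<ge> 0"
  shows "{\<omega> \<in> space M. cap \<tau> T \<omega> \<le> t} \<in> sets (past t)"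
proof (cases "T \<le> t")
  case True
  then have "{\<omega> \<in> space M. cap \<tau> T \<omega> \<le> t} = space (past t)"
    using cap_bounds(2)[OF T, of \<tau>] by (auto intro: order_trans)
  then show ?thesis by (metis sets.top)
next
  case False
  have "cap \<tau> T \<omega> \<le> t \<longleftrightarrow> \<tau> \<omega> \<le> ennreal t" for \<omega>
  proof -
    have e: "ennreal (cap \<tau> T \<omega>) = min (\<tau> \<omega>) (ennreal T)"
      unfolding cap_def by (rule ennreal_enn2real) (simp add: min_less_iff_disj)
    have "cap \<tau> T \<omega> \<le> t \<longleftrightarrow> ennreal (cap \<tau> T \<omega>) \<le> ennreal t" using t by simp
    also have "\<dots> \<longleftrightarrow> \<tau> \<omega> \<le> ennreal t" unfolding e using False t by (simp add: min_le_iff_disj)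
    finally show ?thesis .
  qed
  then show ?thesis using B_stopping_time_past[OF \<tau> t] by simp
qed

lemma stopping_time_measurable:
  assumes \<tau>: "B_stopping_time M B \<tau>"
  shows "\<tau> \<in> borel_measurable M"
proof (rule borel_measurableI_le)
  fix y :: ennreal
  show "{\<omega> \<in> space M. \<tau> \<omega> \<le> y} \<in> sets M"
  proof (cases y)
    case (real t)
    then show ?thesis using B_stopping_time_past[OF \<tau>, of t] past_subset by auto
  qed simp
qed

end

section \<open>Rewards of stopping times and entry times\<close>

text \<open>\<open>ennreal\<close> cuts \<open>f\<close> off at 0, so the hypothesis sees the
  positive part only. If \<open>f\<close> is not integrable its Bochner integral is 0, whence the
  condition \<open>c \<ge> 0\<close>.\<close>

lemma integral_le_of_nn_integral_le:
  assumes "(\<integral>\<^sup>+x. ennreal (f x) \<partial>M) \<le> ennreal c" "c \<ge> 0"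
  shows "integral\<^sup>L M f \<le> c"
proof (cases "integrable M f")
  case True
  then have m: "integrable M (\<lambda>x. max 0 (f x))" by (intro integrable_max) auto
  have "integral\<^sup>L M f \<le> (\<integral>x. max 0 (f x) \<partial>M)" by (rule integral_mono[OF True m]) simp
  also have "ennreal \<dots> = (\<integral>\<^sup>+x. ennreal (f x) \<partial>M)"
    by (subst nn_integral_eq_integral[OF m, symmetric]) (auto simp: ennreal_max_0 intro!: nn_integral_cong)
  then have "(\<integral>x. max 0 (f x) \<partial>M) \<le> c"
    using assms by (metis ennreal_le_iff)
  finally show ?thesis .
qed (use assms in \<open>simp add: not_integrable_integral_eq\<close>)

section \<open>Superharmonic functions along the process\<close>

context ou
begin

lemma transition_measurable [measurable]: "transition h y \<in> borel_measurable borel"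
  unfolding transition_def[abs_def] by measurable

lemma F_measurable [measurable]: "F \<in> borel_measurable borel" and G_measurable [measurable]: "G \<in> borel_measurable borel"
  by (intro borel_measurable_continuous_onI F_continuous, intro borel_measurable_continuous_onI G_continuous)

text \<open>\<open>G\<close> is \<open>F\<close> reflected at \<open>\<theta>\<close>: the noise
  enters with the opposite sign, which is allowed since \<open>nn_integral_std_normal_pcf\<close>
  constrains only \<open>\<rho>\<^sup>2\<close>.\<close>

lemma transition_F_G:
  assumes "h \<ge> 0"
  shows "(\<integral>\<^sup>+w. ennreal (F (transition h y w)) \<partial>std_normal_distribution) = ennreal (exp (r * h) * F y)"
    and "(\<integral>\<^sup>+w. ennreal (G (transition h y w)) \<partial>std_normal_distribution) = ennreal (exp (r * h) * G y)"
proof -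
  have "(exp (- (\<mu> * h)))\<^sup>2 = exp (- 2 * \<mu> * h)"
    by (simp add: power2_eq_square exp_add[symmetric])
  then have rho: "(k * noise_sd h)\<^sup>2 = 1 - (exp (- (\<mu> * h)))\<^sup>2" "(- k * noise_sd h)\<^sup>2 = 1 - (exp (- (\<mu> * h)))\<^sup>2"
    using assms mu_pos sigma_pos by (simp_all add: power_mult_distrib k_sq noise_sd_sq)
  have e: "r / \<mu> * (\<mu> * h) = r * h" using mu_pos by simp
  have 1: "k * (transition h y w - \<theta>) = exp (- (\<mu> * h)) * (k * (y - \<theta>)) + k * noise_sd h * w"
    and 2: "k * (\<theta> - transition h y w) = exp (- (\<mu> * h)) * (k * (\<theta> - y)) + (- k * noise_sd h) * w" for w
    by (simp_all add: transition_def algebra_simps)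
  show "(\<integral>\<^sup>+w. ennreal (F (transition h y w)) \<partial>std_normal_distribution) = ennreal (exp (r * h) * F y)"
    unfolding F_def 1 nn_integral_std_normal_pcf[OF p_pos(1) rho(1)] e ..
  show "(\<integral>\<^sup>+w. ennreal (G (transition h y w)) \<partial>std_normal_distribution) = ennreal (exp (r * h) * G y)"
    unfolding G_def 2 nn_integral_std_normal_pcf[OF p_pos(1) rho(2)] e ..
qed

text \<open>The tangent combination at \<open>y\<close> has average
  \<open>exp (r * h) * U y\<close>. As one of its coefficients may be negative, it is averaged as a
  real integral.\<close>

lemma transition_superharmonic:
  assumes U: "superharmonic U" and h: "h \<ge> 0"
  shows "(\<integral>\<^sup>+w. ennreal (U (transition h y w)) \<partial>std_normal_distribution) \<le> ennreal (exp (r * h) * U y)"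
proof -
  from U obtain \<alpha> \<beta> where eq: "U y = \<alpha> * F y + \<beta> * G y" and le: "\<And>x. U x \<le> \<alpha> * F x + \<beta> * G x"
    unfolding superharmonic_def by meson
  have nonneg: "U x \<ge> 0" for x using U by (simp add: superharmonic_def)
  note F_G = transition_F_G[OF h, of y]
  have iF: "integrable std_normal_distribution (\<lambda>w. F (transition h y w))"
    and vF: "(\<integral>w. F (transition h y w) \<partial>std_normal_distribution) = exp (r * h) * F y"
    using nn_integral_eq_integrable[of "\<lambda>w. F (transition h y w)" std_normal_distribution "exp (r * h) * F y"]
      F_G(1) F_pos by (auto simp: less_imp_le)
  have iG: "integrable std_normal_distribution (\<lambda>w. G (transition h y w))"
    and vG: "(\<integral>w. G (transition h y w) \<partial>std_normal_distribution) = exp (r * h) * G y"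
    using nn_integral_eq_integrable[of "\<lambda>w. G (transition h y w)" std_normal_distribution "exp (r * h) * G y"]
      F_G(2) G_pos by (auto simp: less_imp_le)
  have "(\<integral>\<^sup>+w. ennreal (U (transition h y w)) \<partial>std_normal_distribution)
    \<le> (\<integral>\<^sup>+w. ennreal (\<alpha> * F (transition h y w) + \<beta> * G (transition h y w)) \<partial>std_normal_distribution)"
    by (intro nn_integral_mono ennreal_leI le)
  also have "\<dots> = ennreal (\<integral>w. \<alpha> * F (transition h y w) + \<beta> * G (transition h y w) \<partial>std_normal_distribution)"
    using iF iG order_trans[OF nonneg le] by (intro nn_integral_eq_integral) auto
  also have "(\<integral>w. \<alpha> * F (transition h y w) + \<beta> * G (transition h y w) \<partial>std_normal_distribution)
    = \<alpha> * (exp (r * h) * F y) + \<beta> * (exp (r * h) * G y)"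
    using iF iG by (simp add: vF vG)
  also have "\<dots> = exp (r * h) * U y" unfolding eq by (simp add: algebra_simps)
  finally show ?thesis .
qed

text \<open>\<open>u\<close> depends on time so that discounting and truncation fit the same
  form.\<close>

lemma supermart_X:
  assumes u: "\<And>t. u t \<in> borel_measurable borel"
    and le: "\<And>s h y. s \<ge> 0 \<Longrightarrow> h > 0 \<Longrightarrow> (\<integral>\<^sup>+w. u (s + h) (transition h y w) \<partial>std_normal_distribution) \<le> u s y"
  shows "supermart (\<lambda>t \<omega>. u t (X x t \<omega>))"
  unfolding supermart_def
proof (intro conjI allI impI)
  show "(\<lambda>\<omega>. u t (X x t \<omega>)) \<in> borel_measurable M" if "t \<ge> 0" for t
    using measurable_compose[OF X_measurable[OF that] u] .
  fix s t A assume st: "0 \<le> s" "s < t" and A: "A \<in> sets (past s)"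
  have "(\<integral>\<^sup>+w. u t (transition (t - s) y w) \<partial>std_normal_distribution) \<le> u s y" for y
    using le[of s "t - s" y] st by simp
  then show "(\<integral>\<^sup>+\<omega>. indicator A \<omega> * u t (X x t \<omega>) \<partial>M) \<le> (\<integral>\<^sup>+\<omega>. indicator A \<omega> * u s (X x s \<omega>) \<partial>M)"
    unfolding markov[OF st A u] by (intro nn_integral_mono mult_left_mono) auto
qed

lemma discounted_transition:
  assumes U: "superharmonic U" and sh: "h \<ge> 0" and [measurable]: "U \<in> borel_measurable borel"
  shows "(\<integral>\<^sup>+w. ennreal (exp (- r * (s + h)) * U (transition h y w)) \<partial>std_normal_distribution)
    \<le> ennreal (exp (- r * s) * U y)"
proof -
  have nonneg: "U x \<ge> 0" for x using U by (simp add: superharmonic_def)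
  have "(\<integral>\<^sup>+w. ennreal (exp (- r * (s + h)) * U (transition h y w)) \<partial>std_normal_distribution)
    = ennreal (exp (- r * (s + h))) * (\<integral>\<^sup>+w. ennreal (U (transition h y w)) \<partial>std_normal_distribution)"
    by (subst nn_integral_cmult[symmetric]) (auto simp: ennreal_mult nonneg)
  also have "\<dots> \<le> ennreal (exp (- r * (s + h))) * ennreal (exp (r * h) * U y)"
    by (intro mult_left_mono transition_superharmonic U sh) auto
  also have "\<dots> = ennreal (exp (- r * s) * U y)"
  proof -
    have "exp (- r * (s + h)) * (exp (r * h) * U y) = exp (- r * s) * U y"
      unfolding mult.assoc[symmetric] exp_add[symmetric] by (simp add: algebra_simps)
    then show ?thesis by (simp add: ennreal_mult[symmetric] nonneg)
  qed
  finally show ?thesis .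
qed

definition "disc U x t \<omega> = ennreal (exp (- r * t) * U (X x t \<omega>))"

lemma disc_continuous:
  assumes "continuous_on UNIV U" "\<omega> \<in> space M"
  shows "continuous_on {0..} (\<lambda>t. disc U x t \<omega>)"
  unfolding disc_def
  by (intro continuous_on_ennreal continuous_intros continuous_on_compose2[OF assms(1) X_continuous[OF assms(2)]]) auto

lemma disc_supermart:
  assumes U: "superharmonic U" and c: "continuous_on UNIV U"
  shows "supermart (disc U x)"
proof -
  have [measurable]: "U \<in> borel_measurable borel" using c by (rule borel_measurable_continuous_onI)
  show ?thesis unfolding disc_def[abs_def]
    by (rule supermart_X) (use discounted_transition[OF U] in auto)
qed

text \<open>Truncation keeps the supermartingale property and supplies the bound required for the
  lower estimate in optional stopping.\<close>

lemma disc_min_supermart: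
  assumes U: "superharmonic U" and c: "continuous_on UNIV U"
  shows "supermart (\<lambda>t \<omega>. min (ennreal C) (disc U x t \<omega>))"
  unfolding disc_def
proof (rule supermart_X[where u = "\<lambda>t y. min (ennreal C) (ennreal (exp (- r * t) * U y))"])
  have [measurable]: "U \<in> borel_measurable borel" using c by (rule borel_measurable_continuous_onI)
  show "(\<lambda>y. min (ennreal C) (ennreal (exp (- r * t) * U y))) \<in> borel_measurable borel" for t
    by measurable
  interpret N: prob_space std_normal_distribution by (rule prob_space_normal_density) simp
  fix s h y :: real assume "s \<ge> 0" "h > 0"
  have "(\<integral>\<^sup>+w. min (ennreal C) (ennreal (exp (- r * (s + h)) * U (transition h y w))) \<partial>std_normal_distribution)
    \<le> (\<integral>\<^sup>+w. ennreal C \<partial>std_normal_distribution)"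
    by (intro nn_integral_mono) auto
  moreover have "(\<integral>\<^sup>+w. min (ennreal C) (ennreal (exp (- r * (s + h)) * U (transition h y w))) \<partial>std_normal_distribution)
    \<le> (\<integral>\<^sup>+w. ennreal (exp (- r * (s + h)) * U (transition h y w)) \<partial>std_normal_distribution)"
    by (intro nn_integral_mono) auto
  ultimately show "(\<integral>\<^sup>+w. min (ennreal C) (ennreal (exp (- r * (s + h)) * U (transition h y w))) \<partial>std_normal_distribution)
    \<le> min (ennreal C) (ennreal (exp (- r * s) * U y))"
    using discounted_transition[OF U, of h s y] \<open>h > 0\<close> N.emeasure_space_1 by simp
qed

text \<open>Paths that never stop get the value 0, in agreement with
  \<open>disc_reward\<close>.\<close>

definition "stopped U \<tau> x \<omega> = (if \<tau> \<omega> = \<infinity> then 0 else disc U x (enn2real (\<tau> \<omega>)) \<omega>)"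

text \<open>Fatou along the truncations at \<open>n + 1\<close>: where \<open>\<tau>\<close> is
  finite the truncated values are eventually constant, and where it is infinite the stopped value is
  0.\<close>

lemma superharmonic_stopping:
  assumes U: "superharmonic U" and c: "continuous_on UNIV U" and \<tau>: "B_stopping_time M B \<tau>"
  shows "(\<integral>\<^sup>+\<omega>. stopped U \<tau> x \<omega> \<partial>M) \<le> ennreal (U x)"
proof -
  have n: "real (Suc n) > 0" "real (Suc n) \<ge> 0" for n by auto
  note S = supermart_bounded_stopping[OF disc_supermart[OF U c] disc_continuous[OF c] n(1)
      cap_bounds(1)[OF n(2)] cap_bounds(2)[OF n(2)] cap_stopping[OF \<tau> n(2)]]
  have Z0: "(\<integral>\<^sup>+\<omega>. disc U x 0 \<omega> \<partial>M) = ennreal (U x)"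
  proof -
    have "(\<integral>\<^sup>+\<omega>. disc U x 0 \<omega> \<partial>M) = (\<integral>\<^sup>+\<omega>. ennreal (U x) \<partial>M)"
      by (intro nn_integral_cong) (simp add: disc_def X_0)
    then show ?thesis by (simp add: emeasure_space_1)
  qed
  have "stopped U \<tau> x \<omega> \<le> liminf (\<lambda>n. disc U x (cap \<tau> (real (Suc n)) \<omega>) \<omega>)" for \<omega>
  proof (cases "\<tau> \<omega>")
    case (real t)
    obtain N where N: "t \<le> real N" using real_arch_simple by blast
    have "\<forall>\<^sub>F n in sequentially. disc U x t \<omega> = disc U x (cap \<tau> (real (Suc n)) \<omega>) \<omega>"
    proof (rule eventually_sequentiallyI[of N])
      fix m assume "N \<le> m"
      then have "t \<le> real (Suc m)" using N by simp
      then have "\<tau> \<omega> \<le> ennreal (real (Suc m))" using real by (metis ennreal_leI)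
      from cap_bounds(3)[where \<tau> = \<tau> and \<omega> = \<omega>, OF n(2) this] show "disc U x t \<omega> = disc U x (cap \<tau> (real (Suc m)) \<omega>) \<omega>"
        using real by simp
    qed
    then have "(\<lambda>n. disc U x (cap \<tau> (real (Suc n)) \<omega>) \<omega>) \<longlonglongrightarrow> disc U x t \<omega>"
      by (rule tendsto_eventually[OF eventually_mono]) simp
    from lim_imp_Liminf[OF _ this] show ?thesis using real by (simp add: stopped_def)
  qed (simp add: stopped_def)
  then have "(\<integral>\<^sup>+\<omega>. stopped U \<tau> x \<omega> \<partial>M) \<le> (\<integral>\<^sup>+\<omega>. liminf (\<lambda>n. disc U x (cap \<tau> (real (Suc n)) \<omega>) \<omega>) \<partial>M)"
    by (intro nn_integral_mono)
  also have "\<dots> \<le> liminf (\<lambda>n. \<integral>\<^sup>+\<omega>. disc U x (cap \<tau> (real (Suc n)) \<omega>) \<omega> \<partial>M)"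
    by (rule nn_integral_liminf[OF S(1)])
  also have "\<dots> \<le> limsup (\<lambda>n. \<integral>\<^sup>+\<omega>. disc U x (cap \<tau> (real (Suc n)) \<omega>) \<omega> \<partial>M)"
    by (rule Liminf_le_Limsup) simp
  also have "\<dots> \<le> ennreal (U x)"
  proof (rule Limsup_bounded, intro always_eventually allI)
    show "(\<integral>\<^sup>+\<omega>. disc U x (cap \<tau> (real (Suc n)) \<omega>) \<omega> \<partial>M) \<le> ennreal (U x)" for n
      unfolding Z0[symmetric] by (rule S(2))
  qed
  finally show ?thesis .
qed

lemma superharmonic_F: "superharmonic F" and superharmonic_G: "superharmonic G"
proof -
  have "F y = 1 * F y + 0 * G y \<and> (\<forall>x. F x \<le> 1 * F x + 0 * G x)"
    "G y = 0 * F y + 1 * G y \<and> (\<forall>x. G x \<le> 0 * F x + 1 * G x)" for y by simp_all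
  then show "superharmonic F" "superharmonic G"
    unfolding superharmonic_def using F_pos G_pos less_imp_le by blast+
qed

text \<open>For \<open>F\<close> and \<open>G\<close> the discounted process is a martingale. Truncating it at a level \<open>C\<close> gives a
  bounded supermartingale, whose mean at time \<open>T\<close> bounds its mean at any earlier stopping time from
  below; \<open>C\<close> and then \<open>T\<close> tend to infinity.\<close>

lemma harmonic_hitting:
  assumes H: "H = F \<or> H = G" and \<tau>: "B_stopping_time M B \<tau>"
    and hit: "\<And>\<omega>. \<omega> \<in> space M \<Longrightarrow> \<tau> \<omega> \<noteq> \<infinity> \<Longrightarrow> X x (enn2real (\<tau> \<omega>)) \<omega> = c"
    and below: "\<And>\<omega> t. \<omega> \<in> space M \<Longrightarrow> t \<ge> 0 \<Longrightarrow> ennreal t \<le> \<tau> \<omega> \<Longrightarrow> H (X x t \<omega>) \<le> H c"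
  shows "(\<integral>\<^sup>+\<omega>. stopped H \<tau> x \<omega> \<partial>M) = ennreal (H x)"
proof (rule antisym)
  have sH: "superharmonic H" using H superharmonic_F superharmonic_G by auto
  have cH: "continuous_on UNIV H" using H F_continuous G_continuous by auto
  have [measurable]: "H \<in> borel_measurable borel" using cH by (rule borel_measurable_continuous_onI)
  have Hpos: "H y > 0" for y using H F_pos G_pos by auto
  show "(\<integral>\<^sup>+\<omega>. stopped H \<tau> x \<omega> \<partial>M) \<le> ennreal (H x)" by (rule superharmonic_stopping[OF sH cH \<tau>])
  have mart: "(\<integral>\<^sup>+\<omega>. disc H x T \<omega> \<partial>M) = ennreal (H x)" if T: "T > 0" for T
  proof -
    have "(\<integral>\<^sup>+\<omega>. disc H x T \<omega> \<partial>M) = (\<integral>\<^sup>+\<omega>. indicator (space M) \<omega> * ennreal (exp (- r * T) * H (X x T \<omega>)) \<partial>M)"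
      by (intro nn_integral_cong) (simp add: disc_def)
    also have "\<dots> = (\<integral>\<^sup>+\<omega>. indicator (space M) \<omega> *
      (\<integral>\<^sup>+w. ennreal (exp (- r * T) * H (transition (T - 0) (X x 0 \<omega>) w)) \<partial>std_normal_distribution) \<partial>M)"
      by (rule markov[OF order_refl T, of "space M" "\<lambda>y. ennreal (exp (- r * T) * H y)"])
         (use sets.top[of "past 0"] in simp_all)
    also have "\<dots> = (\<integral>\<^sup>+\<omega>. ennreal (H x) \<partial>M)"
    proof (intro nn_integral_cong)
      fix \<omega> assume \<omega>: "\<omega> \<in> space M"
      have "(\<integral>\<^sup>+w. ennreal (exp (- r * T) * H (transition T x w)) \<partial>std_normal_distribution)
        = ennreal (exp (- r * T)) * (\<integral>\<^sup>+w. ennreal (H (transition T x w)) \<partial>std_normal_distribution)"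
        by (subst nn_integral_cmult[symmetric]) (auto simp: ennreal_mult Hpos less_imp_le)
      also have "\<dots> = ennreal (exp (- r * T)) * ennreal (exp (r * T) * H x)"
        using H transition_F_G[of T x] T by auto
      also have "\<dots> = ennreal (H x)"
      proof -
        have "exp (- r * T) * (exp (r * T) * H x) = H x"
          unfolding mult.assoc[symmetric] exp_add[symmetric] by simp
        then show ?thesis by (simp add: ennreal_mult[symmetric] Hpos less_imp_le)
      qed
      finally show "indicator (space M) \<omega> * (\<integral>\<^sup>+w. ennreal (exp (- r * T) * H (transition (T - 0) (X x 0 \<omega>) w)) \<partial>std_normal_distribution) = ennreal (H x)"
        using \<omega> by (simp add: X_0)
    qed
    finally show ?thesis by (simp add: emeasure_space_1)
  qed
  \<comment> \<open>Paths not stopped by time \<open>T\<close> contribute at most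
    \<open>exp (- r * T) * H c\<close>, by \<open>below\<close>.\<close>
  have ineq: "ennreal (H x) \<le> (\<integral>\<^sup>+\<omega>. stopped H \<tau> x \<omega> \<partial>M) + ennreal (exp (- r * T) * H c)" if T: "T > 0" for T
  proof -
    have T0: "T \<ge> 0" using T by simp
    have Tm [measurable]: "disc H x T \<in> borel_measurable M"
      using disc_supermart[OF sH cH] T0 by (auto simp: supermart_def)
    have "(\<integral>\<^sup>+\<omega>. min (ennreal (real n)) (disc H x T \<omega>) \<partial>M) \<le> (\<integral>\<^sup>+\<omega>. disc H x (cap \<tau> T \<omega>) \<omega> \<partial>M)" for n
    proof -
      have "(\<integral>\<^sup>+\<omega>. min (ennreal (real n)) (disc H x T \<omega>) \<partial>M)
        \<le> (\<integral>\<^sup>+\<omega>. min (ennreal (real n)) (disc H x (cap \<tau> T \<omega>) \<omega>) \<partial>M)"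
        by (rule supermart_bounded_stopping(3)[where C = "real n", OF disc_min_supermart[OF sH cH] _ T
              cap_bounds(1)[OF T0] cap_bounds(2)[OF T0] cap_stopping[OF \<tau> T0]])
           (auto intro!: continuous_intros disc_continuous cH)
      also have "\<dots> \<le> (\<integral>\<^sup>+\<omega>. disc H x (cap \<tau> T \<omega>) \<omega> \<partial>M)" by (intro nn_integral_mono) auto
      finally show ?thesis .
    qed
    then have "(SUP n. \<integral>\<^sup>+\<omega>. min (ennreal (real n)) (disc H x T \<omega>) \<partial>M) \<le> (\<integral>\<^sup>+\<omega>. disc H x (cap \<tau> T \<omega>) \<omega> \<partial>M)"
      by (rule SUP_least)
    also have "(SUP n. \<integral>\<^sup>+\<omega>. min (ennreal (real n)) (disc H x T \<omega>) \<partial>M)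
      = (\<integral>\<^sup>+\<omega>. (SUP n. min (ennreal (real n)) (disc H x T \<omega>)) \<partial>M)"
    proof (rule nn_integral_monotone_convergence_SUP[symmetric])
      show "incseq (\<lambda>n \<omega>. min (ennreal (real n)) (disc H x T \<omega>))"
        by (auto simp: incseq_def le_fun_def min_le_iff_disj intro!: ennreal_leI)
    qed measurable
    also have "\<dots> = (\<integral>\<^sup>+\<omega>. disc H x T \<omega> \<partial>M)"
    proof (intro nn_integral_cong antisym SUP_least)
      fix \<omega>
      obtain m where "exp (- r * T) * H (X x T \<omega>) \<le> real m" using real_arch_simple by blast
      then have "disc H x T \<omega> \<le> min (ennreal (real m)) (disc H x T \<omega>)"
        by (simp add: disc_def ennreal_leI)
      also have "\<dots> \<le> (SUP n. min (ennreal (real n)) (disc H x T \<omega>))" by (rule SUP_upper) simp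
      finally show "disc H x T \<omega> \<le> (SUP n. min (ennreal (real n)) (disc H x T \<omega>))" .
    qed simp
    also have "\<dots> = ennreal (H x)" by (rule mart[OF T])
    finally have "ennreal (H x) \<le> (\<integral>\<^sup>+\<omega>. disc H x (cap \<tau> T \<omega>) \<omega> \<partial>M)" .
    also have "\<dots> \<le> (\<integral>\<^sup>+\<omega>. stopped H \<tau> x \<omega> + ennreal (exp (- r * T) * H c) \<partial>M)"
    proof (intro nn_integral_mono)
      fix \<omega> assume \<omega>: "\<omega> \<in> space M"
      show "disc H x (cap \<tau> T \<omega>) \<omega> \<le> stopped H \<tau> x \<omega> + ennreal (exp (- r * T) * H c)"
      proof (cases "\<tau> \<omega> \<le> ennreal T")
        case True
        then have "\<tau> \<omega> \<noteq> \<infinity>" by (auto simp: top_unique)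
        then have "disc H x (cap \<tau> T \<omega>) \<omega> = stopped H \<tau> x \<omega>"
          by (simp add: stopped_def cap_bounds(3)[where \<tau> = \<tau> and \<omega> = \<omega>, OF T0 True])
        then show ?thesis by simp
      next
        case False
        then have le: "ennreal T \<le> \<tau> \<omega>" by simp
        have "disc H x (cap \<tau> T \<omega>) \<omega> \<le> ennreal (exp (- r * T) * H c)"
          unfolding cap_bounds(4)[where \<tau> = \<tau> and \<omega> = \<omega>, OF T0 le] disc_def
          by (intro ennreal_leI mult_left_mono below[OF \<omega> T0 le]) simp
        then show ?thesis by (simp add: add_increasing)
      qed
    qed
    also have "\<dots> = (\<integral>\<^sup>+\<omega>. stopped H \<tau> x \<omega> \<partial>M) + (\<integral>\<^sup>+\<omega>. ennreal (exp (- r * T) * H c) \<partial>M)"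
    proof (rule nn_integral_add)
      \<comment> \<open>By \<open>hit\<close> the stopped value is a function of
        \<open>\<tau>\<close> alone, which gives its measurability.\<close>
      have [measurable]: "\<tau> \<in> borel_measurable M" by (rule stopping_time_measurable[OF \<tau>])
      have "(\<lambda>\<omega>. if \<tau> \<omega> = \<infinity> then 0 else ennreal (exp (- r * enn2real (\<tau> \<omega>)) * H c)) \<in> borel_measurable M"
        by measurable
      then show "stopped H \<tau> x \<in> borel_measurable M"
        by (rule measurable_cong[THEN iffD1, rotated]) (simp add: stopped_def disc_def hit)
    qed simp
    finally show ?thesis by (simp add: emeasure_space_1)
  qed
  have "(\<lambda>n. (\<integral>\<^sup>+\<omega>. stopped H \<tau> x \<omega> \<partial>M) + ennreal (exp (- r * real (Suc n)) * H c))
      \<longlonglongrightarrow> (\<integral>\<^sup>+\<omega>. stopped H \<tau> x \<omega> \<partial>M) + ennreal 0"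
  proof (intro tendsto_add tendsto_const tendsto_ennrealI)
    show "(\<lambda>n. exp (- r * real (Suc n)) * H c) \<longlonglongrightarrow> 0" using r_pos by real_asymp
  qed
  then have "ennreal (H x) \<le> (\<integral>\<^sup>+\<omega>. stopped H \<tau> x \<omega> \<partial>M) + ennreal 0"
    by (rule LIMSEQ_le_const) (use ineq in auto)
  then show "ennreal (H x) \<le> (\<integral>\<^sup>+\<omega>. stopped H \<tau> x \<omega> \<partial>M)" by simp
qed

text \<open>The position at stopping is the constant \<open>c\<close>, so
  \<open>harmonic_hitting\<close> yields the Laplace transform \<open>H x / H c\<close> of
  \<open>\<tau>\<close> at \<open>r\<close>, and the reward is \<open>g c\<close> times it.\<close>

lemma hitting_reward:
  assumes H: "H = F \<or> H = G" and \<tau>: "B_stopping_time M B \<tau>"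
    and hit: "\<And>\<omega>. \<omega> \<in> space M \<Longrightarrow> \<tau> \<omega> \<noteq> \<infinity> \<Longrightarrow> X x (enn2real (\<tau> \<omega>)) \<omega> = c"
    and below: "\<And>\<omega> t. \<omega> \<in> space M \<Longrightarrow> t \<ge> 0 \<Longrightarrow> ennreal t \<le> \<tau> \<omega> \<Longrightarrow> H (X x t \<omega>) \<le> H c"
  shows "integral\<^sup>L M (disc_reward X r g \<tau> x) = g c / H c * H x"
proof -
  have Hpos: "H y > 0" for y using H F_pos G_pos by auto
  define D where "D \<omega> = (if \<tau> \<omega> = \<infinity> then 0 else exp (- r * enn2real (\<tau> \<omega>)))" for \<omega>
  have [measurable]: "\<tau> \<in> borel_measurable M" by (rule stopping_time_measurable[OF \<tau>])
  have Dm [measurable]: "D \<in> borel_measurable M" unfolding D_def[abs_def] by measurable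
  have "(\<integral>\<^sup>+\<omega>. ennreal (D \<omega> * H c) \<partial>M) = (\<integral>\<^sup>+\<omega>. stopped H \<tau> x \<omega> \<partial>M)"
    by (intro nn_integral_cong) (simp add: D_def stopped_def disc_def hit)
  also have "\<dots> = ennreal (H x)" by (rule harmonic_hitting[OF H \<tau> hit below])
  finally have "(\<integral>\<omega>. D \<omega> * H c \<partial>M) = H x"
    using nn_integral_eq_integrable[of "\<lambda>\<omega>. D \<omega> * H c" M "H x"] Hpos
    by (auto simp: D_def less_imp_le)
  then have ID: "(\<integral>\<omega>. D \<omega> \<partial>M) = H x / H c" using Hpos[of c] by (simp add: field_simps)
  have "integral\<^sup>L M (disc_reward X r g \<tau> x) = (\<integral>\<omega>. D \<omega> * g c \<partial>M)"
    by (intro Bochner_Integration.integral_cong) (auto simp: disc_reward_def D_def hit)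
  also have "\<dots> = g c / H c * H x" by (simp add: ID)
  finally show ?thesis .
qed

lemma reward_le:
  assumes U: "superharmonic U" and c: "continuous_on UNIV U" and \<tau>: "B_stopping_time M B \<tau>"
    and le: "\<And>y. g y \<le> U y"
  shows "integral\<^sup>L M (disc_reward X r g \<tau> x) \<le> U x"
proof (rule integral_le_of_nn_integral_le)
  have "(\<integral>\<^sup>+\<omega>. ennreal (disc_reward X r g \<tau> x \<omega>) \<partial>M) \<le> (\<integral>\<^sup>+\<omega>. stopped U \<tau> x \<omega> \<partial>M)"
    by (intro nn_integral_mono)
       (auto simp: disc_reward_def stopped_def disc_def intro!: ennreal_leI mult_left_mono le)
  also have "\<dots> \<le> ennreal (U x)" by (rule superharmonic_stopping[OF U c \<tau>])
  finally show "(\<integral>\<^sup>+\<omega>. ennreal (disc_reward X r g \<tau> x \<omega>) \<partial>M) \<le> ennreal (U x)" .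
  show "U x \<ge> 0" using U by (simp add: superharmonic_def)
qed

text \<open>The verification step. \<open>reward_le\<close> gives the upper bound and also the
  boundedness that makes the real supremum meaningful.\<close>

lemma opt_stop_value_eq:
  assumes U: "superharmonic U" and c: "continuous_on UNIV U" and le: "\<And>y. g y \<le> U y"
    and \<tau>: "B_stopping_time M B \<tau>" and att: "integral\<^sup>L M (disc_reward X r g \<tau> x) = U x"
  shows "opt_stop_value M B X r g x = U x"
proof (rule antisym)
  show "opt_stop_value M B X r g x \<le> U x"
    unfolding opt_stop_value_def using \<tau> reward_le[OF U c _ le] by (intro cSUP_least) auto
  have "bdd_above ((\<lambda>\<tau>. integral\<^sup>L M (disc_reward X r g \<tau> x)) ` {\<tau>. B_stopping_time M B \<tau>})"
    using reward_le[OF U c _ le] by (intro bdd_aboveI[of _ "U x"]) auto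
  then show "U x \<le> opt_stop_value M B X r g x"
    unfolding opt_stop_value_def att[symmetric] using \<tau> by (intro cSUP_upper) auto
qed

text \<open>The infimum is attained: visits up to the time of some known visit form a compact set,
  by continuity of the path and closedness of the interval.\<close>

lemma entry_time_cases [consumes 1, case_names never at]:
  assumes \<omega>: "\<omega> \<in> space M"
  obtains (never) "entry_time X a d x \<omega> = \<infinity>" "\<And>t. t \<ge> 0 \<Longrightarrow> X x t \<omega> \<notin> {a..d}"
  | (at) t0 where "t0 \<ge> 0" "entry_time X a d x \<omega> = ennreal t0" "X x t0 \<omega> \<in> {a..d}"
      "\<And>t. t \<ge> 0 \<Longrightarrow> X x t \<omega> \<in> {a..d} \<Longrightarrow> t0 \<le> t"
proof (cases "\<exists>t\<ge>0. X x t \<omega> \<in> {a..d}")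
  case False
  then have "{t. 0 \<le> t \<and> X x t \<omega> \<in> {a..d}} = {}" by auto
  then have "entry_time X a d x \<omega> = \<infinity>" unfolding entry_time_def by simp
  then show ?thesis using False never by blast
next
  case True
  then obtain t1 where t1: "t1 \<ge> 0" "X x t1 \<omega> \<in> {a..d}" by blast
  have cont: "continuous_on {0..t1} (\<lambda>t. X x t \<omega>)"
    by (rule continuous_on_subset[OF X_continuous[OF \<omega>]]) auto
  have "compact ({0..t1} \<inter> (\<lambda>t. X x t \<omega>) -` {a..d})"
    using continuous_closed_preimage[OF cont closed_atLeastAtMost closed_atLeastAtMost, of a d]
    by (metis Int_lower1 compact_Icc compact_Int_closed inf.absorb_iff2)
  moreover have "{0..t1} \<inter> (\<lambda>t. X x t \<omega>) -` {a..d} \<noteq> {}" using t1 by auto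
  ultimately obtain t0 where "t0 \<in> {0..t1} \<inter> (\<lambda>t. X x t \<omega>) -` {a..d}"
    "\<forall>t\<in>{0..t1} \<inter> (\<lambda>t. X x t \<omega>) -` {a..d}. t0 \<le> t"
    using compact_attains_inf by metis
  then have t0: "t0 \<in> {0..t1}" "X x t0 \<omega> \<in> {a..d}"
    "\<And>t. t \<in> {0..t1} \<Longrightarrow> X x t \<omega> \<in> {a..d} \<Longrightarrow> t0 \<le> t" by blast+
  have min: "t0 \<le> t" if "t \<ge> 0" "X x t \<omega> \<in> {a..d}" for t
    using t0(1) t0(3)[of t] that by (cases "t \<le> t1") auto
  have "entry_time X a d x \<omega> = ennreal t0"
    unfolding entry_time_def
    by (rule antisym[OF Inf_lower Inf_greatest]) (use t0 min in \<open>auto intro!: ennreal_leI\<close>)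
  then show ?thesis using at[of t0] t0 min by auto
qed

text \<open>By continuity and compactness, [a, d] is visited by time \<open>t\<close> exactly when
  every enlarged interval is visited at one of countably many times up to \<open>t\<close>.\<close>

lemma entry_time_stopping: "B_stopping_time M B (entry_time X a d x)"
  unfolding B_stopping_time_def sets_past[symmetric]
proof (intro allI impI)
  fix t :: real assume t: "t \<ge> 0"
  \<comment> \<open>The times \<open>t * q\<close> with rational \<open>q\<close> stay in [0, t] and
    include its endpoints.\<close>
  let ?Q = "\<rat> \<inter> {0..1} :: real set"
  have Q: "countable ?Q" using countable_rat by blast
  have "{\<omega> \<in> space M. entry_time X a d x \<omega> \<le> ennreal t} =
    (\<Inter>n::nat. \<Union>q\<in>?Q. {\<omega> \<in> space M. X x (t * q) \<omega> \<in> {a - 1 / real (Suc n)..d + 1 / real (Suc n)}})" (is "?L = ?R")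
  proof (intro set_eqI iffI)
    fix \<omega> assume "\<omega> \<in> ?L"
    then have \<omega>: "\<omega> \<in> space M" and le: "entry_time X a d x \<omega> \<le> ennreal t" by auto
    obtain t0 where t0: "0 \<le> t0" "t0 \<le> t" "X x t0 \<omega> \<in> {a..d}"
      using \<omega> le by (cases rule: entry_time_cases[where a = a and d = d and x = x]) (auto simp: t top_unique)
    show "\<omega> \<in> ?R"
    proof
      fix n :: nat
      define e where "e = 1 / real (Suc n)"
      have e: "e > 0" by (simp add: e_def)
      have "\<exists>q\<in>?Q. \<bar>X x (t * q) \<omega> - X x t0 \<omega>\<bar> < e"
      proof (cases "t = 0")
        case True
        then have "\<bar>X x (t * 0) \<omega> - X x t0 \<omega>\<bar> < e" using t0 e by simp
        moreover have "0 \<in> ?Q" by simp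
        ultimately show ?thesis by blast
      next
        case False
        define p where "p = t0 / t"
        have p: "p \<in> {0..1}" "t * p = t0" using t0 False t by (auto simp: p_def)
        have c: "continuous_on {0..1} (\<lambda>q. X x (t * q) \<omega>)"
          by (rule continuous_on_compose2[OF X_continuous[OF \<omega>]]) (use t in \<open>auto intro!: continuous_intros\<close>)
        then obtain \<delta> where \<delta>: "\<delta> > 0" "\<And>q. q \<in> {0..1} \<Longrightarrow> dist q p < \<delta> \<Longrightarrow> dist (X x (t * q) \<omega>) (X x (t * p) \<omega>) < e"
          using p(1) e unfolding continuous_on_iff by metis
        have "max 0 (p - \<delta>) < min 1 (p + \<delta>)" using p \<delta> by auto
        then obtain q where q: "q \<in> \<rat>" "max 0 (p - \<delta>) < q" "q < min 1 (p + \<delta>)"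
          using Rats_dense_in_real by blast
        then have "q \<in> ?Q" "dist q p < \<delta>" by (auto simp: dist_real_def)
        then show ?thesis using \<delta>(2)[of q] p(2) by (auto simp: dist_real_def)
      qed
      then obtain q where q: "q \<in> ?Q" "\<bar>X x (t * q) \<omega> - X x t0 \<omega>\<bar> < e" by blast
      have "X x (t * q) \<omega> \<in> {a - e..d + e}" using q(2) t0(3) by (simp add: abs_less_iff)
      then show "\<omega> \<in> (\<Union>q\<in>?Q. {\<omega> \<in> space M. X x (t * q) \<omega> \<in> {a - 1 / real (Suc n)..d + 1 / real (Suc n)}})"
        using q(1) \<omega> unfolding e_def by blast
    qed
  next
    fix \<omega> assume R: "\<omega> \<in> ?R"
    then have \<omega>: "\<omega> \<in> space M" by blast
    have "\<exists>q\<in>{0..1}. X x (t * q) \<omega> \<in> {a - 1 / real (Suc n)..d + 1 / real (Suc n)}" for n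
      using R by blast
    then obtain q where q: "\<And>n. q n \<in> {0..1}" "\<And>n. X x (t * q n) \<omega> \<in> {a - 1 / real (Suc n)..d + 1 / real (Suc n)}"
      by metis
    \<comment> \<open>Near-visits accumulate at a time whose position lies in all enlarged
      intervals, a true visit.\<close>
    obtain l f where l: "l \<in> {0..1::real}" "strict_mono f" "(q \<circ> f) \<longlonglongrightarrow> l"
      using compact_imp_seq_compact[OF compact_Icc[of 0 "1::real"]] q(1) unfolding seq_compact_def by meson
    have "continuous_on {0..1} (\<lambda>q. X x (t * q) \<omega>)"
      by (rule continuous_on_compose2[OF X_continuous[OF \<omega>]]) (use t in \<open>auto intro!: continuous_intros\<close>)
    from continuous_on_tendsto_compose[OF this l(3,1)] q(1)
    have lim: "(\<lambda>n. X x (t * q (f n)) \<omega>) \<longlonglongrightarrow> X x (t * l) \<omega>" by simp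
    have z: "(\<lambda>n. 1 / real (Suc (f n))) \<longlonglongrightarrow> 0"
      using LIMSEQ_subseq_LIMSEQ[OF LIMSEQ_Suc[OF lim_1_over_n] l(2)] by (simp add: comp_def)
    have "a - 0 \<le> X x (t * l) \<omega>"
      by (rule LIMSEQ_le[OF tendsto_diff[OF tendsto_const z] lim]) (use q(2) in auto)
    moreover have "X x (t * l) \<omega> \<le> d + 0"
      by (rule LIMSEQ_le[OF lim tendsto_add[OF tendsto_const z]]) (use q(2) in auto)
    ultimately have "X x (t * l) \<omega> \<in> {a..d}" "0 \<le> t * l" using l t by auto
    then have "entry_time X a d x \<omega> \<le> ennreal (t * l)"
      unfolding entry_time_def by (intro Inf_lower) auto
    also have "\<dots> \<le> ennreal t" using l t by (intro ennreal_leI) (simp add: mult_left_le)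
    finally show "\<omega> \<in> ?L" using \<omega> by simp
  qed
  also have "\<dots> \<in> sets (past t)"
  proof -
    have m: "{\<omega> \<in> space M. X x (t * q) \<omega> \<in> {a - 1 / real (Suc n)..d + 1 / real (Suc n)}} \<in> sets (past t)"
      if "q \<in> ?Q" for n q
    proof -
      have "X x (t * q) \<in> borel_measurable (past t)"
        using that t by (intro X_past_measurable) (auto simp: mult_left_le)
      from measurable_sets[OF this, of "{a - 1 / real (Suc n)..d + 1 / real (Suc n)}"]
      show ?thesis by (simp add: vimage_def Int_def conj_commute)
    qed
    have "(\<Union>q\<in>?Q. {\<omega> \<in> space M. X x (t * q) \<omega> \<in> {a - 1 / real (Suc n)..d + 1 / real (Suc n)}}) \<in> sets (past t)" for n
      by (rule sets.countable_UN'[OF Q]) (use m in blast)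
    then show ?thesis by (intro sets.countable_INT) auto
  qed
  finally show "{\<omega> \<in> space M. entry_time X a d x \<omega> \<le> ennreal t} \<in> sets (past t)" .
qed

text \<open>By the intermediate value theorem a path started below \<open>a\<close> cannot exceed
  \<open>a\<close> without first visiting \<open>a\<close> itself.\<close>

lemma entry_time_from_below:
  assumes \<omega>: "\<omega> \<in> space M" and x: "x < a" "a \<le> d"
  shows "entry_time X a d x \<omega> \<noteq> \<infinity> \<Longrightarrow> X x (enn2real (entry_time X a d x \<omega>)) \<omega> = a"
    and "t \<ge> 0 \<Longrightarrow> ennreal t \<le> entry_time X a d x \<omega> \<Longrightarrow> X x t \<omega> \<le> a"
proof -
  have ivt: "\<exists>s. 0 \<le> s \<and> s \<le> t \<and> X x s \<omega> = a" if "t \<ge> 0" "X x t \<omega> \<ge> a" for t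
    using IVT'[of "\<lambda>t. X x t \<omega>" 0 a t] that x X_0[OF \<omega>] continuous_on_subset[OF X_continuous[OF \<omega>], of "{0..t}"]
    by auto
  have "(entry_time X a d x \<omega> \<noteq> \<infinity> \<longrightarrow> X x (enn2real (entry_time X a d x \<omega>)) \<omega> = a) \<and>
    (\<forall>t. t \<ge> 0 \<longrightarrow> ennreal t \<le> entry_time X a d x \<omega> \<longrightarrow> X x t \<omega> \<le> a)"
    using \<omega>
  proof (cases rule: entry_time_cases[where a = a and d = d and x = x])
    case never
    then have "X x t \<omega> \<le> a" if "t \<ge> 0" for t using ivt[of t] that x by force
    then show ?thesis using never by simp
  next
    case (at t0)
    have eq: "X x t0 \<omega> = a"
    proof -
      obtain s where s: "0 \<le> s" "s \<le> t0" "X x s \<omega> = a" using ivt[of t0] at by auto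
      then have "t0 \<le> s" using at(4)[of s] x by simp
      then show ?thesis using s by simp
    qed
    have "X x t \<omega> \<le> a" if t: "t \<ge> 0" "ennreal t \<le> entry_time X a d x \<omega>" for t
    proof (rule ccontr)
      assume n: "\<not> X x t \<omega> \<le> a"
      have "t \<le> t0" using t at by simp
      then have "t < t0" using n eq by (cases "t = t0") auto
      obtain s where s: "0 \<le> s" "s \<le> t" "X x s \<omega> = a" using ivt[of t] t n by auto
      then show False using at(4)[of s] x \<open>t < t0\<close> by simp
    qed
    then show ?thesis using at(1,2) eq by simp
  qed
  then show "entry_time X a d x \<omega> \<noteq> \<infinity> \<Longrightarrow> X x (enn2real (entry_time X a d x \<omega>)) \<omega> = a"
    and "t \<ge> 0 \<Longrightarrow> ennreal t \<le> entry_time X a d x \<omega> \<Longrightarrow> X x t \<omega> \<le> a" by auto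
qed

lemma entry_time_from_above:
  assumes \<omega>: "\<omega> \<in> space M" and x: "d < x" "a \<le> d"
  shows "entry_time X a d x \<omega> \<noteq> \<infinity> \<Longrightarrow> X x (enn2real (entry_time X a d x \<omega>)) \<omega> = d"
    and "t \<ge> 0 \<Longrightarrow> ennreal t \<le> entry_time X a d x \<omega> \<Longrightarrow> d \<le> X x t \<omega>"
proof -
  have ivt: "\<exists>s. 0 \<le> s \<and> s \<le> t \<and> X x s \<omega> = d" if "t \<ge> 0" "X x t \<omega> \<le> d" for t
    using IVT2'[of "\<lambda>t. X x t \<omega>" t d 0] that x X_0[OF \<omega>] continuous_on_subset[OF X_continuous[OF \<omega>], of "{0..t}"]
    by auto
  have "(entry_time X a d x \<omega> \<noteq> \<infinity> \<longrightarrow> X x (enn2real (entry_time X a d x \<omega>)) \<omega> = d) \<and>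
    (\<forall>t. t \<ge> 0 \<longrightarrow> ennreal t \<le> entry_time X a d x \<omega> \<longrightarrow> d \<le> X x t \<omega>)"
    using \<omega>
  proof (cases rule: entry_time_cases[where a = a and d = d and x = x])
    case never
    then have "d \<le> X x t \<omega>" if "t \<ge> 0" for t using ivt[of t] that x by force
    then show ?thesis using never by simp
  next
    case (at t0)
    have eq: "X x t0 \<omega> = d"
    proof -
      obtain s where s: "0 \<le> s" "s \<le> t0" "X x s \<omega> = d" using ivt[of t0] at by auto
      then have "t0 \<le> s" using at(4)[of s] x by simp
      then show ?thesis using s by simp
    qed
    have "d \<le> X x t \<omega>" if t: "t \<ge> 0" "ennreal t \<le> entry_time X a d x \<omega>" for t
    proof (rule ccontr)
      assume n: "\<not> d \<le> X x t \<omega>"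
      have "t \<le> t0" using t at by simp
      then have "t < t0" using n eq by (cases "t = t0") auto
      obtain s where s: "0 \<le> s" "s \<le> t" "X x s \<omega> = d" using ivt[of t] t n by auto
      then show False using at(4)[of s] x \<open>t < t0\<close> by simp
    qed
    then show ?thesis using at(1,2) eq by simp
  qed
  then show "entry_time X a d x \<omega> \<noteq> \<infinity> \<Longrightarrow> X x (enn2real (entry_time X a d x \<omega>)) \<omega> = d"
    and "t \<ge> 0 \<Longrightarrow> ennreal t \<le> entry_time X a d x \<omega> \<Longrightarrow> d \<le> X x t \<omega>" by auto
qed

text \<open>Stated for arbitrary \<open>g\<close> and \<open>a \<le> d\<close>: degenerate intervals
  serve the exit problem, [a, d] the entry problem.\<close>

lemma entry_reward:
  assumes "a \<le> d"
  shows "integral\<^sup>L M (disc_reward X r g (entry_time X a d x) x) =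
    (if x < a then g a / F a * F x else if x \<le> d then g x else g d / G d * G x)"
proof -
  consider "x < a" | "a \<le> x" "x \<le> d" | "d < x" by linarith
  then show ?thesis
  proof cases
    case 1
    have mono: "F y \<le> F a" if "y \<le> a" for y using F_strict_mono[of y a] that by (cases "y = a") auto
    have "integral\<^sup>L M (disc_reward X r g (entry_time X a d x) x) = g a / F a * F x"
      by (rule hitting_reward[OF _ entry_time_stopping])
         (use entry_time_from_below[OF _ 1 assms] mono in auto)
    then show ?thesis using 1 by simp
  next
    case 2
    have "entry_time X a d x \<omega> = 0" if "\<omega> \<in> space M" for \<omega>
    proof -
      have "entry_time X a d x \<omega> \<le> ennreal 0"
        unfolding entry_time_def by (rule Inf_lower, rule imageI) (use 2 X_0[OF that, of x] in simp)
      then show ?thesis by simp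
    qed
    then have "integral\<^sup>L M (disc_reward X r g (entry_time X a d x) x) = (\<integral>\<omega>. g x \<partial>M)"
      by (intro Bochner_Integration.integral_cong) (auto simp: disc_reward_def X_0)
    then show ?thesis using 2 by (simp add: prob_space)
  next
    case 3
    have mono: "G y \<le> G d" if "d \<le> y" for y using G_strict_antimono[of d y] that by (cases "y = d") auto
    have "integral\<^sup>L M (disc_reward X r g (entry_time X a d x) x) = g d / G d * G x"
      by (rule hitting_reward[OF _ entry_time_stopping])
         (use entry_time_from_above[OF _ 3 assms] mono in auto)
    then show ?thesis using 3 assms by simp
  qed
qed

end

theorem theorem3p2:
  fixes M :: "'a measure" and B :: "real \<Rightarrow> 'a \<Rightarrow> real"
    and X :: "real \<Rightarrow> real \<Rightarrow> 'a \<Rightarrow> real"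
    and \<mu> \<sigma> \<theta> r c\<^sub>s c\<^sub>b :: real
    and V J F G :: "real \<Rightarrow> real"
  assumes BM: "brownian_motion M B"
    and OU: "OU_process M B \<mu> \<theta> \<sigma> X"
    and pos: "\<mu> > 0" "\<sigma> > 0" "r > 0" "c\<^sub>s > 0" "c\<^sub>b > 0"
    and F_def: "F = OU_F \<mu> \<sigma> \<theta> r"
    and G_def: "G = OU_G \<mu> \<sigma> \<theta> r"
    and V_def: "V = opt_stop_value M B X r (\<lambda>y. exp y - c\<^sub>s)"
    and J_def: "J = opt_stop_value M B X r (\<lambda>y. V y - exp y - c\<^sub>b)"
    and sup_pos: "(SUP x. V x - exp x - c\<^sub>b) > 0"
  shows "\<exists>a d. a \<le> d \<and>
     (\<exists>V'a. (V has_real_derivative V'a) (at a) \<and>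
        F a * (V'a - exp a) = deriv F a * (V a - (exp a + c\<^sub>b))) \<and>
     (\<exists>V'd. (V has_real_derivative V'd) (at d) \<and>
        G d * (V'd - exp d) = deriv G d * (V d - (exp d + c\<^sub>b))) \<and>
     (let P = (V a - (exp a + c\<^sub>b)) / F a; Q = (V d - (exp d + c\<^sub>b)) / G d in
       \<forall>x. J x = (if x < a then P * F x
                  else if x \<le> d then V x - (exp x + c\<^sub>b)
                  else Q * G x)) \<and>
     (\<forall>x. B_stopping_time M B (entry_time X a d x) \<and>
          J x = integral\<^sup>L M (disc_reward X r (\<lambda>y. V y - exp y - c\<^sub>b) (entry_time X a d x) x))"
proof -
  note FG = F_def G_def
  interpret ou M B \<mu> \<sigma> \<theta> r X
    using BM OU pos by unfold_locales
  have F: "F = ou_params.F \<mu> \<sigma> \<theta> r" and G: "G = ou_params.G \<mu> \<sigma> \<theta> r"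
    by (simp_all add: FG OU_F_eq OU_G_eq)
  obtain b where "ou_exit \<mu> \<sigma> \<theta> r c\<^sub>s b"
    using exists_exit_level[OF pos(4)] pos ou_params_axioms
    unfolding ou_exit_def ou_exit_axioms_def by metis
  then interpret ou_exit \<mu> \<sigma> \<theta> r "c\<^sub>s" b .
  have V: "V = W"
  proof
    fix x
    show "V x = W x"
    proof (cases "x \<le> b")
      case True
      \<comment> \<open>Up to \<open>b\<close> the optimal exit is the hitting time of the level
        \<open>b\<close>, an entry into [b, b].\<close>
      show ?thesis unfolding V_def
        by (rule opt_stop_value_eq[OF superharmonic_W W_continuous W_ge entry_time_stopping[of b b x]])
           (use True in \<open>auto simp: entry_reward W_def K_def\<close>)
    next
      case False
      \<comment> \<open>Above \<open>b\<close> stopping at once is optimal: entry into [x, x]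
        happens at time 0. The attaining time may vary with the start.\<close>
      show ?thesis unfolding V_def
        by (rule opt_stop_value_eq[OF superharmonic_W W_continuous W_ge entry_time_stopping[of x x x]])
           (use False in \<open>auto simp: entry_reward W_def\<close>)
    qed
  qed
  obtain x0 where x0: "W x0 - exp x0 - c\<^sub>b > 0"
  proof -
    \<comment> \<open>Boundedness is what turns a positive real supremum into a point with a
      positive value.\<close>
    have "bdd_above (range (\<lambda>x. V x - exp x - c\<^sub>b))"
      unfolding V using W_minus_exp_bounded by (intro bdd_aboveI2[of _ _ "K * ou_params.F \<mu> \<sigma> \<theta> r b - c\<^sub>b"]) simp
    then show ?thesis using sup_pos that V by (auto simp: less_cSUP_iff)
  qed
  obtain a d where "ou_entry \<mu> \<sigma> \<theta> r c\<^sub>s b c\<^sub>b a d"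
    using exists_entry_levels[OF pos(5) x0] by blast
  then interpret ou_entry \<mu> \<sigma> \<theta> r "c\<^sub>s" b "c\<^sub>b" a d .
  have g: "(\<lambda>y. V y - exp y - c\<^sub>b) = h" by (simp add: V h_def fun_eq_iff)
  have reward: "integral\<^sup>L M (disc_reward X r h (entry_time X a d x) x) = Y x" for x
    unfolding entry_reward[OF a_le_d] by (simp add: Y_def P_def Q_def)
  have J: "J x = Y x" for x
    unfolding J_def g
    by (rule opt_stop_value_eq[OF superharmonic_Y Y_continuous Y_ge entry_time_stopping reward])
  have ha: "V y - (exp y + c\<^sub>b) = h y" for y by (simp add: V h_def)
  have V'a: "F a * (W' a - exp a) = deriv F a * (V a - (exp a + c\<^sub>b))"
    using h'_a P_F_a unfolding F ha DERIV_imp_deriv[OF F_DERIV] h'_def by simp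
  have V'd: "G d * (W' d - exp d) = deriv G d * (V d - (exp d + c\<^sub>b))"
    using h'_d Q_G_d unfolding G ha DERIV_imp_deriv[OF G_DERIV] h'_def by simp
  have "J x = (if x < a then (V a - (exp a + c\<^sub>b)) / F a * F x
      else if x \<le> d then V x - (exp x + c\<^sub>b) else (V d - (exp d + c\<^sub>b)) / G d * G x)" for x
    unfolding J ha F G by (simp add: Y_def P_def Q_def)
  moreover have "B_stopping_time M B (entry_time X a d x) \<and>
      J x = integral\<^sup>L M (disc_reward X r (\<lambda>y. V y - exp y - c\<^sub>b) (entry_time X a d x) x)" for x
    unfolding g reward J using entry_time_stopping by simp
  ultimately show ?thesis
    unfolding Let_def using a_le_d V'a V'd W_DERIV V by blast
qed

end
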